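(* Let $0<\alpha<4$ and let $u\in L^1_{\mathrm{loc}}(\mathbb R^4)$ be a normal finite-mass solution of $$\Delta^2u=\left(\int_{\mathbb R^4}\frac{e^{u(y)}}{|x-y|^\alpha}\,dy\right)e^{u(x)}\quad\text{in }\mathbb R^4 .$$ Put $b_\alpha:=\frac{8-\alpha}2$ and $v(x):=\frac1{b_\alpha}\left(u(x)-\frac12\log b_\alpha\right)$. Then $v$ is a classical solution of $$\Delta^2v=\left(\int_{\mathbb R^4}\frac{e^{b_\alpha v(y)}}{|x-y|^\alpha}\,dy\right)e^{b_\alpha v(x)}\quad\text{in }\mathbb R^4,$$ and it satisfies $v(x)=o(|x|^2)$ as $|x|\to\infty$, $$\int_{\mathbb R^4}e^{b_\alpha v(x)}\,dx<+\infty,$$ together with $$\int_{\mathbb R^4}\int_{\mathbb R^4}\frac{e^{b_\alpha v(x)}e^{b_\alpha v(y)}}{|x-y|^\alpha}\,dx\,dy<+\infty .$$ Consequently, Niu's published classification theorem for the higher-order critical exponential Choquard equation applies (to $v$).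
   Context: All functions are real-valued. For a solution $u$ put $F(x)=\left(\int_{\mathbb R^4}\frac{e^{u(y)}}{|x-y|^\alpha}dy\right)e^{u(x)}$. A distributional solution of the equation is $u\in L^1_{\mathrm{loc}}(\mathbb R^4)$ with $F\in L^1_{\mathrm{loc}}(\mathbb R^4)$ and $\int_{\mathbb R^4} u\,\Delta^2\varphi\,dx=\int_{\mathbb R^4} F\varphi\,dx$ for all $\varphi\in C_c^\infty(\mathbb R^4)$. A normal finite-mass solution is a distributional solution with $\int_{\mathbb R^4}e^{\frac8{8-\alpha}u}dx<\infty$ and $$u(x)=-\frac1{8\pi^2}\int_{\mathbb R^4}\log|x-y|\,F(y)\,dy+C$$ for some $C\in\mathbb R$, where the integral is finite for every $x\in\mathbb R^4$. Niu's published classification theorem is an external result from the literature on a family of higher-order critical Choquard equations, of which the equation for $v$ is the four-dimensional member. It is formulated for classical solutions satisfying a subquadratic growth assumption and two global integrability conditions, which here are the conditions on $v$ listed in the claim. In the present situation it is used to conclude that there exist $\mu>0$, $\zeta\in\mathbb R^4$ and $c>0$ such that $u(x)=\frac{8-\alpha}{2}\log\left(\frac{c\mu}{1+\mu^2|x-\zeta|^2}\right)$. *)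

theory Defs
  imports "HOL-Analysis.Analysis" "HOL-Library.Landau_Symbols"
begin

section \<open>Partial derivatives, the bilaplacian and test functions\<close>

definition partial_deriv :: "'a::euclidean_space \<Rightarrow> ('a \<Rightarrow> real) \<Rightarrow> 'a \<Rightarrow> real" where
  "partial_deriv b f x = frechet_derivative f (at x) b"

definition laplacian :: "('a::euclidean_space \<Rightarrow> real) \<Rightarrow> 'a \<Rightarrow> real" where
  "laplacian f x = (\<Sum>b\<in>Basis. partial_deriv b (partial_deriv b f) x)"

definition bilaplacian :: "('a::euclidean_space \<Rightarrow> real) \<Rightarrow> 'a \<Rightarrow> real" where
  "bilaplacian f = laplacian (laplacian f)"

text \<open>The class \<open>C\<^sup>k\<close> on the whole space.\<close>

primrec C_diff :: "nat \<Rightarrow> ('a::euclidean_space \<Rightarrow> real) \<Rightarrow> bool" where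
  "C_diff 0 f \<longleftrightarrow> continuous_on UNIV f"
| "C_diff (Suc k) f \<longleftrightarrow>
     (\<forall>x. f differentiable (at x)) \<and> (\<forall>b\<in>Basis. C_diff k (partial_deriv b f))"

definition test_function :: "('a::euclidean_space \<Rightarrow> real) \<Rightarrow> bool" where
  "test_function \<phi> \<longleftrightarrow> (\<forall>k. C_diff k \<phi>) \<and> compact (closure {x. \<phi> x \<noteq> 0})"

definition locally_integrable :: "('a::euclidean_space \<Rightarrow> real) \<Rightarrow> bool" where
  "locally_integrable f \<longleftrightarrow> (\<forall>K. compact K \<longrightarrow> f absolutely_integrable_on K)"

section \<open>The critical exponential Choquard equation in dimension four\<close>

text \<open>
  The Choquard term of \<open>w\<close> is \<open>F(x) = (\<integral> exp (w y) / |x - y|\<^sup>\<alpha> dy) exp (w x)\<close>.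
  The Bochner integral takes the value 0 on non-integrable functions, so every use of
  \<open>choquard_term\<close> below is accompanied by \<open>choquard_finite\<close>, which says that the (nonnegative)
  integral is really finite at the point: almost everywhere for distributional solutions, and
  everywhere for classical ones. Division by zero at \<open>y = x\<close> only concerns a null set.
\<close>

definition choquard_finite :: "real \<Rightarrow> (real^4 \<Rightarrow> real) \<Rightarrow> real^4 \<Rightarrow> bool" where
  "choquard_finite \<alpha> w x \<longleftrightarrow> integrable lebesgue (\<lambda>y. exp (w y) / norm (x - y) powr \<alpha>)"

definition choquard_term :: "real \<Rightarrow> (real^4 \<Rightarrow> real) \<Rightarrow> real^4 \<Rightarrow> real" where
  "choquard_term \<alpha> w x = (LINT y|lebesgue. exp (w y) / norm (x - y) powr \<alpha>) * exp (w x)"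

definition distributional_solution :: "real \<Rightarrow> (real^4 \<Rightarrow> real) \<Rightarrow> bool" where
  "distributional_solution \<alpha> u \<longleftrightarrow>
     locally_integrable u \<and>
     (AE x in lebesgue. choquard_finite \<alpha> u x) \<and>
     locally_integrable (choquard_term \<alpha> u) \<and>
     (\<forall>\<phi>. test_function \<phi> \<longrightarrow>
        (LINT x|lebesgue. u x * bilaplacian \<phi> x) = (LINT x|lebesgue. choquard_term \<alpha> u x * \<phi> x))"

definition normal_finite_mass_solution :: "real \<Rightarrow> (real^4 \<Rightarrow> real) \<Rightarrow> bool" where
  "normal_finite_mass_solution \<alpha> u \<longleftrightarrow>
     distributional_solution \<alpha> u \<and>
     integrable lebesgue (\<lambda>x. exp (8 / (8 - \<alpha>) * u x)) \<and>
     (\<exists>C. \<forall>x. integrable lebesgue (\<lambda>y. ln (norm (x - y)) * choquard_term \<alpha> u y) \<and>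
        u x = - (1 / (8 * pi\<^sup>2)) * (LINT y|lebesgue. ln (norm (x - y)) * choquard_term \<alpha> u y) + C)"

text \<open>
  Classical solutions of \<open>\<Delta>\<^sup>2 w = (\<integral> exp (b w(y)) / |x - y|\<^sup>\<alpha> dy) exp (b w(x))\<close>.
\<close>

definition classical_solution :: "real \<Rightarrow> real \<Rightarrow> (real^4 \<Rightarrow> real) \<Rightarrow> bool" where
  "classical_solution \<alpha> b w \<longleftrightarrow>
     C_diff 4 w \<and>
     (\<forall>x. choquard_finite \<alpha> (\<lambda>y. b * w y) x \<and>
          bilaplacian w x = choquard_term \<alpha> (\<lambda>y. b * w y) x)"

section \<open>Niu's classification theorem\<close>

definition niu_hypotheses :: "real \<Rightarrow> (real^4 \<Rightarrow> real) \<Rightarrow> bool" where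
  "niu_hypotheses \<alpha> w \<longleftrightarrow>
     0 < \<alpha> \<and> \<alpha> < 4 \<and>
     classical_solution \<alpha> ((8 - \<alpha>) / 2) w \<and>
     w \<in> o[at_infinity](\<lambda>x. (norm x)\<^sup>2) \<and>
     integrable lebesgue (\<lambda>x. exp ((8 - \<alpha>) / 2 * w x)) \<and>
     (\<integral>\<^sup>+ y. \<integral>\<^sup>+ x. ennreal (exp ((8 - \<alpha>) / 2 * w x) * exp ((8 - \<alpha>) / 2 * w y)
        / norm (x - y) powr \<alpha>) \<partial>lebesgue \<partial>lebesgue) < \<infinity>"

text \<open>
  The assertion of Niu's theorem in dimension four for the exponent \<open>\<alpha>\<close>. It is an external
  result; here it is only a proposition, which is not asserted to hold.
\<close>

definition niu_classification :: "real \<Rightarrow> bool" where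
  "niu_classification \<alpha> \<longleftrightarrow>
     (\<forall>w. niu_hypotheses \<alpha> w \<longrightarrow>
        (\<exists>\<mu>>0. \<exists>\<zeta>. \<exists>c>0. \<forall>x. w x = ln (c * \<mu> / (1 + \<mu>\<^sup>2 * (norm (x - \<zeta>))\<^sup>2))))"

end

theory Submission
  imports Defs
begin

text \<open>
  Write \<open>F\<close> for the Choquard term, \<open>I\<close> for its integral factor, \<open>c\<^sub>0 = 1 / (8 \<pi>\<^sup>2)\<close> and \<open>M = \<integral> F\<close>,
  which is finite because \<open>F\<close> is integrable against the logarithm. Balls of a small fixed radius
  carry little \<open>F\<close>-mass, so Jensen's inequality in the representation formula bounds \<open>e\<^sup>p\<^sup>u\<close>
  in \<open>L\<^sup>1\<close> of unit balls for every \<open>p\<close>, uniformly in the centre; Young's inequality together with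
  the finite mass then bounds \<open>I\<close>, and hence \<open>u\<close> from above and \<open>F\<close>. Now \<open>u\<close> is Lipschitz, so
  \<open>e\<^sup>u\<close>, \<open>I\<close> and \<open>F\<close> vary slowly, all derivatives in the convolutions may be moved to the
  density, and a bootstrap gives smoothness; the equation holds pointwise by testing with bumps.
  The integrability of \<open>e\<^sup>u\<close> does not follow from the mass condition alone. It follows from the
  Pohozaev identity \<open>c\<^sub>0 M = 8 - \<alpha>\<close>, since \<open>u\<close> behaves like \<open>- c\<^sub>0 M ln \<bar>x\<bar>\<close> at infinity and
  \<open>8 - \<alpha> > 4\<close>.
\<close>

section \<open>Singular integrals\<close>

text \<open>The gap that the Pohozaev identity closes shows on the model case where
  \<open>exp (u x)\<close> decays like \<open>norm x powr (- m)\<close> with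
  \<open>m = c0 * M\<close>. The mass condition then asks for
  \<open>8 * m / (8 - \<alpha>) > 4\<close>, that is \<open>m > (8 - \<alpha>) / 2\<close>, a
  threshold below 4, whereas integrability of \<open>exp u\<close> needs \<open>m > 4\<close>. Since
  that integrability is the goal, the identity has to be derived without it. The dilation field is
  unbounded and the gradient of the kernel may be too singular, so one parameter \<delta> truncates
  the field and another, \<epsilon>, smooths the kernel. Both are removed by dominated convergence,
  \<epsilon> before \<delta>. The dominating functions are multiples of \<open>F\<close>, of
  \<open>F x * F y\<close> and of the interaction density \<open>P\<close>, and all of these are
  integrable as soon as \<open>M\<close> is finite. The same finiteness of \<open>M\<close> gives
  the double integral condition for \<open>v\<close>.\<close>

abbreviation lborel2 :: "('a::euclidean_space \<times> 'b::euclidean_space) measure" where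
  "lborel2 \<equiv> lborel \<Otimes>\<^sub>M lborel"

text \<open>Written through \<open>norm (x - y)\<close>, so that integrals in \<open>y\<close> are
  convolutions and translation reduces them to one centre. The result type stays open because real
  and extended nonnegative integrands both use it.\<close>

abbreviation near :: "'a::real_normed_vector \<Rightarrow> 'a \<Rightarrow> 'b::zero_neq_one" where
  "near x y \<equiv> indicator {..<1} (norm (x - y))"

lemmas integrable_dominated = Bochner_Integration.integrable_bound

lemma ball_measurable [measurable]: "ball (x::'a::metric_space) r \<in> sets borel"
  by simp

section \<open>Reflections and translations of Lebesgue measure\<close>

lemma distr_lborel_minus: "distr lborel borel (\<lambda>y::'a::euclidean_space. x - y) = lborel"
  using lborel_affine[of "-1" x] by (simp add: density_1)

lemma nn_integral_lborel_diff:
  fixes f :: "'a::euclidean_space \<Rightarrow> ennreal"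
  assumes [measurable]: "f \<in> borel_measurable borel"
  shows "(\<integral>\<^sup>+y. f (x - y) \<partial>lborel) = (\<integral>\<^sup>+y. f y \<partial>lborel)"
  by (subst (2) distr_lborel_minus[of x, symmetric], subst nn_integral_distr) auto

lemma nn_integral_lborel_shift:
  fixes f :: "'a::euclidean_space \<Rightarrow> ennreal"
  assumes [measurable]: "f \<in> borel_measurable borel"
  shows "(\<integral>\<^sup>+y. f (x + y) \<partial>lborel) = (\<integral>\<^sup>+y. f y \<partial>lborel)"
  by (subst (2) lborel_distr_plus[of x, symmetric], subst nn_integral_distr) auto

lemma integrable_lborel_diff_iff:
  fixes f :: "'a::euclidean_space \<Rightarrow> real"
  assumes [measurable]: "f \<in> borel_measurable borel"
  shows "integrable lborel (\<lambda>y. f (x - y)) \<longleftrightarrow> integrable lborel f"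
  using integrable_distr_eq[of "\<lambda>y. x - y" lborel borel f] by (simp add: distr_lborel_minus)

lemma integral_lborel_diff:
  fixes f :: "'a::euclidean_space \<Rightarrow> real"
  assumes [measurable]: "f \<in> borel_measurable borel"
  shows "(LBINT y. f (x - y)) = (LBINT y. f y)"
  using integral_distr[of "\<lambda>y. x - y" lborel borel f] by (simp add: distr_lborel_minus)

lemma integrable_lborel_shift_iff:
  fixes f :: "'a::euclidean_space \<Rightarrow> real"
  assumes [measurable]: "f \<in> borel_measurable borel"
  shows "integrable lborel (\<lambda>y. f (x + y)) \<longleftrightarrow> integrable lborel f"
  using integrable_distr_eq[of "\<lambda>y. x + y" lborel borel f] by (simp add: lborel_distr_plus)

lemma integral_lborel_shift:
  fixes f :: "'a::euclidean_space \<Rightarrow> real"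
  assumes [measurable]: "f \<in> borel_measurable borel"
  shows "(LBINT y. f (x + y)) = (LBINT y. f y)"
  using integral_distr[of "\<lambda>y. x + y" lborel borel f] by (simp add: lborel_distr_plus)

section \<open>Powers of the norm, by reduction to one dimension\<close>

lemma nn_integral_even_real:
  fixes f :: "real \<Rightarrow> ennreal"
  assumes [measurable]: "f \<in> borel_measurable borel"
  shows "(\<integral>\<^sup>+t. f \<bar>t\<bar> \<partial>lborel) \<le> 2 * (\<integral>\<^sup>+t. f t * indicator {0..} t \<partial>lborel)"
proof -
  have "(\<integral>\<^sup>+t. f \<bar>t\<bar> \<partial>lborel)
      \<le> (\<integral>\<^sup>+t. f t * indicator {0..} t + f (0 - t) * indicator {0..} (0 - t) \<partial>lborel)"
    by (intro nn_integral_mono) (auto simp: indicator_def)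
  also have "\<dots> = (\<integral>\<^sup>+t. f t * indicator {0..} t \<partial>lborel) + (\<integral>\<^sup>+t. f (0 - t) * indicator {0..} (0 - t) \<partial>lborel)"
    by (rule nn_integral_add) auto
  also have "(\<integral>\<^sup>+t. f (0 - t) * indicator {0..} (0 - t) \<partial>lborel) = (\<integral>\<^sup>+t. f t * indicator {0..} t \<partial>lborel)"
    by (rule nn_integral_lborel_diff) auto
  finally show ?thesis by (simp add: mult_2)
qed

text \<open>The value \<infinity> at the null set \<open>{0}\<close> serves the product bound in
  \<open>nn_integral_inverse_powr_ball\<close>: since \<open>0 powr (-a)\<close> is 0, a plain power
  would make the majorant vanish on the coordinate hyperplanes.\<close>

lemma nn_integral_powr_unit_interval:
  assumes "0 \<le> a" "a < 1"
  shows "(\<integral>\<^sup>+t. (if t = 0 then \<infinity> else ennreal (\<bar>t\<bar> powr (-a)) * indicator {-1..1} t) \<partial>lborel) < \<infinity>"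
proof -
  have "((\<lambda>t::real. t powr (-a)) has_integral (1 powr (-a+1) / (-a+1))) {0..1}"
    using assms by (intro has_integral_powr_from_0) auto
  then have 1: "(\<integral>\<^sup>+t. ennreal (t powr (-a)) * indicator {0..1} t \<partial>lborel) = ennreal (1 powr (-a+1) / (-a+1))"
    by (intro nn_integral_has_integral_lebesgue') auto
  have "(\<integral>\<^sup>+t. (if t = 0 then \<infinity> else ennreal (\<bar>t\<bar> powr (-a)) * indicator {-1..1} t) \<partial>lborel)
    = (\<integral>\<^sup>+t. ennreal (\<bar>t\<bar> powr (-a)) * indicator {0..1} \<bar>t\<bar> \<partial>lborel)"
    by (intro nn_integral_cong_AE eventually_mono[OF AE_lborel_singleton[of 0]]) (auto simp: indicator_def)
  also have "\<dots> \<le> 2 * (\<integral>\<^sup>+t. (ennreal (t powr (-a)) * indicator {0..1} t) * indicator {0..} t \<partial>lborel)"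
    by (rule nn_integral_even_real) auto
  also have "(\<integral>\<^sup>+t. (ennreal (t powr (-a)) * indicator {0..1} t) * indicator {0..} t \<partial>lborel)
     = (\<integral>\<^sup>+t. ennreal (t powr (-a)) * indicator {0..1} t \<partial>lborel)"
    by (intro nn_integral_cong) (auto simp: indicator_def)
  also note 1
  finally show ?thesis by (auto simp: ennreal_mult_less_top intro: le_less_trans)
qed

lemma nn_integral_powr_tail:
  assumes "1 < a"
  shows "(\<integral>\<^sup>+t. ennreal ((1 + \<bar>t\<bar>) powr (-a)) \<partial>lborel) < \<infinity>"
proof -
  have "((\<lambda>t::real. t powr (-a)) has_integral (-(1 powr (-a+1)) / (-a+1))) {1..}"
    using assms by (intro has_integral_powr_to_inf) auto
  then have 1: "(\<integral>\<^sup>+t. ennreal (t powr (-a)) * indicator {1..} t \<partial>lborel) = ennreal (-(1 powr (-a+1)) / (-a+1))"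
    by (intro nn_integral_has_integral_lebesgue') auto
  have "(\<integral>\<^sup>+t. ennreal ((1 + \<bar>t\<bar>) powr (-a)) \<partial>lborel)
    \<le> 2 * (\<integral>\<^sup>+t. ennreal ((1 + t) powr (-a)) * indicator {0..} t \<partial>lborel)"
    by (rule nn_integral_even_real) auto
  also have "(\<integral>\<^sup>+t. ennreal ((1 + t) powr (-a)) * indicator {0..} t \<partial>lborel)
    = (\<integral>\<^sup>+t. ennreal ((1 + t) powr (-a)) * indicator {1..} (1 + t) \<partial>lborel)"
    by (intro nn_integral_cong) (auto simp: indicator_def)
  also have "\<dots> = (\<integral>\<^sup>+t. ennreal (t powr (-a)) * indicator {1..} t \<partial>lborel)"
    by (rule nn_integral_lborel_shift) auto
  also note 1
  finally show ?thesis by (auto simp: ennreal_mult_less_top intro: le_less_trans)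
qed

lemma prod_ennreal_less_top:
  assumes "finite A" "\<And>b. b \<in> A \<Longrightarrow> f b < (\<infinity>::ennreal)"
  shows "(\<Prod>b\<in>A. f b) < \<infinity>"
  using assms by (induction A) (auto simp: ennreal_mult_less_top)

text \<open>Because \<open>\<bar>z \<bullet> b\<bar> \<le> norm z\<close>, splitting
  \<open>norm z powr (-s)\<close> into \<open>n\<close> equal factors, \<open>n\<close> the
  dimension, bounds it by the product of the \<open>\<bar>z \<bullet> b\<bar> powr (-(s/n))\<close>.
  The integral of the product factorises, and \<open>s/n < 1\<close> makes each factor finite. This
  replaces polar coordinates.\<close>

lemma nn_integral_inverse_powr_ball:
  fixes s :: real
  assumes "0 \<le> s" "s < DIM('a::euclidean_space)"
  shows "(\<integral>\<^sup>+(z::'a). ennreal (1 / norm z powr s) * indicator (ball 0 1) z \<partial>lborel) < \<infinity>"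
proof -
  let ?n = "real DIM('a)"
  define f :: "real \<Rightarrow> ennreal" where
    "f t = (if t = 0 then \<infinity> else ennreal (\<bar>t\<bar> powr (-(s/?n))) * indicator {-1..1} t)" for t
  have [measurable]: "f \<in> borel_measurable borel" unfolding f_def by measurable
  have "ennreal (1 / norm z powr s) * indicator (ball 0 1) z \<le> (\<Prod>b\<in>Basis. f (z \<bullet> b))" for z :: 'a
  proof (cases "z \<in> ball 0 1")
    case True
    have le: "\<bar>z \<bullet> b\<bar> \<le> norm z" if "b \<in> Basis" for b using Basis_le_norm[OF that] .
    have f1: "f t \<ge> 1" if "\<bar>t\<bar> \<le> 1" for t
    proof -
      have "\<bar>t\<bar> powr (-(s/?n)) \<ge> 1" if "t \<noteq> 0"
      proof -
        have "1 = 1 powr (-(s/?n))" by simp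
        also have "\<dots> \<le> \<bar>t\<bar> powr (-(s/?n))"
          by (rule powr_mono2') (use assms that \<open>\<bar>t\<bar> \<le> 1\<close> in auto)
        finally show ?thesis .
      qed
      then show ?thesis using \<open>\<bar>t\<bar> \<le> 1\<close> by (auto simp: f_def indicator_def ennreal_ge_1)
    qed
    have z1: "\<bar>z \<bullet> b\<bar> \<le> 1" if "b \<in> Basis" for b using le[OF that] True by simp
    show ?thesis
    proof (cases "\<exists>b\<in>Basis. z \<bullet> b = 0")
      case True
      then obtain b where b: "b \<in> Basis" "z \<bullet> b = 0" by auto
      have "(\<Prod>c\<in>Basis. f (z \<bullet> c)) = f (z \<bullet> b) * (\<Prod>c\<in>Basis-{b}. f (z \<bullet> c))"
        by (rule prod.remove) (use b in auto)
      \<comment> \<open>The other factors must not vanish, as \<open>\<infinity> * 0 = 0\<close> in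
        \<open>ennreal\<close>; this is the purpose of \<open>f1\<close>.\<close>
      moreover have "(\<Prod>c\<in>Basis-{b}. f (z \<bullet> c)) \<ge> 1"
        by (rule prod_ge_1) (use f1 z1 in auto)
      ultimately have "(\<Prod>c\<in>Basis. f (z \<bullet> c)) = \<infinity>"
        using b by (metis (no_types, lifting) ennreal_top_mult f_def infinity_ennreal_def not_one_le_zero)
      then show ?thesis by simp
    next
      case False
      have n0: "norm z > 0" using False SOME_Basis by fastforce
      have "1 / norm z powr s = norm z powr (-s)" by (simp add: powr_minus_divide)
      also have "\<dots> = (\<Prod>b\<in>(Basis::'a set). norm z powr (-(s/?n)))"
        using n0 by (simp add: powr_power)
      also have "\<dots> \<le> (\<Prod>b\<in>Basis. \<bar>z \<bullet> b\<bar> powr (-(s/?n)))"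
        using False assms by (intro prod_mono conjI powr_mono2' le) auto
      finally have "ennreal (1 / norm z powr s) \<le> ennreal (\<Prod>b\<in>Basis. \<bar>z \<bullet> b\<bar> powr (-(s/?n)))"
        by (rule ennreal_leI)
      also have "\<dots> = (\<Prod>b\<in>Basis. ennreal (\<bar>z \<bullet> b\<bar> powr (-(s/?n))))"
        by (rule prod_ennreal[symmetric]) auto
      also have "\<dots> = (\<Prod>b\<in>Basis. f (z \<bullet> b))"
        using False z1 by (intro prod.cong) (auto simp: f_def indicator_def abs_le_iff)
      finally show ?thesis using \<open>z \<in> ball 0 1\<close> by simp
    qed
  qed simp
  then have "(\<integral>\<^sup>+(z::'a). ennreal (1 / norm z powr s) * indicator (ball 0 1) z \<partial>lborel)
     \<le> (\<integral>\<^sup>+(z::'a). (\<Prod>b\<in>Basis. f (z \<bullet> b)) \<partial>lborel)"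
    by (intro nn_integral_mono) auto
  also have "\<dots> = (\<Prod>b\<in>(Basis::'a set). (\<integral>\<^sup>+t. f t \<partial>lborel))"
    by (rule nn_integral_lborel_prod) auto
  also have "\<dots> < \<infinity>"
    unfolding f_def using assms
    by (intro prod_ennreal_less_top nn_integral_powr_unit_interval) auto
  finally show ?thesis .
qed

text \<open>The same splitting over the coordinates, now with
  \<open>1 + \<bar>z \<bullet> b\<bar> \<le> 1 + norm z\<close> and one-dimensional exponents
  \<open>s/n > 1\<close>.\<close>

lemma integrable_powr_tail:
  fixes s :: real
  assumes "s > DIM('a::euclidean_space)"
  shows "integrable lborel (\<lambda>z::'a. (1 + norm z) powr (-s))"
proof -
  let ?n = "real DIM('a)"
  have le: "ennreal ((1 + norm z) powr (-s)) \<le> (\<Prod>b\<in>Basis. ennreal ((1 + \<bar>z \<bullet> b\<bar>) powr (-(s/?n))))" for z :: 'a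
  proof -
    have "(1 + norm z) powr (-s) = (\<Prod>b\<in>(Basis::'a set). (1 + norm z) powr (-(s/?n)))"
      by (simp add: powr_power add_nonneg_eq_0_iff)
    also have "\<dots> \<le> (\<Prod>b\<in>Basis. (1 + \<bar>z \<bullet> b\<bar>) powr (-(s/?n)))"
      using assms by (intro prod_mono conjI powr_mono2') (auto simp: Basis_le_norm)
    finally show ?thesis by (subst prod_ennreal) (auto intro!: ennreal_leI)
  qed
  have "(\<integral>\<^sup>+(z::'a). ennreal ((1 + norm z) powr (-s)) \<partial>lborel)
     \<le> (\<integral>\<^sup>+(z::'a). (\<Prod>b\<in>Basis. ennreal ((1 + \<bar>z \<bullet> b\<bar>) powr (-(s/?n)))) \<partial>lborel)"
    by (intro nn_integral_mono le)
  also have "\<dots> = (\<Prod>b\<in>(Basis::'a set). (\<integral>\<^sup>+t. ennreal ((1 + \<bar>t\<bar>) powr (-(s/?n))) \<partial>lborel))"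
    by (rule nn_integral_lborel_prod) auto
  also have "\<dots> < \<infinity>"
    using assms by (intro prod_ennreal_less_top nn_integral_powr_tail) auto
  finally show ?thesis by (intro integrableI_nonneg) auto
qed

lemma inverse_powr_ball_bound:
  fixes s :: real
  assumes "0 \<le> s" "s < DIM('a::euclidean_space)"
  shows "\<exists>K\<ge>0. \<forall>x::'a. (\<integral>\<^sup>+y. ennreal (1 / norm (x - y) powr s) * near x y \<partial>lborel) \<le> ennreal K"
proof -
  define K where "K = (\<integral>\<^sup>+(z::'a). ennreal (1 / norm z powr s) * indicator {..<1} (norm z) \<partial>lborel)"
  have "(\<integral>\<^sup>+y. ennreal (1 / norm (x - y) powr s) * near x y \<partial>lborel) = K" for x :: 'a
    unfolding K_def by (rule nn_integral_lborel_diff) measurable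
  moreover have "K = (\<integral>\<^sup>+(z::'a). ennreal (1 / norm z powr s) * indicator (ball 0 1) z \<partial>lborel)"
    unfolding K_def by (intro nn_integral_cong) (auto simp: indicator_def)
  then have "K < \<infinity>" using nn_integral_inverse_powr_ball[OF assms] by simp
  ultimately show ?thesis by (intro exI[of _ "enn2real K"]) (auto simp: less_top)
qed

lemma inverse_powr_tail_bound:
  fixes s :: real
  assumes s: "s > DIM('a::euclidean_space)"
  shows "\<exists>K\<ge>0. \<forall>x::'a. (\<integral>\<^sup>+y. ennreal (1 / norm (x - y) powr s) * indicator {1..} (norm (x - y)) \<partial>lborel) \<le> ennreal K"
proof -
  define K where "K = (\<integral>\<^sup>+(z::'a). ennreal (1 / norm z powr s) * indicator {1..} (norm z) \<partial>lborel)"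
  have eq: "(\<integral>\<^sup>+y. ennreal (1 / norm (x - y) powr s) * indicator {1..} (norm (x - y)) \<partial>lborel) = K" for x :: 'a
    unfolding K_def by (rule nn_integral_lborel_diff) measurable
  have int: "integrable lborel (\<lambda>z::'a. 2 powr s * (1 + norm z) powr (-s))"
    using integrable_powr_tail[OF s] by simp
  have "K \<le> (\<integral>\<^sup>+(z::'a). ennreal (2 powr s * (1 + norm z) powr (-s)) \<partial>lborel)"
    unfolding K_def
  proof (rule nn_integral_mono)
    fix z :: 'a
    show "ennreal (1 / norm z powr s) * indicator {1..} (norm z) \<le> ennreal (2 powr s * (1 + norm z) powr (-s))"
    proof (cases "norm z \<ge> 1")
      case True
      have "(1 + norm z) powr s \<le> (2 * norm z) powr s"
        using True s by (intro powr_mono2) auto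
      also have "\<dots> = 2 powr s * norm z powr s" using True by (simp add: powr_mult)
      finally have le: "(1 + norm z) powr s \<le> 2 powr s * norm z powr s" .
      have "norm z powr s > 0" "(1 + norm z) powr s > 0" using True by auto
      with le have "1 / norm z powr s \<le> 2 powr s * inverse ((1 + norm z) powr s)"
        by (simp only: pos_divide_le_eq divide_inverse[symmetric] pos_le_divide_eq mult.commute times_divide_eq_left mult_1)
      then have "1 / norm z powr s \<le> 2 powr s * (1 + norm z) powr (-s)"
        by (simp only: powr_minus)
      then show ?thesis using True by (auto intro: ennreal_leI)
    qed simp
  qed
  also have "\<dots> = ennreal (LBINT z. 2 powr s * (1 + norm (z::'a)) powr (-s))"
    by (rule nn_integral_eq_integral[OF int]) auto
  also have "\<dots> < \<infinity>" by simp
  finally show ?thesis unfolding eq by (intro exI[of _ "enn2real K"]) (auto simp: less_top)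
qed

section \<open>Differentiation of integrals and logarithmic potentials\<close>

text \<open>Jensen's inequality for a density of total mass \<open>t\<close> at most 1. With
  \<open>m\<close> the integral of \<open>\<phi> * g\<close>, the tangent of \<open>exp\<close> at
  \<open>m\<close> integrates to \<open>exp m * (m + (1 - m) * t)\<close>. This misses
  \<open>exp m\<close> by \<open>(1 - t) * (exp m * (1 - m))\<close>, which never exceeds 1; hence
  the summand 1 on the right.\<close>

lemma exp_integral_le:
  fixes g \<phi> :: "'b \<Rightarrow> real"
  assumes g: "integrable M g" "\<And>x. 0 \<le> g x" "(LINT x|M. g x) \<le> 1"
    and \<phi>: "integrable M (\<lambda>x. \<phi> x * g x)" "\<phi> \<in> borel_measurable M"
  shows "ennreal (exp (LINT x|M. \<phi> x * g x)) \<le> 1 + (\<integral>\<^sup>+x. ennreal (exp (\<phi> x) * g x) \<partial>M)"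
proof (cases "(\<integral>\<^sup>+x. ennreal (exp (\<phi> x) * g x) \<partial>M) = \<infinity>")
  case False
  define m where "m = (LINT x|M. \<phi> x * g x)"
  define t where "t = (LINT x|M. g x)"
  have t: "0 \<le> t" "t \<le> 1" using g by (auto simp: t_def)
  have [measurable]: "g \<in> borel_measurable M" "\<phi> \<in> borel_measurable M" using g \<phi> by auto
  have int: "integrable M (\<lambda>x. exp (\<phi> x) * g x)"
    using False g by (intro integrableI_nonneg) (auto simp: top.not_eq_extremum)
  have "exp m * (m + (1 - m) * t) = (LINT x|M. exp m * (\<phi> x * g x + (1 - m) * g x))"
    using g \<phi> by (simp add: m_def t_def)
  also have "\<dots> \<le> (LINT x|M. exp (\<phi> x) * g x)"
  proof (rule integral_mono)
    fix x
    have "exp m * (1 + (\<phi> x - m)) \<le> exp m * exp (\<phi> x - m)"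
      by (intro mult_left_mono exp_ge_add_one_self) auto
    also have "\<dots> = exp (\<phi> x)" by (simp flip: exp_add)
    finally have "exp m * (1 + (\<phi> x - m)) * g x \<le> exp (\<phi> x) * g x"
      using g by (intro mult_right_mono) auto
    then show "exp m * (\<phi> x * g x + (1 - m) * g x) \<le> exp (\<phi> x) * g x"
      by (simp add: algebra_simps)
  qed (use g \<phi> int in auto)
  finally have 1: "exp m * (m + (1 - m) * t) \<le> (LINT x|M. exp (\<phi> x) * g x)" .
  have "exp m * (1 - m) \<le> exp m * exp (-m)"
    using exp_ge_add_one_self[of "-m"] by (intro mult_left_mono) auto
  then have 2: "exp m * (1 - m) \<le> 1" by (simp flip: exp_add)
  have "(1 - t) * (exp m * (1 - m)) \<le> (1 - t) * 1"
    using 2 t by (intro mult_left_mono) auto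
  then have "exp m \<le> 1 + exp m * (m + (1 - m) * t)"
    using t by (simp add: algebra_simps)
  with 1 have "exp m \<le> 1 + (LINT x|M. exp (\<phi> x) * g x)" by simp
  then have "ennreal (exp m) \<le> ennreal (1 + (LINT x|M. exp (\<phi> x) * g x))"
    by (rule ennreal_leI)
  also have "\<dots> = 1 + ennreal (LINT x|M. exp (\<phi> x) * g x)"
    using g by (simp add: ennreal_plus)
  also have "ennreal (LINT x|M. exp (\<phi> x) * g x) = (\<integral>\<^sup>+x. ennreal (exp (\<phi> x) * g x) \<partial>M)"
    using int g by (intro nn_integral_eq_integral[symmetric]) auto
  finally show ?thesis by (simp add: m_def)
qed simp

text \<open>The domination is imposed on difference quotients. Measurability of \<open>f'\<close>
  and the bound \<open>g y * norm h\<close> for it are then obtained in the limit along a sequence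
  of increments.\<close>

lemma has_derivative_lebesgue_integral:
  fixes f :: "'a::real_normed_vector \<Rightarrow> 'b \<Rightarrow> real"
  assumes int: "\<And>h. norm h \<le> 1 \<Longrightarrow> integrable M (f (x + h))"
    and der: "\<And>y. y \<in> space M \<Longrightarrow> ((\<lambda>x. f x y) has_derivative f' y) (at x)"
    and lip: "\<And>h y. norm h \<le> 1 \<Longrightarrow> y \<in> space M \<Longrightarrow> \<bar>f (x + h) y - f x y\<bar> \<le> g y * norm h"
    and g: "integrable M g"
  shows "integrable M (\<lambda>y. f' y h)"
    and "((\<lambda>x. LINT y|M. f x y) has_derivative (\<lambda>h. LINT y|M. f' y h)) (at x)"
proof -
  have mf[measurable]: "f (x + h) \<in> borel_measurable M" if "norm h \<le> 1" for h using int[OF that] by auto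
  have mf0[measurable]: "f x \<in> borel_measurable M" using mf[of 0] by simp
  have mg[measurable]: "g \<in> borel_measurable M" using g by auto
  \<comment> \<open>Dividing by \<open>max 1 (norm h)\<close> keeps all increments in the unit ball,
    where \<open>int\<close> and \<open>lip\<close> are available.\<close>
  have lim: "(\<lambda>n. (f (x + (1 / real (Suc n) / max 1 (norm h)) *\<^sub>R h) y - f x y) / (1 / real (Suc n) / max 1 (norm h)))
      \<longlonglongrightarrow> f' y h" if y: "y \<in> space M" for y h
  proof -
    have lin: "linear (f' y)" using der[OF y] by (rule has_derivative_linear)
    have "((\<lambda>t. f (x + t *\<^sub>R h) y) has_derivative (\<lambda>t. f' y (t *\<^sub>R h))) (at 0)"
      by (rule has_derivative_compose[of "\<lambda>t. x + t *\<^sub>R h" "\<lambda>t. t *\<^sub>R h" 0 UNIV "\<lambda>x. f x y" "f' y"])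
         (auto intro!: derivative_eq_intros simp: der[OF y])
    moreover have "(\<lambda>t. f' y (t *\<^sub>R h)) = (*) (f' y h)" by (auto simp: linear_cmul[OF lin])
    ultimately have "((\<lambda>t. f (x + t *\<^sub>R h) y) has_real_derivative f' y h) (at 0)"
      by (simp add: has_field_derivative_def)
    then have *: "((\<lambda>t. (f (x + t *\<^sub>R h) y - f x y) / t) \<longlongrightarrow> f' y h) (at 0)"
      by (auto dest: DERIV_D)
    have t0: "(\<lambda>n. 1 / real (Suc n) / max 1 (norm h)) \<longlonglongrightarrow> 0"
      using LIMSEQ_inverse_real_of_nat
      by (intro tendsto_divide_zero) (simp add: inverse_eq_divide)
    show ?thesis
      by (rule filterlim_compose[OF *]) (rule filterlim_atI[OF t0], simp)
  qed
  have bdd: "\<bar>f' y h\<bar> \<le> g y * norm h" if y: "y \<in> space M" for y h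
  proof (rule tendsto_upperbound[OF tendsto_rabs[OF lim[OF y]]])
    let ?t = "\<lambda>n. 1 / real (Suc n) / max 1 (norm h)"
    have pos: "?t n > 0" for n by simp
    have "norm (?t n *\<^sub>R h) \<le> 1" for n
    proof -
      have "norm (?t n *\<^sub>R h) = (norm h / max 1 (norm h)) * (1 / real (Suc n))" by simp
      also have "\<dots> \<le> 1 * 1" by (intro mult_mono) (auto simp: field_simps)
      finally show ?thesis by simp
    qed
    then have "\<bar>f (x + ?t n *\<^sub>R h) y - f x y\<bar> \<le> g y * norm (?t n *\<^sub>R h)" for n
      using lip y by blast
    then have "\<bar>f (x + ?t n *\<^sub>R h) y - f x y\<bar> \<le> g y * norm h * ?t n" for n
      unfolding norm_scaleR abs_of_pos[OF pos] by (simp only: mult_ac)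
    moreover have "\<bar>a / t\<bar> \<le> G" if "\<bar>a\<bar> \<le> G * t" "0 < t" for a t G :: real
      using that by (simp add: pos_divide_le_eq)
    ultimately have "\<bar>(f (x + ?t n *\<^sub>R h) y - f x y) / ?t n\<bar> \<le> g y * norm h" for n
      using pos by blast
    then show "\<forall>\<^sub>F n in sequentially. \<bar>(f (x + ?t n *\<^sub>R h) y - f x y) / ?t n\<bar> \<le> g y * norm h"
      by simp
  qed simp
  have meas[measurable]: "(\<lambda>y. f' y h) \<in> borel_measurable M" for h
  proof (rule borel_measurable_LIMSEQ_real[OF lim])
    fix n
    let ?t = "1 / real (Suc n) / max 1 (norm h)"
    have "norm (?t *\<^sub>R h) = (norm h / max 1 (norm h)) * (1 / real (Suc n))" by simp
    also have "\<dots> \<le> 1 * 1" by (intro mult_mono) (auto simp: field_simps)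
    finally have [measurable]: "f (x + ?t *\<^sub>R h) \<in> borel_measurable M" using mf by simp
    show "(\<lambda>y. (f (x + ?t *\<^sub>R h) y - f x y) / ?t) \<in> borel_measurable M" by measurable
  qed auto
  have int': "integrable M (\<lambda>y. f' y h)" for h
  proof (rule integrable_dominated)
    show "integrable M (\<lambda>y. g y * norm h)" using g by simp
    show "AE y in M. norm (f' y h) \<le> norm (g y * norm h)"
      using bdd by (intro AE_I2) (metis abs_ge_self order_trans real_norm_def)
  qed auto
  then show "integrable M (\<lambda>y. f' y h)" .
  show "((\<lambda>x. LINT y|M. f x y) has_derivative (\<lambda>h. LINT y|M. f' y h)) (at x)"
    unfolding has_derivative_at
  proof
    show "bounded_linear (\<lambda>h. LINT y|M. f' y h)"
    proof (rule bounded_linear_intro)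
      fix a b and r :: real
      show "(LINT y|M. f' y (a + b)) = (LINT y|M. f' y a) + (LINT y|M. f' y b)"
      proof -
        have "(LINT y|M. f' y (a + b)) = (LINT y|M. f' y a + f' y b)"
          by (intro Bochner_Integration.integral_cong refl linear_add has_derivative_linear[OF der])
        also have "\<dots> = (LINT y|M. f' y a) + (LINT y|M. f' y b)"
          by (rule Bochner_Integration.integral_add[OF int' int'])
        finally show ?thesis .
      qed
      show "(LINT y|M. f' y (r *\<^sub>R a)) = r *\<^sub>R (LINT y|M. f' y a)"
      proof -
        have "(LINT y|M. f' y (r *\<^sub>R a)) = (LINT y|M. r *\<^sub>R f' y a)"
          by (intro Bochner_Integration.integral_cong refl linear_cmul has_derivative_linear[OF der])
        also have "\<dots> = r *\<^sub>R (LINT y|M. f' y a)"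
          using int' by simp
        finally show ?thesis .
      qed
      have "norm (LINT y|M. f' y a) \<le> (LINT y|M. \<bar>f' y a\<bar>)"
        using integral_norm_bound[of M "\<lambda>y. f' y a"] by simp
      also have "\<dots> \<le> (LINT y|M. g y * norm a)"
        using int' g bdd by (intro integral_mono) auto
      finally show "norm (LINT y|M. f' y a) \<le> norm a * (LINT y|M. g y)" by (simp add: mult.commute)
    qed
    show "(\<lambda>h. norm ((LINT y|M. f (x + h) y) - (LINT y|M. f x y) - (LINT y|M. f' y h)) / norm h) \<midarrow>0\<rightarrow> 0"
      unfolding tendsto_at_iff_sequentially
    proof (intro allI impI)
      fix X :: "nat \<Rightarrow> 'a" assume X: "\<forall>i. X i \<in> UNIV - {0}" and X0: "X \<longlonglongrightarrow> 0"
      obtain N where N: "\<And>n. n \<ge> N \<Longrightarrow> norm (X n) \<le> 1"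
        using LIMSEQ_D[OF X0, of 1] by (auto intro: less_imp_le)
      define Y where "Y = (\<lambda>n. X (n + N))"
      have Y: "Y n \<noteq> 0" "norm (Y n) \<le> 1" for n using X N by (auto simp: Y_def)
      have Y0: "Y \<longlonglongrightarrow> 0" using LIMSEQ_ignore_initial_segment[OF X0] by (simp add: Y_def)
      define q where "q n y = \<bar>f (x + Y n) y - f x y - f' y (Y n)\<bar> / norm (Y n)" for n y
      have [measurable]: "f (x + Y n) \<in> borel_measurable M" for n using mf[OF Y(2)] .
      have qm: "q n \<in> borel_measurable M" for n unfolding q_def by measurable
      have "(\<lambda>n. LINT y|M. q n y) \<longlonglongrightarrow> (LINT y|M. 0)"
      \<comment> \<open>One \<open>g\<close> bounds the difference quotient by \<open>lip\<close>,
        the other bounds the linear part by \<open>bdd\<close>.\<close>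
      proof (rule integral_dominated_convergence[where w = "\<lambda>y. 2 * g y"])
        show "AE y in M. (\<lambda>n. q n y) \<longlonglongrightarrow> 0"
        proof (rule AE_I2)
          fix y assume y: "y \<in> space M"
          have "(\<lambda>h. norm (f (x + h) y - f x y - f' y h) / norm h) \<midarrow>0\<rightarrow> 0"
            using der[OF y] by (simp add: has_derivative_at)
          then have "(\<lambda>n. norm (f (x + Y n) y - f x y - f' y (Y n)) / norm (Y n)) \<longlonglongrightarrow> 0"
            by (rule filterlim_compose) (rule filterlim_atI[OF Y0], simp add: Y)
          then show "(\<lambda>n. q n y) \<longlonglongrightarrow> 0" by (simp add: q_def)
        qed
        show "AE y in M. norm (q n y) \<le> 2 * g y" for n
        proof (rule AE_I2)
          fix y assume y: "y \<in> space M"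
          have "\<bar>f (x + Y n) y - f x y - f' y (Y n)\<bar> \<le> 2 * g y * norm (Y n)"
            using lip[OF Y(2) y, of n] bdd[OF y, of "Y n"] by linarith
          then show "norm (q n y) \<le> 2 * g y" using Y[of n] by (simp add: q_def field_simps)
        qed
      qed (use qm g in auto)
      then have q0: "(\<lambda>n. LINT y|M. q n y) \<longlonglongrightarrow> 0" by simp
      have "(\<lambda>n. norm ((LINT y|M. f (x + Y n) y) - (LINT y|M. f x y) - (LINT y|M. f' y (Y n))) / norm (Y n)) \<longlonglongrightarrow> 0"
      proof (rule tendsto_sandwich[OF _ _ tendsto_const q0]; intro always_eventually allI)
        fix n
        have i: "integrable M (f (x + Y n))" "integrable M (f x)" using int[OF Y(2)] int[of 0] by auto
        have "norm ((LINT y|M. f (x + Y n) y) - (LINT y|M. f x y) - (LINT y|M. f' y (Y n)))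
            = norm (LINT y|M. f (x + Y n) y - f x y - f' y (Y n))" using i int' by simp
        also have "\<dots> \<le> (LINT y|M. \<bar>f (x + Y n) y - f x y - f' y (Y n)\<bar>)"
          using integral_norm_bound[of M "\<lambda>y. f (x + Y n) y - f x y - f' y (Y n)"] by simp
        finally show "norm ((LINT y|M. f (x + Y n) y) - (LINT y|M. f x y) - (LINT y|M. f' y (Y n))) / norm (Y n)
           \<le> (LINT y|M. q n y)"
          unfolding q_def using Y[of n] by (simp add: divide_right_mono)
      qed auto
      then show "((\<lambda>h. norm ((LINT y|M. f (x + h) y) - (LINT y|M. f x y) - (LINT y|M. f' y h)) / norm h) \<circ> X) \<longlonglongrightarrow> 0"
        unfolding Y_def o_def by (rule LIMSEQ_offset)
    qed
  qed
qed

text \<open>The map is inversion in the unit sphere, and at the same time the gradient of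
  \<open>ln (norm z)\<close>. The formula therefore compares the gradients of the logarithm at two
  points.\<close>

lemma norm_inversion_diff:
  fixes z w :: "'a::real_inner"
  assumes "z \<noteq> 0" "w \<noteq> 0"
  shows "norm (z /\<^sub>R (norm z)\<^sup>2 - w /\<^sub>R (norm w)\<^sup>2) = norm (z - w) / (norm z * norm w)"
proof -
  have "(norm (z /\<^sub>R (norm z)\<^sup>2 - w /\<^sub>R (norm w)\<^sup>2))\<^sup>2 = (norm (z - w) / (norm z * norm w))\<^sup>2"
    using assms unfolding power_divide power_mult_distrib power2_norm_eq_inner
    by (simp add: inner_diff inner_commute field_simps)
  then show ?thesis by (rule power2_eq_imp_eq) auto
qed

text \<open>The inequality \<open>ln t \<le> t - 1\<close> at the quotient of the squared norms
  bounds the increment from above. Exchanging the two base points bounds it from below, but with the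
  gradient at \<open>z + h\<close>; the inversion formula controls the change of gradient. Nothing
  is assumed about the segment from \<open>z\<close> to \<open>z + h\<close>, which may pass through
  0.\<close>

lemma ln_norm_taylor:
  fixes z h :: "'a::real_inner"
  assumes "z \<noteq> 0" "z + h \<noteq> 0"
  shows "\<bar>ln (norm (z + h)) - ln (norm z) - (z \<bullet> h) / (norm z)\<^sup>2\<bar>
    \<le> (norm h)\<^sup>2 * (1 / (norm z)\<^sup>2 + 1 / (norm (z + h))\<^sup>2)"
proof -
  define w where "w = z + h"
  have w: "w \<noteq> 0" "h = w - z" using assms by (auto simp: w_def)
  have up: "ln (norm (a + k)) - ln (norm a) \<le> (a \<bullet> k) / (norm a)\<^sup>2 + (norm k)\<^sup>2 / (2 * (norm a)\<^sup>2)"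
    if "a \<noteq> 0" "a + k \<noteq> 0" for a k :: 'a
  proof -
    have "2 * (ln (norm (a + k)) - ln (norm a)) = ln ((norm (a + k))\<^sup>2 / (norm a)\<^sup>2)"
      using that by (simp add: ln_div ln_realpow)
    also have "\<dots> \<le> (norm (a + k))\<^sup>2 / (norm a)\<^sup>2 - 1"
      using that by (intro ln_le_minus_one) auto
    also have "(norm (a + k))\<^sup>2 = (norm a)\<^sup>2 + 2 * (a \<bullet> k) + (norm k)\<^sup>2"
      by (simp add: power2_norm_eq_inner inner_add inner_commute)
    also have "((norm a)\<^sup>2 + 2 * (a \<bullet> k) + (norm k)\<^sup>2) / (norm a)\<^sup>2 - 1
      = 2 * ((a \<bullet> k) / (norm a)\<^sup>2 + (norm k)\<^sup>2 / (2 * (norm a)\<^sup>2))"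
      using that by (simp add: field_simps)
    finally show ?thesis by simp
  qed
  have u1: "ln (norm w) - ln (norm z) - (z \<bullet> h) / (norm z)\<^sup>2 \<le> (norm h)\<^sup>2 / (2 * (norm z)\<^sup>2)"
    using up[of z h] assms by (simp add: w_def)
  have u2: "ln (norm z) - ln (norm w) \<le> - (w \<bullet> h) / (norm w)\<^sup>2 + (norm h)\<^sup>2 / (2 * (norm w)\<^sup>2)"
    using up[of w "-h"] assms by (simp add: w_def)
  have "(z \<bullet> h) / (norm z)\<^sup>2 - (w \<bullet> h) / (norm w)\<^sup>2 = (z /\<^sub>R (norm z)\<^sup>2 - w /\<^sub>R (norm w)\<^sup>2) \<bullet> h"
    by (simp add: inner_diff_left divide_inverse mult.commute)
  also have "\<dots> \<le> norm (z /\<^sub>R (norm z)\<^sup>2 - w /\<^sub>R (norm w)\<^sup>2) * norm h" by (rule norm_cauchy_schwarz)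
  also have "\<dots> = (norm h)\<^sup>2 * (1 / norm z * (1 / norm w))"
    using assms w by (subst norm_inversion_diff) (auto simp: power2_eq_square norm_minus_commute)
  also have "\<dots> \<le> (norm h)\<^sup>2 * ((1 / norm z)\<^sup>2 / 2 + (1 / norm w)\<^sup>2 / 2)"
    using sum_squares_bound[of "1 / norm z" "1 / norm w"] by (intro mult_left_mono) auto
  finally have u3: "(z \<bullet> h) / (norm z)\<^sup>2 - (w \<bullet> h) / (norm w)\<^sup>2 \<le>
    (norm h)\<^sup>2 / (2 * (norm z)\<^sup>2) + (norm h)\<^sup>2 / (2 * (norm w)\<^sup>2)"
    by (simp add: power_divide distrib_left)
  have p: "0 \<le> (norm h)\<^sup>2 / (2 * (norm z)\<^sup>2)" "0 \<le> (norm h)\<^sup>2 / (2 * (norm w)\<^sup>2)" by auto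
  have e: "(norm h)\<^sup>2 * (1 / (norm z)\<^sup>2 + 1 / (norm w)\<^sup>2)
     = 2 * ((norm h)\<^sup>2 / (2 * (norm z)\<^sup>2)) + 2 * ((norm h)\<^sup>2 / (2 * (norm w)\<^sup>2))"
    by (simp add: distrib_left)
  show ?thesis
    unfolding w_def[symmetric] e using u1 u2 u3 p by (intro abs_leI) linarith+
qed

text \<open>
  The second order remainder in \<open>ln_norm_taylor\<close> is integrable against the density at both base
  points, so differentiability needs no dominated convergence.
\<close>

lemma has_derivative_log_potential:
  fixes f :: "'a::euclidean_space \<Rightarrow> real"
  assumes [measurable]: "f \<in> borel_measurable borel"
    and i0: "\<And>x. integrable lborel (\<lambda>y. ln (norm (x - y)) * f y)"
    and i1: "\<And>x. integrable lborel (\<lambda>y. f y / norm (x - y))"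
    and i2: "\<And>x. integrable lborel (\<lambda>y. f y / (norm (x - y))\<^sup>2)"
    and K: "\<And>x. (LBINT y. \<bar>f y\<bar> / (norm (x - y))\<^sup>2) \<le> K"
  shows "((\<lambda>x. LBINT y. ln (norm (x - y)) * f y) has_derivative
           (\<lambda>h. LBINT y. ((x - y) \<bullet> h) / (norm (x - y))\<^sup>2 * f y)) (at x)"
proof -
  have iD: "integrable lborel (\<lambda>y. ((x - y) \<bullet> h) / (norm (x - y))\<^sup>2 * f y)" for h
  proof (rule integrable_dominated)
    show "integrable lborel (\<lambda>y. norm h * (f y / norm (x - y)))"
      by (rule integrable_mult_right) (rule i1)
    show "AE y in lborel. norm (((x - y) \<bullet> h) / (norm (x - y))\<^sup>2 * f y) \<le> norm (norm h * (f y / norm (x - y)))"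
    proof (rule AE_I2)
      fix y
      have "\<bar>(x - y) \<bullet> h\<bar> / (norm (x - y))\<^sup>2 \<le> (norm (x - y) * norm h) / (norm (x - y))\<^sup>2"
        by (intro divide_right_mono Cauchy_Schwarz_ineq2) auto
      also have "\<dots> = norm h / norm (x - y)" by (simp add: power2_eq_square)
      finally have "\<bar>(x - y) \<bullet> h\<bar> / (norm (x - y))\<^sup>2 * \<bar>f y\<bar> \<le> norm h / norm (x - y) * \<bar>f y\<bar>"
        by (intro mult_right_mono) auto
      then show "norm (((x - y) \<bullet> h) / (norm (x - y))\<^sup>2 * f y) \<le> norm (norm h * (f y / norm (x - y)))"
        by (simp add: abs_mult)
    qed
  qed measurable
  have i2': "integrable lborel (\<lambda>y. \<bar>f y\<bar> / (norm (x' - y))\<^sup>2)" for x'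
    using integrable_abs[OF i2[of x']] by (simp only: abs_divide abs_power2 abs_norm_cancel)
  let ?D = "\<lambda>h. LBINT y. ((x - y) \<bullet> h) / (norm (x - y))\<^sup>2 * f y"
  let ?V = "\<lambda>x. LBINT y. ln (norm (x - y)) * f y"
  have bl: "bounded_linear ?D"
  proof (rule bounded_linear_intro)
    fix a b and r :: real
    show "?D (a + b) = ?D a + ?D b"
      using iD by (subst Bochner_Integration.integral_add[symmetric])
        (auto simp: inner_add add_divide_distrib ring_distribs)
    show "?D (r *\<^sub>R a) = r *\<^sub>R ?D a"
      using iD by (subst integral_scaleR_right[symmetric]) (auto simp: mult.assoc)
    have "norm (?D a) \<le> (LBINT y. \<bar>((x - y) \<bullet> a) / (norm (x - y))\<^sup>2 * f y\<bar>)"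
      using integral_norm_bound[of lborel "\<lambda>y. ((x - y) \<bullet> a) / (norm (x - y))\<^sup>2 * f y"] by simp
    also have "\<dots> \<le> (LBINT y. norm a * \<bar>f y / norm (x - y)\<bar>)"
    proof (rule integral_mono)
      fix y
      have "\<bar>(x - y) \<bullet> a\<bar> / (norm (x - y))\<^sup>2 \<le> (norm (x - y) * norm a) / (norm (x - y))\<^sup>2"
        by (intro divide_right_mono Cauchy_Schwarz_ineq2) auto
      also have "\<dots> = norm a / norm (x - y)" by (simp add: power2_eq_square)
      finally have "\<bar>(x - y) \<bullet> a\<bar> / (norm (x - y))\<^sup>2 * \<bar>f y\<bar> \<le> norm a / norm (x - y) * \<bar>f y\<bar>"
        by (intro mult_right_mono) auto
      then show "\<bar>((x - y) \<bullet> a) / (norm (x - y))\<^sup>2 * f y\<bar> \<le> norm a * \<bar>f y / norm (x - y)\<bar>"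
        by (simp add: abs_mult)
    qed (intro integrable_abs integrable_mult_right iD i1)+
    finally show "norm (?D a) \<le> norm a * (LBINT y. \<bar>f y / norm (x - y)\<bar>)"
      by (simp only: integral_mult_right_zero)
  qed
  have est: "\<bar>?V (x + h) - ?V x - ?D h\<bar> \<le> (norm h)\<^sup>2 * (2 * K)" for h
  proof -
    have "\<bar>?V (x + h) - ?V x - ?D h\<bar>
      = \<bar>LBINT y. ln (norm (x + h - y)) * f y - ln (norm (x - y)) * f y - ((x - y) \<bullet> h) / (norm (x - y))\<^sup>2 * f y\<bar>"
      using i0 iD by simp
    also have "\<dots> \<le> (LBINT y. \<bar>ln (norm (x + h - y)) * f y - ln (norm (x - y)) * f y - ((x - y) \<bullet> h) / (norm (x - y))\<^sup>2 * f y\<bar>)"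
      by (rule integral_abs_bound)
    also have "\<dots> \<le> (LBINT y. (norm h)\<^sup>2 * (\<bar>f y\<bar> / (norm (x - y))\<^sup>2 + \<bar>f y\<bar> / (norm (x + h - y))\<^sup>2))"
    proof (rule integral_mono_AE)
      show "AE y in lborel. \<bar>ln (norm (x + h - y)) * f y - ln (norm (x - y)) * f y - ((x - y) \<bullet> h) / (norm (x - y))\<^sup>2 * f y\<bar>
         \<le> (norm h)\<^sup>2 * (\<bar>f y\<bar> / (norm (x - y))\<^sup>2 + \<bar>f y\<bar> / (norm (x + h - y))\<^sup>2)"
        using AE_lborel_singleton[of x] AE_lborel_singleton[of "x + h"]
      proof eventually_elim
        case (elim y)
        have "\<bar>ln (norm ((x - y) + h)) - ln (norm (x - y)) - ((x - y) \<bullet> h) / (norm (x - y))\<^sup>2\<bar> * \<bar>f y\<bar>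
            \<le> (norm h)\<^sup>2 * (1 / (norm (x - y))\<^sup>2 + 1 / (norm ((x - y) + h))\<^sup>2) * \<bar>f y\<bar>"
          using elim by (intro mult_right_mono ln_norm_taylor) (auto simp: algebra_simps)
        also have "(x - y) + h = x + h - y" by simp
        finally show ?case by (simp add: abs_mult[symmetric] algebra_simps)
      qed
      show "integrable lborel (\<lambda>y. (norm h)\<^sup>2 * (\<bar>f y\<bar> / (norm (x - y))\<^sup>2 + \<bar>f y\<bar> / (norm (x + h - y))\<^sup>2))"
        using i2' by (intro integrable_mult_right Bochner_Integration.integrable_add)
    qed (use i0 iD in auto)
    also have "\<dots> = (norm h)\<^sup>2 * ((LBINT y. \<bar>f y\<bar> / (norm (x - y))\<^sup>2) + (LBINT y. \<bar>f y\<bar> / (norm (x + h - y))\<^sup>2))"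
      using i2' by simp
    also have "\<dots> \<le> (norm h)\<^sup>2 * (2 * K)"
      using K[of x] K[of "x + h"] by (intro mult_left_mono) auto
    finally show ?thesis .
  qed
  show ?thesis
    unfolding has_derivative_at
  proof
    show "bounded_linear ?D" by (rule bl)
    have 0: "(\<lambda>h. norm h * (2 * K)) \<midarrow>0\<rightarrow> 0"
      by (rule tendsto_eq_intros refl | simp)+
    show "(\<lambda>h. norm (?V (x + h) - ?V x - ?D h) / norm h) \<midarrow>0\<rightarrow> 0"
    proof (rule tendsto_sandwich[OF _ _ tendsto_const 0]; intro always_eventually allI)
      fix h
      show "norm (?V (x + h) - ?V x - ?D h) / norm h \<le> norm h * (2 * K)"
      proof (cases "h = 0")
        case False
        then show ?thesis using est[of h] by (simp add: field_simps power2_eq_square)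
      qed simp
    qed auto
  qed
qed

section \<open>Classes of differentiable functions\<close>

lemma partial_deriv_eqI: "(f has_derivative D) (at x) \<Longrightarrow> partial_deriv b f x = D b"
  unfolding partial_deriv_def using frechet_derivative_at by metis

lemma has_derivative_partial_deriv:
  fixes f :: "'a::euclidean_space \<Rightarrow> real"
  assumes "f differentiable (at x)"
  shows "(f has_derivative (\<lambda>h. \<Sum>b\<in>Basis. (h \<bullet> b) * partial_deriv b f x)) (at x)"
proof -
  obtain D where D: "(f has_derivative D) (at x)" using assms by (auto simp: differentiable_def)
  then have lin: "linear D" by (rule has_derivative_linear)
  have "D h = (\<Sum>b\<in>Basis. (h \<bullet> b) * partial_deriv b f x)" for h
  proof -
    have "D h = D (\<Sum>b\<in>Basis. (h \<bullet> b) *\<^sub>R b)" by (simp add: euclidean_representation)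
    also have "\<dots> = (\<Sum>b\<in>Basis. (h \<bullet> b) * D b)"
      by (simp add: linear_sum[OF lin] linear_cmul[OF lin])
    finally show ?thesis by (simp add: partial_deriv_eqI[OF D])
  qed
  then have "D = (\<lambda>h. \<Sum>b\<in>Basis. (h \<bullet> b) * partial_deriv b f x)" by (rule ext)
  with D show ?thesis by simp
qed

text \<open>The derivative bound is asked on one segment only, so \<open>B\<close> may depend on the
  place. This is what weighted estimates need, where the bound is the local size of the weight. The
  dimension factor comes from adding the coordinates.\<close>

lemma lipschitz_partial_deriv:
  fixes f :: "'a::euclidean_space \<Rightarrow> real"
  assumes "\<And>x. f differentiable (at x)"
    and B: "\<And>y b. y \<in> closed_segment x (x + h) \<Longrightarrow> b \<in> Basis \<Longrightarrow> \<bar>partial_deriv b f y\<bar> \<le> B"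
  shows "\<bar>f (x + h) - f x\<bar> \<le> real DIM('a) * B * norm h"
proof -
  obtain b0 :: 'a where b0: "b0 \<in> Basis" using nonempty_Basis by blast
  have B0: "0 \<le> B" using B[of x b0] b0 by force
  have "norm (f (x + h) - f x) \<le> real DIM('a) * B * norm (x + h - x)"
  proof (rule differentiable_bound[where S = "closed_segment x (x + h)"])
    fix y assume y: "y \<in> closed_segment x (x + h)"
    show "(f has_derivative (\<lambda>k. \<Sum>b\<in>Basis. (k \<bullet> b) * partial_deriv b f y)) (at y within closed_segment x (x + h))"
      using assms has_derivative_partial_deriv has_derivative_at_withinI by blast
    show "onorm (\<lambda>k. \<Sum>b\<in>Basis. (k \<bullet> b) * partial_deriv b f y) \<le> real DIM('a) * B"
    proof (rule onorm_bound)
      fix k :: 'a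
      have "norm (\<Sum>b\<in>Basis. (k \<bullet> b) * partial_deriv b f y) \<le> (\<Sum>b\<in>(Basis::'a set). B * norm k)"
      proof (rule sum_norm_le)
        fix b :: 'a assume "b \<in> Basis"
        then show "norm ((k \<bullet> b) * partial_deriv b f y) \<le> B * norm k"
          using mult_mono[OF Basis_le_norm B[OF y], of b b k] B0 by (simp add: abs_mult mult.commute)
      qed
      then show "norm (\<Sum>b\<in>Basis. (k \<bullet> b) * partial_deriv b f y) \<le> real DIM('a) * B * norm k" by simp
    qed (use B0 in simp)
  qed auto
  then show ?thesis by simp
qed

text \<open>
  A version of \<open>C\<^sup>k\<close> in which every partial derivative of order at most \<open>k\<close> is also required to
  satisfy \<open>P\<close>. It covers both \<open>C_diff\<close> and the weighted bounds used for the bootstrap.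
\<close>

primrec cdiff :: "(('a::euclidean_space \<Rightarrow> real) \<Rightarrow> bool) \<Rightarrow> nat \<Rightarrow> ('a \<Rightarrow> real) \<Rightarrow> bool" where
  "cdiff P 0 f \<longleftrightarrow> continuous_on UNIV f \<and> P f"
| "cdiff P (Suc k) f \<longleftrightarrow>
     P f \<and> (\<forall>x. f differentiable (at x)) \<and> (\<forall>b\<in>Basis. cdiff P k (partial_deriv b f))"

lemma cdiff_True: "cdiff (\<lambda>_. True) k f \<longleftrightarrow> C_diff k f"
  by (induction k arbitrary: f) auto

lemma cdiff_mono: "cdiff P k f \<Longrightarrow> (\<And>g. P g \<Longrightarrow> Q g) \<Longrightarrow> cdiff Q k f"
  by (induction k arbitrary: f) auto

lemma cdiff_imp_C_diff: "cdiff P k f \<Longrightarrow> C_diff k f"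
  using cdiff_mono[of P k f "\<lambda>_. True"] by (simp add: cdiff_True)

lemma cdiff_prop: "cdiff P k f \<Longrightarrow> P f"
  by (cases k) auto

lemma cdiff_continuous: "cdiff P k f \<Longrightarrow> continuous_on UNIV f"
  by (cases k) (auto intro!: differentiable_imp_continuous_on simp: differentiable_on_def
    intro: differentiable_at_withinI)

lemma cdiff_Suc_imp: "cdiff P (Suc k) f \<Longrightarrow> cdiff P k f"
proof (induction k arbitrary: f)
  case 0
  then show ?case using cdiff_continuous[OF 0] by simp
next
  case (Suc k)
  then show ?case by auto
qed

section \<open>Sum, product and chain rules\<close>

lemma partial_deriv_add:
  assumes "f differentiable (at x)" "g differentiable (at x)"
  shows "partial_deriv b (\<lambda>x. f x + g x) x = partial_deriv b f x + partial_deriv b g x"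
proof -
  obtain D E where "(f has_derivative D) (at x)" "(g has_derivative E) (at x)"
    using assms by (auto simp: differentiable_def)
  then show ?thesis
    using partial_deriv_eqI[OF has_derivative_add] partial_deriv_eqI by metis
qed

lemma partial_deriv_mult:
  fixes f g :: "'a::euclidean_space \<Rightarrow> real"
  assumes "f differentiable (at x)" "g differentiable (at x)"
  shows "partial_deriv b (\<lambda>x. f x * g x) x = f x * partial_deriv b g x + partial_deriv b f x * g x"
proof -
  obtain D E where "(f has_derivative D) (at x)" "(g has_derivative E) (at x)"
    using assms by (auto simp: differentiable_def)
  then show ?thesis
    using partial_deriv_eqI[OF has_derivative_mult] partial_deriv_eqI by metis
qed

lemma partial_deriv_chain:
  fixes q :: "'a::euclidean_space \<Rightarrow> real"
  assumes "q differentiable (at x)" "(g has_real_derivative g') (at (q x))"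
  shows "partial_deriv b (\<lambda>x. g (q x)) x = g' * partial_deriv b q x"
    and "(\<lambda>x. g (q x)) differentiable (at x)"
proof -
  obtain D where D: "(q has_derivative D) (at x)"
    using assms by (auto simp: differentiable_def)
  have "((\<lambda>x. g (q x)) has_derivative (\<lambda>h. g' * D h)) (at x)"
    using has_derivative_compose[OF D assms(2)[unfolded has_field_derivative_def]] .
  then show "partial_deriv b (\<lambda>x. g (q x)) x = g' * partial_deriv b q x"
      "(\<lambda>x. g (q x)) differentiable (at x)"
    using D by (auto simp: partial_deriv_eqI differentiable_def)
qed

lemma cdiff_add:
  assumes PQR: "\<And>f g. P f \<Longrightarrow> P g \<Longrightarrow> P (\<lambda>x. f x + g x)"
  shows "cdiff P k f \<Longrightarrow> cdiff P k g \<Longrightarrow> cdiff P k (\<lambda>x. f x + g x)"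
proof (induction k arbitrary: f g)
  case 0
  then show ?case using PQR by (auto intro: continuous_intros)
next
  case (Suc k)
  then have "partial_deriv b (\<lambda>x. f x + g x) = (\<lambda>x. partial_deriv b f x + partial_deriv b g x)" for b
    by (auto simp: partial_deriv_add)
  with Suc PQR show ?case by auto
qed

text \<open>The factors may obey different bounds: by the Leibniz rule every derivative of the
  product is a sum of terms of type \<open>P\<close> times \<open>Q\<close>, so \<open>R\<close> has
  to contain these and be closed under sums. In the application the weights are \<open>I\<close>,
  \<open>exp u\<close> and their product \<open>F\<close>.\<close>

lemma cdiff_mult:
  fixes f g :: "'a::euclidean_space \<Rightarrow> real"
  assumes PQR: "\<And>f g. P f \<Longrightarrow> Q g \<Longrightarrow> R (\<lambda>x. f x * g x)"
    and R: "\<And>f g. R f \<Longrightarrow> R g \<Longrightarrow> R (\<lambda>x. f x + g x)"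
  shows "cdiff P k f \<Longrightarrow> cdiff Q k g \<Longrightarrow> cdiff R k (\<lambda>x. f x * g x)"
proof (induction k arbitrary: f g)
  case 0
  then show ?case using PQR by (auto intro: continuous_intros)
next
  case (Suc k)
  then have "partial_deriv b (\<lambda>x. f x * g x) = (\<lambda>x. f x * partial_deriv b g x + partial_deriv b f x * g x)" for b
    by (auto simp: partial_deriv_mult)
  moreover have "cdiff R k (\<lambda>x. f x * partial_deriv b g x)" "cdiff R k (\<lambda>x. partial_deriv b f x * g x)"
    if "b \<in> Basis" for b
    using Suc.prems that cdiff_Suc_imp[OF Suc.prems(1)] cdiff_Suc_imp[OF Suc.prems(2)]
    by (auto intro!: Suc.IH)
  ultimately show ?case using Suc PQR by (auto intro!: cdiff_add R)
qed

lemma C_diff_add: "C_diff k f \<Longrightarrow> C_diff k g \<Longrightarrow> C_diff k (\<lambda>x. f x + g x)"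
  unfolding cdiff_True[symmetric] by (rule cdiff_add) auto

lemma C_diff_mult: "C_diff k f \<Longrightarrow> C_diff k g \<Longrightarrow> C_diff k (\<lambda>x. f x * g x)"
  unfolding cdiff_True[symmetric] by (rule cdiff_mult) auto

lemma C_diff_const: "C_diff k (\<lambda>x. c)"
proof (induction k arbitrary: c)
  case (Suc k)
  have "partial_deriv b (\<lambda>x::'a. c) = (\<lambda>x. 0)" for b
    by (auto intro!: partial_deriv_eqI derivative_eq_intros)
  with Suc show ?case by simp
qed (auto intro: continuous_intros)

lemma C_diff_cmult: "C_diff k f \<Longrightarrow> C_diff k (\<lambda>x. c * f x)"
  using C_diff_mult[OF C_diff_const] .

lemma C_diff_sum: "finite A \<Longrightarrow> (\<And>a. a \<in> A \<Longrightarrow> C_diff k (f a)) \<Longrightarrow> C_diff k (\<lambda>x. \<Sum>a\<in>A. f a x)"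
  by (induction A rule: finite_induct) (auto intro: C_diff_const C_diff_add)

lemma C_diff_Suc_imp: "C_diff (Suc k) f \<Longrightarrow> C_diff k f"
  unfolding cdiff_True[symmetric] by (rule cdiff_Suc_imp)

lemma C_diff_continuous: "C_diff k f \<Longrightarrow> continuous_on UNIV f"
  unfolding cdiff_True[symmetric] by (rule cdiff_continuous)

lemma C_diff_mono: "k \<le> m \<Longrightarrow> C_diff m f \<Longrightarrow> C_diff k f"
  by (induction m) (auto simp: le_Suc_eq simp del: C_diff.simps dest: C_diff_Suc_imp)

lemma C_diff_laplacian: "C_diff (k + 2) f \<Longrightarrow> C_diff k (laplacian f)"
  unfolding laplacian_def[abs_def] by (intro C_diff_sum) auto

section \<open>Integration by parts\<close>

text \<open>Translation invariance gives the integral of \<open>f (b + x) - f x\<close> the value 0.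
  By the fundamental theorem of calculus and Fubini it is also the average over \<open>s\<close> in
  the unit interval of the integrals of \<open>partial_deriv b f (s *\<^sub>R b + x)\<close>, each
  equal to the integral in question. No boundary terms and no compact support occur.\<close>

lemma integral_partial_deriv_eq_0:
  fixes f :: "'a::euclidean_space \<Rightarrow> real"
  assumes b: "b \<in> Basis" and diff: "\<And>x. f differentiable (at x)"
    and cont: "continuous_on UNIV (partial_deriv b f)"
    and f: "integrable lborel f" and pf: "integrable lborel (partial_deriv b f)"
  shows "(LBINT x. partial_deriv b f x) = 0"
proof -
  let ?p = "partial_deriv b f"
  have [measurable]: "?p \<in> borel_measurable borel" "f \<in> borel_measurable borel" using f pf by auto
  define G where "G s x = indicator {0..1::real} s * ?p (s *\<^sub>R b + x)" for s x
  have [measurable]: "case_prod G \<in> borel_measurable lborel2"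
    unfolding G_def by measurable
  have i: "integrable lborel (\<lambda>x. ?p (s *\<^sub>R b + x))" for s
    using pf by (subst integrable_lborel_shift_iff) auto
  have "integrable lborel2 (case_prod G)"
  proof (rule lborel_pair.Fubini_integrable)
    have "(LBINT x. norm (G s x)) = indicator {0..1} s * (LBINT x. \<bar>?p x\<bar>)" for s
    proof -
      have "(LBINT x. norm (G s x)) = indicator {0..1} s * (LBINT x. \<bar>?p (s *\<^sub>R b + x)\<bar>)"
        unfolding G_def by (simp add: abs_mult)
      also have "(LBINT x. \<bar>?p (s *\<^sub>R b + x)\<bar>) = (LBINT x. \<bar>?p x\<bar>)"
        by (rule integral_lborel_shift) measurable
      finally show ?thesis .
    qed
    then show "integrable lborel (\<lambda>x. LBINT y. norm (case (x, y) of (x, xa) \<Rightarrow> G x xa))"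
      by simp
    show "AE x in lborel. integrable lborel (\<lambda>y. case (x, y) of (x, xa) \<Rightarrow> G x xa)"
      using i by (auto simp: G_def)
  qed measurable
  then have "(LBINT x. LBINT s. G s x) = (LBINT s. LBINT x. G s x)"
    by (rule lborel_pair.Fubini_integral)
  also have "(LBINT s. LBINT x. G s x) = (LBINT s. indicator {0..1::real} s * (LBINT x. ?p x))"
    unfolding G_def by (simp add: integral_lborel_shift[of ?p])
  also have "\<dots> = (LBINT x. ?p x)" by simp
  finally have "(LBINT x. ?p x) = (LBINT x. LBINT s. G s x)" ..
  also have "\<dots> = (LBINT x. f (b + x) - f x)"
  proof (rule arg_cong[where f = "integral\<^sup>L lborel"])
    show "(\<lambda>x. LBINT s. G s x) = (\<lambda>x. f (b + x) - f x)"
  proof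
    fix x
    have "(LBINT s. indicator {0..1} s *\<^sub>R ?p (s *\<^sub>R b + x)) = f (1 *\<^sub>R b + x) - f (0 *\<^sub>R b + x)"
    proof (rule integral_FTC_atLeastAtMost[where F = "\<lambda>s. f (s *\<^sub>R b + x)"])
      fix s :: real
      let ?D = "\<lambda>h. \<Sum>c\<in>Basis. (h \<bullet> c) * partial_deriv c f (s *\<^sub>R b + x)"
      have "((\<lambda>s. f (s *\<^sub>R b + x)) has_derivative (\<lambda>t. ?D (t *\<^sub>R b))) (at s within {0..1})"
        by (rule has_derivative_compose[of "\<lambda>s. s *\<^sub>R b + x" "\<lambda>t. t *\<^sub>R b" s _ f])
          (auto intro!: derivative_eq_intros has_derivative_partial_deriv diff)
      moreover have "?D (t *\<^sub>R b) = t *\<^sub>R ?p (s *\<^sub>R b + x)" for t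
        using b by (simp add: inner_Basis if_distrib if_distribR sum.delta' cong: if_cong)
      ultimately show "((\<lambda>s. f (s *\<^sub>R b + x)) has_vector_derivative ?p (s *\<^sub>R b + x)) (at s within {0..1})"
        by (simp add: has_vector_derivative_def)
    next
      show "continuous_on {0..1} (\<lambda>s. ?p (s *\<^sub>R b + x))"
        by (intro continuous_on_compose2[OF cont] continuous_intros) auto
    qed auto
    then show "(LBINT s. G s x) = f (b + x) - f x" by (simp add: G_def)
    qed
  qed
  also have "\<dots> = (LBINT x. f (b + x)) - (LBINT x. f x)"
    using f by (intro Bochner_Integration.integral_diff) (auto simp: integrable_lborel_shift_iff)
  also have "\<dots> = 0" by (simp add: integral_lborel_shift)
  finally show ?thesis .
qed

lemma integrable_compact_support:
  fixes f :: "'a::euclidean_space \<Rightarrow> real"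
  assumes "continuous_on UNIV f" "\<And>x. norm x > R \<Longrightarrow> f x = 0"
  shows "integrable lborel f"
proof -
  have "integrable lborel (\<lambda>x. indicator (cball 0 R) x *\<^sub>R f x)"
    by (rule borel_integrable_compact) (auto intro: continuous_on_subset[OF assms(1)])
  moreover have "(\<lambda>x. indicator (cball 0 R) x *\<^sub>R f x) = f"
    using assms(2) by (intro ext) (metis indicator_simps mem_cball_0 mult_zero_left mult_1
      not_le real_scaleR_def scaleR_one)
  ultimately show ?thesis by simp
qed

lemma partial_deriv_support:
  fixes f :: "'a::euclidean_space \<Rightarrow> real"
  assumes "\<And>x. norm x > R \<Longrightarrow> f x = 0" "norm x > R"
  shows "partial_deriv b f x = 0"
proof -
  have "open {x::'a. norm x > R}" by (intro open_Collect_less continuous_intros)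
  then have "(f has_derivative (\<lambda>_. 0)) (at x)"
    by (rule has_derivative_transform_within_open[of "\<lambda>_. 0", rotated])
      (use assms in auto)
  then show ?thesis by (simp add: partial_deriv_eqI)
qed

lemma integral_by_parts_partial_deriv:
  fixes f g :: "'a::euclidean_space \<Rightarrow> real"
  assumes b: "b \<in> Basis" and f: "C_diff 1 f" and g: "C_diff 1 g"
    and supp: "\<And>x. norm x > R \<Longrightarrow> g x = 0"
  shows "(LBINT x. f x * partial_deriv b g x) = - (LBINT x. partial_deriv b f x * g x)"
proof -
  have c: "continuous_on UNIV f" "continuous_on UNIV g"
    "continuous_on UNIV (partial_deriv b f)" "continuous_on UNIV (partial_deriv b g)"
    using f g b C_diff_continuous[OF f] C_diff_continuous[OF g] by auto
  have d: "f differentiable (at x)" "g differentiable (at x)" for x using f g by auto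
  have p: "partial_deriv b (\<lambda>x. f x * g x) = (\<lambda>x. f x * partial_deriv b g x + partial_deriv b f x * g x)"
    by (auto simp: partial_deriv_mult d)
  have s: "norm x > R \<Longrightarrow> partial_deriv b g x = 0" for x
    using partial_deriv_support[of R g x b] supp by blast
  have i: "integrable lborel (\<lambda>x. f x * partial_deriv b g x)" "integrable lborel (\<lambda>x. partial_deriv b f x * g x)"
    by (rule integrable_compact_support[where R = R];
        use s in \<open>force intro!: continuous_intros c simp: supp\<close>)+
  have "(LBINT x. partial_deriv b (\<lambda>x. f x * g x) x) = 0"
  proof (rule integral_partial_deriv_eq_0[OF b])
    show "integrable lborel (\<lambda>x. f x * g x)"
      by (rule integrable_compact_support[where R = R]) (auto intro!: continuous_intros c simp: supp)
    show "integrable lborel (partial_deriv b (\<lambda>x. f x * g x))" unfolding p using i by simp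
    show "continuous_on UNIV (partial_deriv b (\<lambda>x. f x * g x))" unfolding p by (intro continuous_intros c)
    show "(\<lambda>x. f x * g x) differentiable (at x)" for x using d by simp
  qed
  then show ?thesis unfolding p using i by simp
qed

lemma integral_laplacian_commute:
  fixes f g :: "'a::euclidean_space \<Rightarrow> real"
  assumes f: "C_diff 2 f" and g: "C_diff 2 g" and supp: "\<And>x. norm x > R \<Longrightarrow> g x = 0"
  shows "(LBINT x. f x * laplacian g x) = (LBINT x. laplacian f x * g x)"
proof -
  have f1: "C_diff 1 f" "C_diff 1 g" using f g C_diff_mono[of 1 2] by auto
  have fb: "C_diff 1 (partial_deriv b f)" "C_diff 1 (partial_deriv b g)" if "b \<in> Basis" for b
    using f g that by (auto simp: numeral_2_eq_2)
  have c: "continuous_on UNIV f" "continuous_on UNIV g"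
    using f g by (auto intro: C_diff_continuous)
  have cb: "continuous_on UNIV (partial_deriv b (partial_deriv b f))"
    "continuous_on UNIV (partial_deriv b (partial_deriv b g))" if "b \<in> Basis" for b
    using fb[OF that] that by auto
  have s1: "norm x > R \<Longrightarrow> partial_deriv b g x = 0" for x b
    using partial_deriv_support[of R g x b] supp by blast
  have s2: "norm x > R \<Longrightarrow> partial_deriv b (partial_deriv b g) x = 0" for x b
    using partial_deriv_support[of R "partial_deriv b g" x b] s1 by blast
  have i: "integrable lborel (\<lambda>x. f x * partial_deriv b (partial_deriv b g) x)"
    "integrable lborel (\<lambda>x. partial_deriv b (partial_deriv b f) x * g x)" if "b \<in> Basis" for b
    by (rule integrable_compact_support[where R = R];
        use that in \<open>force intro!: continuous_intros c cb simp: supp s2\<close>)+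
  have "(LBINT x. f x * laplacian g x) = (\<Sum>b\<in>Basis. LBINT x. f x * partial_deriv b (partial_deriv b g) x)"
    unfolding laplacian_def sum_distrib_left using i by (intro Bochner_Integration.integral_sum) auto
  also have "\<dots> = (\<Sum>b\<in>Basis. LBINT x. partial_deriv b (partial_deriv b f) x * g x)"
  proof (rule sum.cong[OF refl])
    fix b :: 'a assume b: "b \<in> Basis"
    have "(LBINT x. f x * partial_deriv b (partial_deriv b g) x) = - (LBINT x. partial_deriv b f x * partial_deriv b g x)"
      by (rule integral_by_parts_partial_deriv[OF b f1(1) fb(2)[OF b] s1])
    also have "(LBINT x. partial_deriv b f x * partial_deriv b g x) = - (LBINT x. partial_deriv b (partial_deriv b f) x * g x)"
      by (rule integral_by_parts_partial_deriv[OF b fb(1)[OF b] f1(2) supp])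
    finally show "(LBINT x. f x * partial_deriv b (partial_deriv b g) x) = (LBINT x. partial_deriv b (partial_deriv b f) x * g x)"
      by simp
  qed
  also have "\<dots> = (LBINT x. laplacian f x * g x)"
    unfolding laplacian_def sum_distrib_right using i by (intro Bochner_Integration.integral_sum[symmetric]) auto
  finally show ?thesis .
qed

lemma integral_bilaplacian_commute:
  fixes f g :: "'a::euclidean_space \<Rightarrow> real"
  assumes f: "C_diff 4 f" and g: "C_diff 4 g" and supp: "\<And>x. norm x > R \<Longrightarrow> g x = 0"
  shows "(LBINT x. f x * bilaplacian g x) = (LBINT x. bilaplacian f x * g x)"
proof -
  have 2: "C_diff 2 f" "C_diff 2 g" using f g C_diff_mono[of 2 4] by auto
  have l: "C_diff 2 (laplacian f)" "C_diff 2 (laplacian g)"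
    using C_diff_laplacian[of 2] f g by auto
  have s: "laplacian g x = 0" if "norm x > R" for x
    using supp that by (auto simp: laplacian_def intro!: sum.neutral partial_deriv_support)
  show ?thesis
    unfolding bilaplacian_def
    using integral_laplacian_commute[OF 2(1) l(2) s] integral_laplacian_commute[OF l(1) 2(2) supp] by simp
qed

section \<open>Bump functions\<close>

text \<open>The classical function \<open>exp (-1/t)\<close>, flat at 0, together with the powers of
  \<open>1/t\<close> that differentiation produces; the linear span of the family is closed under
  derivatives.\<close>

definition flat :: "nat \<Rightarrow> real \<Rightarrow> real" where
  "flat j t = (if t \<le> 0 then 0 else exp (- 1 / t) / t ^ j)"

text \<open>The shifted index is due to the use at 0: the difference quotient of
  \<open>flat j\<close> there is \<open>flat (Suc j)\<close>, and a linear bound makes it tend to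
  0.\<close>

lemma flat_bound: "\<bar>flat (Suc j) t\<bar> \<le> real (j + 2) ^ (j + 2) * \<bar>t\<bar>"
proof (cases "t \<le> 0")
  case False
  \<comment> \<open>The estimate below gives \<open>exp (-1/t) \<le> n ^ n * t ^ n\<close>; the
    exponent \<open>j + 2\<close> leaves exactly one power of \<open>t\<close> after division by
    \<open>t ^ Suc j\<close>.\<close>
  define n where "n = j + 2"
  have t: "t > 0" and n: "n > 0" using False by (auto simp: n_def)
  have "(1 / (t * n)) ^ n \<le> (1 + (1 / t) / n) ^ n"
    using t by (intro power_mono) auto
  also have "\<dots> \<le> exp (1 / t)"
    using t n by (intro exp_ge_one_plus_x_over_n_power_n) (auto simp: order_trans[of _ 0])
  finally have "1 \<le> exp (1 / t) * t ^ n * n ^ n" using t n by (simp add: power_divide power_mult_distrib field_simps)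
  then have "exp (- 1 / t) \<le> t ^ n * n ^ n" by (simp add: exp_minus field_simps)
  then have "exp (- 1 / t) / t ^ Suc j \<le> t ^ n * n ^ n / t ^ Suc j"
    using t by (intro divide_right_mono) auto
  also have "\<dots> = n ^ n * t" using t by (simp add: n_def)
  finally have "exp (- 1 / t) / t ^ Suc j \<le> n ^ n * t" .
  moreover have "\<bar>flat (Suc j) t\<bar> = exp (- 1 / t) / t ^ Suc j" using t by (simp add: flat_def)
  ultimately show ?thesis using t unfolding n_def by (simp only: abs_of_pos of_nat_power)
next
  case True
  then have "flat (Suc j) t = 0" by (simp add: flat_def)
  then show ?thesis by (simp only: abs_zero) simp
qed

lemma flat_has_derivative:
  "(flat j has_real_derivative (flat (j + 2) t - real j * flat (Suc j) t)) (at t)"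
proof -
  consider "t < 0" | "t = 0" | "t > 0" by linarith
  then show ?thesis
  proof cases
    case 1
    have "(flat j has_real_derivative 0) (at t)"
      by (rule has_field_derivative_transform_within_open[of "\<lambda>_. 0" _ _ "{..<0}"])
        (use 1 in \<open>auto simp: flat_def\<close>)
    then show ?thesis using 1 by (simp add: flat_def)
  next
    case 2
    have lim: "(\<lambda>h. real (j + 2) ^ (j + 2) * \<bar>h\<bar>) \<midarrow>0\<rightarrow> 0"
      by (rule tendsto_eq_intros refl | simp)+
    have "(\<lambda>h. (flat j (0 + h) - flat j 0) / h) \<midarrow>0\<rightarrow> 0"
    proof (rule Lim_null_comparison[OF _ lim], intro always_eventually allI)
      fix h :: real
      have "(flat j (0 + h) - flat j 0) / h = flat (Suc j) h" by (simp add: flat_def)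
      then show "norm ((flat j (0 + h) - flat j 0) / h) \<le> real (j + 2) ^ (j + 2) * \<bar>h\<bar>"
        using flat_bound[of j h] by simp
    qed
    then show ?thesis using 2 by (simp add: DERIV_def flat_def)
  next
    case 3
    have "((\<lambda>t. exp (- 1 / t) / t ^ j) has_real_derivative (flat (j + 2) t - real j * flat (Suc j) t)) (at t)"
      using 3 by (cases "j = 0")
        (auto intro!: derivative_eq_intros simp: flat_def field_simps power2_eq_square power_eq_if[of t j])
    then show ?thesis
      by (rule has_field_derivative_transform_within_open[of _ _ _ "{0<..}"])
        (use 3 in \<open>auto simp: flat_def\<close>)
  qed
qed

text \<open>The induction on the order treats all \<open>j\<close> at once, since the derivative of
  \<open>flat j\<close> involves the indices \<open>j + 1\<close> and \<open>j + 2\<close>.\<close>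

lemma C_diff_flat:
  assumes q: "\<And>k. C_diff k q"
  shows "C_diff k (\<lambda>x. flat j (q x))"
proof (induction k arbitrary: j)
  case 0
  have "continuous_on UNIV (flat j)"
    by (intro continuous_at_imp_continuous_on ballI DERIV_isCont[OF flat_has_derivative])
  then show ?case using q[of 0] by (auto intro: continuous_on_compose2)
next
  case (Suc k)
  have d: "q differentiable (at x)" for x using q[of 1] by simp
  have "partial_deriv b (\<lambda>x. flat j (q x))
     = (\<lambda>x. (flat (j + 2) (q x) + - real j * flat (Suc j) (q x)) * partial_deriv b q x)" for b
    by (rule ext) (simp add: partial_deriv_chain(1)[OF d flat_has_derivative])
  moreover have "C_diff k (\<lambda>x. (flat (j + 2) (q x) + - real j * flat (Suc j) (q x)) * partial_deriv b q x)"
    if "b \<in> Basis" for b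
    using q[of "Suc k"] that by (intro C_diff_mult C_diff_add C_diff_cmult Suc.IH) auto
  moreover have "(\<lambda>x. flat j (q x)) differentiable (at x)" for x
    by (rule partial_deriv_chain(2)[OF d flat_has_derivative])
  ultimately show ?case by simp
qed

lemma C_diff_inner: "C_diff k (\<lambda>x. (x - a) \<bullet> b)"
proof (cases k)
  case (Suc m)
  have "partial_deriv c (\<lambda>x. (x - a) \<bullet> b) = (\<lambda>x. c \<bullet> b)" for c
    by (auto intro!: partial_deriv_eqI derivative_eq_intros)
  then show ?thesis using Suc by (auto intro!: C_diff_const)
qed (auto intro!: continuous_intros)

lemma C_diff_sqdist: "C_diff k (\<lambda>x. c - (x - a) \<bullet> (x - a))"
proof (cases k)
  case (Suc m)
  have "partial_deriv b (\<lambda>x. c - (x - a) \<bullet> (x - a)) = (\<lambda>x. (-2) * ((x - a) \<bullet> b))" (is "_ = ?d b") for b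
    by (auto intro!: partial_deriv_eqI derivative_eq_intros simp: inner_commute)
  moreover have "(\<lambda>x. c - (x - a) \<bullet> (x - a)) differentiable (at x)" for x
    by (auto intro!: derivative_intros differentiableI derivative_eq_intros)
  moreover have "C_diff m (?d b)" for b by (intro C_diff_cmult C_diff_inner)
  ultimately show ?thesis using Suc by (simp del: mult_minus_left)
qed (auto intro!: continuous_intros)

definition bump :: "'a::euclidean_space \<Rightarrow> real \<Rightarrow> 'a \<Rightarrow> real" where
  "bump a r x = flat 0 (r\<^sup>2 - (x - a) \<bullet> (x - a))"

lemma bump_nonneg: "0 \<le> bump a r x"
  by (simp add: bump_def flat_def)

lemma bump_pos_iff: "0 < r \<Longrightarrow> 0 < bump a r x \<longleftrightarrow> dist a x < r"
proof -
  assume r: "0 < r"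
  have "(norm (x - a))\<^sup>2 < r\<^sup>2 \<longleftrightarrow> norm (x - a) < r"
    using r by (simp add: power_mono_iff abs_less_iff flip: abs_le_square_iff not_le)
  then show ?thesis
    by (auto simp: bump_def flat_def dist_norm norm_minus_commute[of a] power2_norm_eq_inner not_le)
qed

lemma test_function_bump:
  fixes a :: "'a::euclidean_space"
  assumes "0 < r"
  shows "test_function (bump a r)"
proof -
  have "{x. bump a r x \<noteq> 0} \<subseteq> cball a r"
    using bump_pos_iff[OF assms, of a] bump_nonneg[of a r] by (force simp: less_le)
  then have "bounded {x. bump a r x \<noteq> 0}" using bounded_subset bounded_cball by blast
  moreover have "C_diff k (bump a r)" for k
    unfolding bump_def[abs_def] by (intro C_diff_flat C_diff_sqdist)
  ultimately show ?thesis unfolding test_function_def by (simp add: compact_closure)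
qed

text \<open>If \<open>g a\<close> were positive, a bump supported where \<open>g > 0\<close> would
  give a nonnegative integrand with integral 0, so a ball would be a null set. The conclusion is
  one-sided; applying it to \<open>g\<close> and to its negative gives equality.\<close>

lemma test_function_eq_zeroI:
  fixes g :: "'a::euclidean_space \<Rightarrow> real"
  assumes g: "continuous_on UNIV g" and 0: "\<And>\<phi>. test_function \<phi> \<Longrightarrow> (LBINT x. g x * \<phi> x) = 0"
  shows "g a \<le> 0"
proof (rule ccontr)
  assume "\<not> g a \<le> 0"
  then have pos: "g a > 0" by simp
  have "open {x. g x > 0}" using g by (intro open_Collect_less continuous_intros) auto
  then obtain r where r: "r > 0" "\<And>x. dist a x < r \<Longrightarrow> g x > 0"
    using pos by (auto simp: open_contains_ball subset_iff mem_ball)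
  have tf: "test_function (bump a r)" using r by (intro test_function_bump)
  have nn: "0 \<le> g x * bump a r x" for x
    using r(2)[of x] bump_nonneg[of a r x] bump_pos_iff[OF r(1), of a x] by (cases "dist a x < r") (auto simp: less_le)
  have cont: "continuous_on UNIV (\<lambda>x. g x * bump a r x)"
    using tf g by (intro continuous_intros) (auto simp: test_function_def dest: spec[of _ 0])
  have "integrable lborel (\<lambda>x. g x * bump a r x)"
  proof (rule integrable_compact_support[where R = "norm a + r"])
    fix x :: 'a assume "norm x > norm a + r"
    moreover have "norm x \<le> norm a + dist a x"
      unfolding dist_norm using norm_triangle_ineq4[of a "a - x"] by simp
    ultimately have "\<not> dist a x < r" by linarith
    then show "g x * bump a r x = 0"
      using bump_pos_iff[OF r(1), of a x] bump_nonneg[of a r x] by simp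
  qed (fact cont)
  then have "AE x in lborel. g x * bump a r x = 0"
    using 0[OF tf] nn by (subst (asm) integral_nonneg_eq_0_iff_AE) auto
  then have "AE x in lborel. x \<notin> ball a r"
  proof eventually_elim
    case (elim x)
    then show ?case using r(2)[of x] bump_pos_iff[OF r(1), of a x] by auto
  qed
  then have "emeasure lborel (ball a r) = 0"
    by (subst (asm) AE_iff_measurable[of "ball a r"]) auto
  then show False using r(1) unit_ball_vol_pos[of "real DIM('a)"] by (simp add: emeasure_ball)
qed

text \<open>Compact support of the test function moves the bilaplacian back onto \<open>u\<close>
  without boundary terms. The continuous function \<open>bilaplacian u - G\<close> then annihilates
  all test functions.\<close>

lemma bilaplacian_eqI:
  fixes u G :: "'a::euclidean_space \<Rightarrow> real"
  assumes u: "C_diff 4 u" and G: "continuous_on UNIV G"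
    and eq: "\<And>\<phi>. test_function \<phi> \<Longrightarrow> (LBINT x. u x * bilaplacian \<phi> x) = (LBINT x. G x * \<phi> x)"
  shows "bilaplacian u x = G x"
proof -
  have cu: "continuous_on UNIV (bilaplacian u)"
  proof -
    have "C_diff 0 (laplacian (laplacian u))"
      using u by (intro C_diff_laplacian) (simp add: numeral_eq_Suc del: C_diff.simps)
    then show ?thesis by (simp add: bilaplacian_def)
  qed
  have z: "(LBINT x. (bilaplacian u x - G x) * \<phi> x) = 0" if t: "test_function \<phi>" for \<phi>
  proof -
    have c: "C_diff k \<phi>" for k using t by (simp add: test_function_def)
    have "bounded {x. \<phi> x \<noteq> 0}"
      using t compact_imp_bounded bounded_subset closure_subset by (metis test_function_def)
    then obtain R where R: "\<And>x. \<phi> x \<noteq> 0 \<Longrightarrow> norm x \<le> R" by (auto simp: bounded_iff)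
    then have s: "norm x > R \<Longrightarrow> \<phi> x = 0" for x by (meson not_le)
    have i: "integrable lborel (\<lambda>x. bilaplacian u x * \<phi> x)" "integrable lborel (\<lambda>x. G x * \<phi> x)"
      by (rule integrable_compact_support[where R = R];
         use s in \<open>auto intro!: continuous_intros cu G C_diff_continuous[OF c]\<close>)+
    have "(LBINT x. bilaplacian u x * \<phi> x) = (LBINT x. G x * \<phi> x)"
      using integral_bilaplacian_commute[OF u c s] eq[OF t] by simp
    with i show ?thesis by (simp add: left_diff_distrib)
  qed
  have z': "(LBINT x. (G x - bilaplacian u x) * \<phi> x) = 0" if t: "test_function \<phi>" for \<phi>
  proof -
    have "(LBINT x. (G x - bilaplacian u x) * \<phi> x) = (LBINT x. - ((bilaplacian u x - G x) * \<phi> x))"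
      by (intro Bochner_Integration.integral_cong) (auto simp: algebra_simps)
    then show ?thesis using z[OF t] by simp
  qed
  have "bilaplacian u x - G x \<le> 0" "G x - bilaplacian u x \<le> 0"
    by (rule test_function_eq_zeroI[where g = "\<lambda>x. bilaplacian u x - G x"];
        use z cu G in \<open>auto intro!: continuous_intros\<close>)
       (rule test_function_eq_zeroI[where g = "\<lambda>x. G x - bilaplacian u x"];
        use z' cu G in \<open>auto intro!: continuous_intros\<close>)
  then show ?thesis by simp
qed

section \<open>Convolution with a slowly varying weight\<close>

definition dominated :: "('a \<Rightarrow> real) \<Rightarrow> ('a \<Rightarrow> real) \<Rightarrow> bool" where
  "dominated w f \<longleftrightarrow> (\<exists>C. \<forall>x. \<bar>f x\<bar> \<le> C * w x)"

lemma dominatedD: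
  assumes "dominated w f" "\<And>x. 0 \<le> w x"
  shows "\<exists>C\<ge>0. \<forall>x. \<bar>f x\<bar> \<le> C * w x"
proof -
  obtain C where C: "\<And>x. \<bar>f x\<bar> \<le> C * w x" using assms by (auto simp: dominated_def)
  have "\<bar>f x\<bar> \<le> max 0 C * w x" for x
    using C[of x] mult_right_mono[of C "max 0 C" "w x"] assms(2)[of x] by (meson max.cobounded2 order_trans)
  then show ?thesis by (intro exI[of _ "max 0 C"]) auto
qed

lemma dominated_add:
  assumes "dominated w f" "dominated w g" shows "dominated w (\<lambda>x. f x + g x)"
proof -
  obtain C D where C: "\<And>x. \<bar>f x\<bar> \<le> C * w x" and D: "\<And>x. \<bar>g x\<bar> \<le> D * w x"
    using assms by (auto simp: dominated_def)
  have "\<bar>f x + g x\<bar> \<le> (C + D) * w x" for x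
    unfolding distrib_right using C[of x] D[of x] by linarith
  then show ?thesis by (auto simp: dominated_def)
qed

lemma dominated_mult:
  assumes "dominated w f" "dominated v g" "\<And>x. 0 \<le> w x" "\<And>x. 0 \<le> v x"
  shows "dominated (\<lambda>x. w x * v x) (\<lambda>x. f x * g x)"
proof -
  obtain C where C: "0 \<le> C" "\<And>x. \<bar>f x\<bar> \<le> C * w x" using dominatedD[OF assms(1,3)] by auto
  obtain D where D: "0 \<le> D" "\<And>x. \<bar>g x\<bar> \<le> D * v x" using dominatedD[OF assms(2,4)] by auto
  have "\<bar>f x * g x\<bar> \<le> (C * D) * (w x * v x)" for x
    using mult_mono[OF C(2)[of x] D(2)[of x]] C D assms(3)[of x] by (simp add: abs_mult mult_ac)
  then show ?thesis by (auto simp: dominated_def)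
qed

lemma dominated_trans:
  assumes "dominated w f" "dominated v w" "\<And>x. 0 \<le> w x"
  shows "dominated v f"
proof -
  obtain C where C: "0 \<le> C" "\<And>x. \<bar>f x\<bar> \<le> C * w x" using dominatedD[OF assms(1,3)] by auto
  obtain D where D: "\<And>x. \<bar>w x\<bar> \<le> D * v x" using assms by (auto simp: dominated_def)
  have "\<bar>f x\<bar> \<le> (C * D) * v x" for x
    using C(2)[of x] mult_left_mono[OF D[of x] C(1)] assms(3)[of x] by simp
  then show ?thesis by (auto simp: dominated_def)
qed

lemma dominated_cmult: "dominated w f \<Longrightarrow> dominated w (\<lambda>x. c * f x)"
proof -
  assume "dominated w f"
  then obtain C where C: "\<And>x. \<bar>f x\<bar> \<le> C * w x" by (auto simp: dominated_def)
  have "\<bar>c * f x\<bar> \<le> (\<bar>c\<bar> * C) * w x" for x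
    using mult_left_mono[OF C[of x], of "\<bar>c\<bar>"] by (simp add: abs_mult mult_ac)
  then show ?thesis by (auto simp: dominated_def)
qed

text \<open>
  Convolution with a singular kernel: all derivatives fall on the density, and they are dominated
  by the convolution of the kernel with the weight because the weight varies slowly.
\<close>

lemma cdiff_convolution:
  fixes k w f :: "'a::euclidean_space \<Rightarrow> real"
  assumes [measurable]: "k \<in> borel_measurable borel" "w \<in> borel_measurable borel"
    and w0: "\<And>x. 0 \<le> w x"
    and H: "\<And>x h. norm h \<le> 1 \<Longrightarrow> w (x + h) \<le> H * w x"
    and int: "\<And>x. integrable lborel (\<lambda>z. \<bar>k z\<bar> * w (x - z))"
  shows "cdiff (dominated w) j f \<Longrightarrow>
    cdiff (dominated (\<lambda>x. LBINT z. \<bar>k z\<bar> * w (x - z))) j (\<lambda>x. LBINT z. k z * f (x - z))"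
proof (induction j arbitrary: f)
  have meas: "g \<in> borel_measurable borel" if "cdiff (dominated w) j g" for j g
    using cdiff_continuous[OF that] by (rule borel_measurable_continuous_onI)
  have intf: "integrable lborel (\<lambda>z. k z * g (x - z))"
    if g: "dominated w g" and [measurable]: "g \<in> borel_measurable borel" for g x
  proof -
    obtain C where C: "0 \<le> C" "\<And>x. \<bar>g x\<bar> \<le> C * w x" using dominatedD[OF g w0] by auto
    show ?thesis
    proof (rule integrable_dominated)
      show "integrable lborel (\<lambda>z. C * (\<bar>k z\<bar> * w (x - z)))" using int by simp
      show "AE z in lborel. norm (k z * g (x - z)) \<le> norm (C * (\<bar>k z\<bar> * w (x - z)))"
      proof (rule AE_I2)
        fix z
        show "norm (k z * g (x - z)) \<le> norm (C * (\<bar>k z\<bar> * w (x - z)))"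
          using mult_left_mono[OF C(2)[of "x - z"], of "\<bar>k z\<bar>"] C w0[of "x - z"] by (simp add: abs_mult mult_ac)
      qed
    qed measurable
  qed
  have dom: "dominated (\<lambda>x. LBINT z. \<bar>k z\<bar> * w (x - z)) (\<lambda>x. LBINT z. k z * g (x - z))"
    if g: "dominated w g" and [measurable]: "g \<in> borel_measurable borel" for g
  proof -
    obtain C where C: "0 \<le> C" "\<And>x. \<bar>g x\<bar> \<le> C * w x" using dominatedD[OF g w0] by auto
    have "\<bar>LBINT z. k z * g (x - z)\<bar> \<le> C * (LBINT z. \<bar>k z\<bar> * w (x - z))" for x
    proof -
      have "\<bar>LBINT z. k z * g (x - z)\<bar> \<le> (LBINT z. \<bar>k z * g (x - z)\<bar>)"
        by (rule integral_abs_bound)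
      also have "\<dots> \<le> (LBINT z. C * (\<bar>k z\<bar> * w (x - z)))"
      proof (rule integral_mono)
        show "integrable lborel (\<lambda>z. \<bar>k z * g (x - z)\<bar>)" by (rule integrable_abs[OF intf[OF that]])
        show "integrable lborel (\<lambda>z. C * (\<bar>k z\<bar> * w (x - z)))" using int by simp
        show "\<bar>k z * g (x - z)\<bar> \<le> C * (\<bar>k z\<bar> * w (x - z))" for z
          using mult_left_mono[OF C(2)[of "x - z"], of "\<bar>k z\<bar>"] by (simp add: abs_mult mult_ac)
      qed
      finally show ?thesis by simp
    qed
    then show ?thesis by (auto simp: dominated_def)
  qed
  {
    case 0
    then have f: "continuous_on UNIV f" "dominated w f" and [measurable]: "f \<in> borel_measurable borel"
      using meas[of 0 f] by auto
    obtain C where C: "0 \<le> C" "\<And>x. \<bar>f x\<bar> \<le> C * w x" using dominatedD[OF f(2) w0] by auto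
    have "isCont (\<lambda>x. LBINT z. k z * f (x - z)) x" for x
      unfolding continuous_at_sequentially
    proof (intro allI impI)
      fix X assume X: "X \<longlonglongrightarrow> x"
      obtain N where N: "\<And>n. n \<ge> N \<Longrightarrow> norm (X n - x) \<le> 1"
        using LIMSEQ_D[OF X, of 1] by (auto intro: less_imp_le)
      have "(\<lambda>n. LBINT z. k z * f (X (n + N) - z)) \<longlonglongrightarrow> (LBINT z. k z * f (x - z))"
      \<comment> \<open>From \<open>N\<close> on the points are within distance 1 of
        \<open>x\<close>, so the slow variation of \<open>w\<close> yields one integrable bound for
        the whole sequence.\<close>
      proof (rule integral_dominated_convergence[where w = "\<lambda>z. C * H * (\<bar>k z\<bar> * w (x - z))"])
        show "integrable lborel (\<lambda>z. C * H * (\<bar>k z\<bar> * w (x - z)))" using int by simp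
        show "AE z in lborel. (\<lambda>n. k z * f (X (n + N) - z)) \<longlonglongrightarrow> k z * f (x - z)"
        proof (rule AE_I2)
          fix z
          have "isCont f (x - z)" using f(1) by (simp add: continuous_on_eq_continuous_at)
          moreover have "(\<lambda>n. X (n + N) - z) \<longlonglongrightarrow> x - z"
            using LIMSEQ_ignore_initial_segment[OF X, of N] by (intro tendsto_intros)
          ultimately show "(\<lambda>n. k z * f (X (n + N) - z)) \<longlonglongrightarrow> k z * f (x - z)"
            by (intro tendsto_mult_left isCont_tendsto_compose[of "x - z" f])
        qed
        show "AE z in lborel. norm (k z * f (X (n + N) - z)) \<le> C * H * (\<bar>k z\<bar> * w (x - z))" for n
        proof (rule AE_I2)
          fix z
          have "w (X (n + N) - z) \<le> H * w (x - z)"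
            using H[OF N[of "n + N"], of "x - z"] by simp
          then have "\<bar>f (X (n + N) - z)\<bar> \<le> C * (H * w (x - z))"
            using C(2)[of "X (n + N) - z"] mult_left_mono[of _ _ C] C(1) by (meson order_trans)
          then show "norm (k z * f (X (n + N) - z)) \<le> C * H * (\<bar>k z\<bar> * w (x - z))"
            using mult_left_mono[of "\<bar>f (X (n + N) - z)\<bar>" "C * (H * w (x - z))" "\<bar>k z\<bar>"]
            by (simp add: abs_mult mult_ac)
        qed
      qed measurable
      then show "((\<lambda>x. LBINT z. k z * f (x - z)) \<circ> X) \<longlonglongrightarrow> (LBINT z. k z * f (x - z))"
        unfolding o_def by (rule LIMSEQ_offset)
    qed
    then show ?case using dom[of f] f by (auto intro: continuous_at_imp_continuous_on)
  next
    case (Suc j)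
    have f: "dominated w f" "\<And>x. f differentiable (at x)" "\<And>b. b \<in> Basis \<Longrightarrow> cdiff (dominated w) j (partial_deriv b f)"
      using Suc.prems by auto
    have [measurable]: "f \<in> borel_measurable borel" by (rule meas[OF Suc.prems])
    have "\<forall>b\<in>Basis. \<exists>C\<ge>0. \<forall>x. \<bar>partial_deriv b f x\<bar> \<le> C * w x"
      using dominatedD[OF cdiff_prop[OF f(3)] w0] by simp
    then obtain c where "\<forall>b\<in>Basis. 0 \<le> c b \<and> (\<forall>x. \<bar>partial_deriv b f x\<bar> \<le> c b * w x)"
      using bchoice[of Basis "\<lambda>b C. 0 \<le> C \<and> (\<forall>x. \<bar>partial_deriv b f x\<bar> \<le> C * w x)"] by blast
    then have c: "\<And>b. b \<in> Basis \<Longrightarrow> 0 \<le> c b" "\<And>b x. b \<in> Basis \<Longrightarrow> \<bar>partial_deriv b f x\<bar> \<le> c b * w x"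
      by auto
    define C where "C = (\<Sum>b\<in>Basis. c b)"
    have C0: "0 \<le> C" using c by (auto simp: C_def intro: sum_nonneg)
    have C: "\<bar>partial_deriv b f x\<bar> \<le> C * w x" if "b \<in> Basis" for b x
    proof -
      have "c b \<le> C" unfolding C_def using c that by (intro member_le_sum) auto
      then show ?thesis using c(2)[OF that, of x] w0[of x] by (meson mult_right_mono order_trans)
    qed
    let ?K = "\<lambda>f x. LBINT z. k z * f (x - z)"
    let ?D = "\<lambda>y h. \<Sum>b\<in>Basis. (h \<bullet> b) * partial_deriv b f y"
    have der: "(?K f has_derivative (\<lambda>h. LBINT z. k z * ?D (x - z) h)) (at x)" for x
    proof (rule has_derivative_lebesgue_integral(2)[where f = "\<lambda>x z. k z * f (x - z)"])
      show "integrable lborel (\<lambda>z. k z * f (x + h - z))" for h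
        using intf[OF f(1)] by simp
      show "((\<lambda>x. k z * f (x - z)) has_derivative (\<lambda>h. k z * ?D (x - z) h)) (at x)" for z
        by (rule has_derivative_mult_right)
           (rule has_derivative_compose[of "\<lambda>x. x - z" "\<lambda>h. h" x UNIV f],
             auto intro!: derivative_eq_intros has_derivative_partial_deriv f)
      show "integrable lborel (\<lambda>z. real DIM('a) * (C * H) * (\<bar>k z\<bar> * w (x - z)))" using int by simp
      fix h z :: 'a assume h: "norm h \<le> 1"
      have "\<bar>f ((x - z) + h) - f (x - z)\<bar> \<le> real DIM('a) * (C * (H * w (x - z))) * norm h"
      proof (rule lipschitz_partial_deriv[OF f(2)])
        fix y b :: 'a assume y: "y \<in> closed_segment (x - z) (x - z + h)" and b: "b \<in> Basis"
        obtain t where t: "0 \<le> t" "t \<le> 1" "y = (x - z) + t *\<^sub>R h"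
          using y by (auto simp: in_segment algebra_simps)
        have "norm (t *\<^sub>R h) \<le> 1" using t h by (simp add: mult_le_one)
        then have "w y \<le> H * w (x - z)" using H t by simp
        then show "\<bar>partial_deriv b f y\<bar> \<le> C * (H * w (x - z))"
          using C[OF b, of y] C0 by (meson mult_left_mono order_trans)
      qed
      then have "\<bar>k z\<bar> * \<bar>f ((x - z) + h) - f (x - z)\<bar> \<le> \<bar>k z\<bar> * (real DIM('a) * (C * (H * w (x - z))) * norm h)"
        by (intro mult_left_mono) auto
      then show "\<bar>k z * f (x + h - z) - k z * f (x - z)\<bar> \<le> real DIM('a) * (C * H) * (\<bar>k z\<bar> * w (x - z)) * norm h"
        by (simp add: abs_mult[symmetric] algebra_simps)
    qed
    have "?K f differentiable (at x)" for x using der by (auto simp: differentiable_def)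
    moreover have "partial_deriv b (?K f) = ?K (partial_deriv b f)" if "b \<in> Basis" for b
    proof
      fix x
      show "partial_deriv b (?K f) x = ?K (partial_deriv b f) x"
        using partial_deriv_eqI[OF der, of b x] that
        by (simp add: inner_Basis if_distrib if_distribR sum.delta' cong: if_cong)
    qed
    moreover have "cdiff (dominated (\<lambda>x. LBINT z. \<bar>k z\<bar> * w (x - z))) j (?K (partial_deriv b f))" if "b \<in> Basis" for b
      using Suc.IH[OF f(3)[OF that]] .
    ultimately show ?case using dom[OF f(1)] by simp
  }
qed

section \<open>A priori bounds\<close>

text \<open>Absolute continuity of the integral, uniform in the centre: the excess of
  \<open>f\<close> over a high level \<open>n\<close> has small total integral, and the part below
  the level contributes at most \<open>n\<close> times the volume of the ball, wherever the ball
  lies.\<close>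

lemma uniform_small_ball:
  fixes f :: "'a::euclidean_space \<Rightarrow> real"
  assumes f: "integrable lborel f" and f0: "\<And>x. 0 \<le> f x" and e: "0 < \<epsilon>"
  shows "\<exists>r>0. r \<le> 1 \<and> (\<forall>x. (LBINT y. f y * indicator {..<r} (norm (x - y))) \<le> \<epsilon>)"
proof -
  have [measurable]: "f \<in> borel_measurable borel" using f by auto
  have "(\<lambda>n. LBINT y. f y - min (f y) (real n)) \<longlonglongrightarrow> integral\<^sup>L lborel (\<lambda>_::'a. 0::real)"
  proof (rule integral_dominated_convergence[where w = f])
    show "AE y in lborel. (\<lambda>n. f y - min (f y) (real n)) \<longlonglongrightarrow> 0"
    proof (rule AE_I2, rule tendsto_eventually)
      fix y
      obtain N where "f y \<le> real N" using real_arch_simple by blast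
      then show "\<forall>\<^sub>F n in sequentially. f y - min (f y) (real n) = 0"
        by (intro eventually_sequentiallyI[of N]) auto
    qed
  qed (use f f0 in \<open>auto simp: min_def\<close>)
  then obtain n where n: "(LBINT y. f y - min (f y) (real n)) < \<epsilon> / 2"
    using order_tendstoD(2)[of _ 0 sequentially "\<epsilon> / 2"] e by (force simp: eventually_sequentially)
  let ?V = "unit_ball_vol (real DIM('a))"
  have V: "?V > 0" by simp
  \<comment> \<open>Chosen so that \<open>n * ?V * r\<close> is at most \<epsilon>/2;
    \<open>n + 1\<close> avoids a zero denominator, and \<open>r \<le> 1\<close> allows
    \<open>r ^ DIM('a) \<le> r\<close>.\<close>
  define r where "r = min 1 (\<epsilon> / (2 * (real n + 1) * ?V))"
  have r: "0 < r" "r \<le> 1" using e V by (auto simp: r_def)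
  have mi: "integrable lborel (\<lambda>y. f y - min (f y) (real n))"
    by (rule integrable_dominated[OF f]) (use f0 in \<open>auto simp: min_def\<close>)
  have "(LBINT y. f y * indicator {..<r} (norm (x - y))) \<le> \<epsilon>" for x
  proof -
    have b: "indicator {..<r} (norm (x - y)) = (indicator (ball x r) y :: real)" for y
      by (auto simp: indicator_def dist_norm)
    have ib: "integrable lborel (indicator (ball x r) :: 'a \<Rightarrow> real)"
      using r by (intro integrable_real_indicator) (auto simp: emeasure_ball)
    have "(LBINT y. f y * indicator (ball x r) y)
      \<le> (LBINT y. (f y - min (f y) (real n)) + real n * indicator (ball x r) y)"
    proof (rule integral_mono)
      show "integrable lborel (\<lambda>y. f y * indicator (ball x r) y)"
        by (rule integrable_dominated[OF f]) (auto simp: indicator_def)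
      show "integrable lborel (\<lambda>y. (f y - min (f y) (real n)) + real n * indicator (ball x r) y)"
        using mi ib by simp
      show "f y * indicator (ball x r) y \<le> (f y - min (f y) (real n)) + real n * indicator (ball x r) y" for y
        using f0[of y] by (auto simp: indicator_def)
    qed
    also have "\<dots> = (LBINT y. f y - min (f y) (real n)) + real n * measure lborel (ball x r)"
      using mi ib by simp
    also have "measure lborel (ball x r) = ?V * r ^ DIM('a)"
      using r by (simp add: content_ball)
    also have "real n * (?V * r ^ DIM('a)) \<le> real n * (?V * r)"
      using r V power_decreasing[of 1 "DIM('a)" r] by (intro mult_left_mono) auto
    also have "\<dots> \<le> real n * (?V * (\<epsilon> / (2 * (real n + 1) * ?V)))"
      using V by (intro mult_left_mono) (auto simp: r_def)
    also have "\<dots> = (real n / (real n + 1)) * (\<epsilon> / 2)"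
    proof -
      have eq: "m * (v * (\<epsilon> / (2 * k * v))) = (m / k) * (\<epsilon> / 2)" if "v > 0" for m k v :: real
        using that by simp
      show ?thesis by (rule eq[OF V])
    qed
    also have "\<dots> \<le> 1 * (\<epsilon> / 2)" using e by (intro mult_right_mono) auto
    finally show ?thesis using n unfolding b by simp
  qed
  with r show ?thesis by blast
qed

text \<open>Young's inequality for the product of the kernel and \<open>exp a\<close>, with
  \<open>p\<close> on the exponential and the conjugate exponent on the kernel. The factors
  \<open>1/p\<close> and its dual are at most 1 and are dropped. At \<open>t = 0\<close> the kernel
  terms are 0 by the conventions for division and \<open>powr\<close>.\<close>

lemma inverse_Young:
  fixes a s p :: real
  assumes "p > 1" "t \<ge> 0"
  shows "exp a / t powr s \<le> 1 / t powr (s * (p / (p - 1))) + exp (p * a)"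
proof -
  let ?q = "p / (p - 1)"
  have q: "?q > 1" "1 / ?q + 1 / p = 1" using assms by (auto simp: field_simps)
  have "(1 / t powr s) * exp a \<le> (1 / t powr s) powr ?q / ?q + exp a powr p / p"
    using assms q by (intro Youngs_inequality) auto
  also have "\<dots> \<le> (1 / t powr s) powr ?q / 1 + exp a powr p / 1"
    using assms q by (intro add_mono divide_left_mono) auto
  also have "(1 / t powr s) powr ?q = 1 / t powr (s * ?q)"
    by (simp add: powr_divide powr_powr)
  also have "exp a powr p = exp (p * a)" by (simp add: powr_def)
  finally show ?thesis by simp
qed

text \<open>The consequences of the representation formula, the mass condition and the integrability
  of \<open>F\<close> are collected here, with Borel functions and \<open>lborel\<close>, so that
  product measures can be used. The distributional equation joins in at
  \<open>bilaplacian_u\<close>.\<close>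

locale choquard =
  fixes \<alpha> C0 :: real and u I F :: "real^4 \<Rightarrow> real"
  assumes \<alpha>: "0 < \<alpha>" "\<alpha> < 4"
    and u_meas [measurable]: "u \<in> borel_measurable borel"
    and I_eq: "I = (\<lambda>x. LBINT y. exp (u y) / norm (x - y) powr \<alpha>)"
    and F_eq: "F = (\<lambda>x. I x * exp (u x))"
    and mass: "integrable lborel (\<lambda>x. exp (8 / (8 - \<alpha>) * u x))"
    and F_int: "integrable lborel F"
    and F_log: "\<And>x. integrable lborel (\<lambda>y. ln (norm (x - y)) * F y)"
    and u_eq: "\<And>x. u x = - (1 / (8 * pi\<^sup>2)) * (LBINT y. ln (norm (x - y)) * F y) + C0"
begin

definition c0 :: real where "c0 = 1 / (8 * pi\<^sup>2)"

definition M :: real where "M = (LBINT x. F x)"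

lemma c0_pos: "c0 > 0" by (simp add: c0_def)

lemma I_nonneg: "0 \<le> I x" unfolding I_eq by (intro integral_nonneg_AE AE_I2) auto

lemma F_nonneg: "0 \<le> F x" unfolding F_eq using I_nonneg by simp

lemma F_meas [measurable]: "F \<in> borel_measurable borel" using F_int by auto

lemma M_nonneg: "0 \<le> M" unfolding M_def using F_nonneg by (intro integral_nonneg_AE AE_I2)

lemma nn_F: "(\<integral>\<^sup>+x. ennreal (F x) \<partial>lborel) = ennreal M"
  unfolding M_def by (rule nn_integral_eq_integral[OF F_int]) (simp add: F_nonneg)

lemma u_eq': "u x = c0 * (LBINT y. - ln (norm (x - y)) * F y) + C0"
  using u_eq[of x] by (simp add: c0_def)

text \<open>
  Jensen's inequality with the measure \<open>p c\<^sub>0 F dy\<close> on a ball so small that its mass is at most 1;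
  \<open>exp\<close> of the logarithmic kernel is then only \<open>1 / \<bar>x - y\<bar>\<close>, whatever \<open>p\<close> is.
\<close>

lemma exp_u_pointwise:
  assumes p: "p > 0"
  shows "\<exists>A\<ge>0. \<forall>x. ennreal (exp (p * u x)) \<le>
    ennreal A * (1 + (\<integral>\<^sup>+y. ennreal (F y / norm (x - y)) * near x y \<partial>lborel))"
proof -
  have "0 < 1 / (p * c0)" using p c0_pos by simp
  from uniform_small_ball[OF F_int F_nonneg this] obtain r where r: "0 < r" "r \<le> 1"
    and sm: "\<And>x. (LBINT y. F y * indicator {..<r} (norm (x - y))) \<le> 1 / (p * c0)" by blast
  \<comment> \<open>The term with \<open>M\<close> pays for distances at least \<open>r\<close>: the
    kernel there is at most \<open>- ln r\<close>, which is nonnegative because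
    \<open>r \<le> 1\<close>, so the whole mass may be charged.\<close>
  define B where "B = p * c0 * (- ln r * M) + p * C0"
  define A where "A = exp B * max 1 (p * c0)"
  show ?thesis
  proof (intro exI[of _ A] conjI allI)
    show "0 \<le> A" by (simp add: A_def)
    fix x
    define g where "g y = p * c0 * (F y * indicator {..<r} (norm (x - y)))" for y
    define \<phi> where "\<phi> y = - ln (norm (x - y))" for y
    have [measurable]: "\<phi> \<in> borel_measurable borel" "g \<in> borel_measurable borel"
      unfolding g_def \<phi>_def by measurable
    have i: "integrable lborel (\<lambda>y. \<phi> y * F y)" using F_log[of x] by (simp add: \<phi>_def)
    have i1: "integrable lborel (\<lambda>y. \<phi> y * F y * indicator {..<r} (norm (x - y)))"
      by (rule integrable_dominated[OF i]) (auto simp: indicator_def)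
    have i2: "integrable lborel (\<lambda>y. \<phi> y * F y * indicator {r..} (norm (x - y)))"
      by (rule integrable_dominated[OF i]) (auto simp: indicator_def)
    have i3: "integrable lborel (\<lambda>y. F y * indicator {..<r} (norm (x - y)))"
      by (rule integrable_dominated[OF F_int]) (auto simp: indicator_def)
    have "(LBINT y. \<phi> y * F y) = (LBINT y. \<phi> y * F y * indicator {..<r} (norm (x - y))
        + \<phi> y * F y * indicator {r..} (norm (x - y)))"
      by (intro Bochner_Integration.integral_cong) (auto simp: indicator_def)
    also have "\<dots> = (LBINT y. \<phi> y * F y * indicator {..<r} (norm (x - y)))
        + (LBINT y. \<phi> y * F y * indicator {r..} (norm (x - y)))"
      by (rule Bochner_Integration.integral_add[OF i1 i2])
    also have "(LBINT y. \<phi> y * F y * indicator {r..} (norm (x - y))) \<le> (LBINT y. - ln r * F y)"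
    proof (rule integral_mono[OF i2])
      show "integrable lborel (\<lambda>y. - ln r * F y)" using F_int by simp
      fix y
      show "\<phi> y * F y * indicator {r..} (norm (x - y)) \<le> - ln r * F y"
      proof (cases "norm (x - y) \<ge> r")
        case True
        moreover from True r have "norm (x - y) > 0" by linarith
          ultimately have "\<phi> y \<le> - ln r" using r by (simp add: \<phi>_def)
        then show ?thesis using True F_nonneg[of y] mult_right_mono[of "\<phi> y" "- ln r" "F y"] by simp
      next
        case False
        have "0 \<le> - ln r * F y" using r F_nonneg[of y] by (intro mult_nonneg_nonneg) auto
        then show ?thesis using False by simp
      qed
    qed
    also have "(LBINT y. - ln r * F y) = - ln r * M" by (simp add: M_def)
    finally have "(LBINT y. \<phi> y * F y) \<le> (LBINT y. \<phi> y * F y * indicator {..<r} (norm (x - y))) + - ln r * M"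
      by simp
    then have "p * c0 * (LBINT y. \<phi> y * F y)
        \<le> p * c0 * ((LBINT y. \<phi> y * F y * indicator {..<r} (norm (x - y))) + - ln r * M)"
      using p c0_pos by (intro mult_left_mono) auto
    also have "p * c0 * (LBINT y. \<phi> y * F y) = p * u x - p * C0"
    proof -
      have "c0 * (LBINT y. \<phi> y * F y) = u x - C0" using u_eq'[of x] by (simp add: \<phi>_def)
      then show ?thesis by (simp only: mult.assoc right_diff_distrib)
    qed
    also have "p * c0 * ((LBINT y. \<phi> y * F y * indicator {..<r} (norm (x - y))) + - ln r * M)
        = (LBINT y. \<phi> y * g y) + p * c0 * (- ln r * M)"
    proof -
      have "(LBINT y. \<phi> y * g y) = (LBINT y. p * c0 * (\<phi> y * F y * indicator {..<r} (norm (x - y))))"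
        by (intro Bochner_Integration.integral_cong) (auto simp: g_def)
      then show ?thesis by (simp add: algebra_simps)
    qed
    finally have "p * u x \<le> (LBINT y. \<phi> y * g y) + B" by (simp add: B_def)
    then have l1: "ennreal (exp (p * u x)) \<le> ennreal (exp B) * ennreal (exp (LBINT y. \<phi> y * g y))"
      by (simp add: ennreal_mult[symmetric] exp_add[symmetric] add.commute)
    have l2: "ennreal (exp (LBINT y. \<phi> y * g y)) \<le> 1 + (\<integral>\<^sup>+y. ennreal (exp (\<phi> y) * g y) \<partial>lborel)"
    proof (rule exp_integral_le)
      show "integrable lborel g" unfolding g_def using i3 by simp
      show "0 \<le> g y" for y using p c0_pos F_nonneg by (simp add: g_def)
      have "(LBINT y. g y) = p * c0 * (LBINT y. F y * indicator {..<r} (norm (x - y)))"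
        unfolding g_def by simp
      also have "\<dots> \<le> p * c0 * (1 / (p * c0))" using sm p c0_pos by (intro mult_left_mono) auto
      finally show "(LBINT y. g y) \<le> 1" using p c0_pos by simp
      have "(\<lambda>y. \<phi> y * g y) = (\<lambda>y. p * c0 * (\<phi> y * F y * indicator {..<r} (norm (x - y))))"
        by (auto simp: g_def)
      then show "integrable lborel (\<lambda>y. \<phi> y * g y)" using i1 by simp
    qed measurable
    have l3: "(\<integral>\<^sup>+y. ennreal (exp (\<phi> y) * g y) \<partial>lborel) \<le>
      (\<integral>\<^sup>+y. ennreal (p * c0) * (ennreal (F y / norm (x - y)) * near x y) \<partial>lborel)"
    proof (rule nn_integral_mono_AE)
      show "AE y in lborel. ennreal (exp (\<phi> y) * g y)
        \<le> ennreal (p * c0) * (ennreal (F y / norm (x - y)) * near x y)"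
        using AE_lborel_singleton[of x]
      proof eventually_elim
        case (elim y)
        then have "exp (\<phi> y) = 1 / norm (x - y)" by (simp add: \<phi>_def exp_minus inverse_eq_divide)
        then show ?case using r p c0_pos F_nonneg[of y]
          by (auto simp: g_def indicator_def ennreal_mult[symmetric])
      qed
    qed
    have l4: "(\<integral>\<^sup>+y. ennreal (p * c0) * (ennreal (F y / norm (x - y)) * near x y) \<partial>lborel)
       = ennreal (p * c0) * (\<integral>\<^sup>+y. ennreal (F y / norm (x - y)) * near x y \<partial>lborel)"
      (is "_ = _ * ?N") by (rule nn_integral_cmult) measurable
    have l5: "1 + ennreal (p * c0) * ?N \<le> ennreal (max 1 (p * c0)) * (1 + ?N)"
    proof -
      have "1 \<le> ennreal (max 1 (p * c0))" by (simp add: ennreal_ge_1)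
      moreover have "ennreal (p * c0) * ?N \<le> ennreal (max 1 (p * c0)) * ?N"
        by (intro mult_right_mono ennreal_leI) auto
      ultimately have "1 + ennreal (p * c0) * ?N \<le> ennreal (max 1 (p * c0)) + ennreal (max 1 (p * c0)) * ?N"
        by (rule add_mono)
      then show ?thesis by (simp only: distrib_left mult_1_right)
    qed
    have "ennreal (exp (LBINT y. \<phi> y * g y)) \<le> ennreal (max 1 (p * c0)) * (1 + ?N)"
      by (rule order_trans[OF order_trans[OF l2 add_left_mono[OF l3[unfolded l4]]] l5])
    then have "ennreal (exp (p * u x)) \<le> ennreal (exp B) * (ennreal (max 1 (p * c0)) * (1 + ?N))"
      by (intro order_trans[OF l1] mult_left_mono) auto
    then show "ennreal (exp (p * u x)) \<le> ennreal A * (1 + ?N)"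
      by (simp add: A_def ennreal_mult mult.assoc)
  qed
qed

text \<open>Inside the ball \<open>1 \<le> 1 / norm (x - y)\<close> off the centre, so a kernel
  bound already proved also bounds the volume.\<close>

lemma nn_unit_ball_bound:
  "\<exists>K\<ge>0. \<forall>x::real^4. (\<integral>\<^sup>+y. near x y \<partial>lborel) \<le> ennreal K"
proof -
  obtain K where K: "K \<ge> 0" "\<And>x::real^4. (\<integral>\<^sup>+y. ennreal (1 / norm (x - y) powr 1) * near x y \<partial>lborel) \<le> ennreal K"
    using inverse_powr_ball_bound[of 1, where 'a = "real^4"] by auto
  have "(\<integral>\<^sup>+y. near x y \<partial>lborel)
    \<le> (\<integral>\<^sup>+y. ennreal (1 / norm (x - y) powr 1) * near x y \<partial>lborel)" for x :: "real^4"
    by (intro nn_integral_mono_AE eventually_mono[OF AE_lborel_singleton[of x]])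
      (auto simp: indicator_def ennreal_ge_1)
  then show ?thesis using K order_trans by blast
qed

text \<open>The pointwise bound is integrated over the ball. The potential term may even be
  integrated over the whole space: Tonelli puts the \<open>x\<close>-integral on the kernel, leaving
  \<open>M\<close> times a constant. Only the constant term uses that the ball has finite
  volume.\<close>

lemma exp_u_local:
  assumes p: "p > 0"
  shows "\<exists>K\<ge>0. \<forall>x. (\<integral>\<^sup>+y. ennreal (exp (p * u y)) * near x y \<partial>lborel) \<le> ennreal K"
proof -
  obtain A where A: "A \<ge> 0" "\<And>x. ennreal (exp (p * u x)) \<le>
    ennreal A * (1 + (\<integral>\<^sup>+y. ennreal (F y / norm (x - y)) * near x y \<partial>lborel))"
    using exp_u_pointwise[OF p] by auto
  obtain K1 where K1: "K1 \<ge> 0" "\<And>x::real^4. (\<integral>\<^sup>+y. ennreal (1 / norm (x - y) powr 1) * near x y \<partial>lborel) \<le> ennreal K1"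
    using inverse_powr_ball_bound[of 1, where 'a = "real^4"] by auto
  obtain V where V: "V \<ge> 0" "\<And>x::real^4. (\<integral>\<^sup>+y. near x y \<partial>lborel) \<le> ennreal V"
    using nn_unit_ball_bound by auto
  let ?N = "\<lambda>x. (\<integral>\<^sup>+y. ennreal (F y / norm (x - y)) * near x y \<partial>lborel)"
  have [measurable]: "?N \<in> borel_measurable borel" by measurable
  have N: "(\<integral>\<^sup>+x. ?N x \<partial>lborel) \<le> ennreal M * ennreal K1"
  proof -
    have "(\<integral>\<^sup>+x. ?N x \<partial>lborel) = (\<integral>\<^sup>+y. (\<integral>\<^sup>+x. ennreal (F y / norm (x - y)) * near x y \<partial>lborel) \<partial>lborel)"
      by (rule lborel_pair.Fubini') measurable
    also have "\<dots> = (\<integral>\<^sup>+y. (\<integral>\<^sup>+x. ennreal (F y) * (ennreal (1 / norm (y - x) powr 1) * near y x) \<partial>lborel) \<partial>lborel)"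
      using F_nonneg by (intro nn_integral_cong) (simp add: ennreal_mult[symmetric] mult.assoc[symmetric] norm_minus_commute)
    also have "\<dots> = (\<integral>\<^sup>+y. ennreal (F y) * (\<integral>\<^sup>+x. ennreal (1 / norm (y - x) powr 1) * near y x \<partial>lborel) \<partial>lborel)"
      by (intro nn_integral_cong nn_integral_cmult) measurable
    also have "\<dots> \<le> (\<integral>\<^sup>+y. ennreal (F y) * ennreal K1 \<partial>lborel)"
      by (intro nn_integral_mono mult_left_mono K1) auto
    also have "\<dots> = ennreal M * ennreal K1" by (simp add: nn_integral_multc nn_F)
    finally show ?thesis .
  qed
  have "(\<integral>\<^sup>+y. ennreal (exp (p * u y)) * near x y \<partial>lborel) \<le> ennreal (A * (V + M * K1))" for x
  proof -
    have "(\<integral>\<^sup>+y. ennreal (exp (p * u y)) * near x y \<partial>lborel)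
      \<le> (\<integral>\<^sup>+y. ennreal A * (near x y + ?N y) \<partial>lborel)"
    proof (rule nn_integral_mono)
      fix y
      show "ennreal (exp (p * u y)) * near x y \<le> ennreal A * (near x y + ?N y)"
        using A(2)[of y] by (auto simp: indicator_def)
    qed
    also have "\<dots> = ennreal A * ((\<integral>\<^sup>+y. near x y \<partial>lborel) + (\<integral>\<^sup>+y. ?N y \<partial>lborel))"
      by (subst nn_integral_cmult, measurable, subst nn_integral_add, measurable)
    also have "\<dots> \<le> ennreal A * (ennreal V + ennreal M * ennreal K1)"
      by (intro mult_left_mono add_mono V N) auto
    also have "\<dots> = ennreal (A * (V + M * K1))"
      using A V K1 M_nonneg by (simp add: ennreal_mult ennreal_plus)
    finally show ?thesis .
  qed
  moreover have "A * (V + M * K1) \<ge> 0" using A V K1 M_nonneg by simp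
  ultimately show ?thesis by blast
qed

text \<open>
  Young's inequality with the exponent \<open>8 / (4 - \<alpha>)\<close> near \<open>x\<close>, where it leaves a kernel of order
  \<open>8 \<alpha> / (4 + \<alpha>) < 4\<close>, and with the exponent \<open>8 / (8 - \<alpha>)\<close> of the mass condition far from \<open>x\<close>,
  where it leaves a kernel of order \<open>8 > 4\<close>.
\<close>

lemma choquard_bound:
  "\<exists>K\<ge>0. \<forall>x. (\<integral>\<^sup>+y. ennreal (exp (u y) / norm (x - y) powr \<alpha>) \<partial>lborel) \<le> ennreal K"
proof -
  let ?p = "8 / (4 - \<alpha>)" and ?q = "8 / (8 - \<alpha>)"
  have p1: "?p - 1 = (4 + \<alpha>) / (4 - \<alpha>)" using \<alpha> by (simp add: field_simps)
  have p: "?p > 1" using \<alpha> by simp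
  have p2: "\<alpha> * (?p / (?p - 1)) = 8 * \<alpha> / (4 + \<alpha>)" 
  proof -
    have eq: "8 / d / (e / d) = 8 / e" if "d \<noteq> 0" for d e :: real using that by simp
    show ?thesis unfolding p1 using \<alpha> by (subst eq) auto
  qed
  have p4: "0 \<le> 8 * \<alpha> / (4 + \<alpha>)" "8 * \<alpha> / (4 + \<alpha>) < 4" using \<alpha> by (auto simp: field_simps)
  have q: "?q > 1" "\<alpha> * (?q / (?q - 1)) = 8" using \<alpha> by (auto simp: field_simps)
  obtain K1 where K1: "K1 \<ge> 0" "\<And>x::real^4. (\<integral>\<^sup>+y. ennreal (1 / norm (x - y) powr (8 * \<alpha> / (4 + \<alpha>))) * near x y \<partial>lborel) \<le> ennreal K1"
    using inverse_powr_ball_bound[of "8 * \<alpha> / (4 + \<alpha>)", where 'a = "real^4"] p4 by auto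
  obtain K2 where K2: "K2 \<ge> 0" "\<And>x. (\<integral>\<^sup>+y. ennreal (exp (?p * u y)) * near x y \<partial>lborel) \<le> ennreal K2"
    using exp_u_local[OF less_trans[OF zero_less_one p]] by blast
  obtain K3 where K3: "K3 \<ge> 0" "\<And>x::real^4. (\<integral>\<^sup>+y. ennreal (1 / norm (x - y) powr 8) * indicator {1..} (norm (x - y)) \<partial>lborel) \<le> ennreal K3"
    using inverse_powr_tail_bound[of 8, where 'a = "real^4"] by auto
  define K4 where "K4 = (LBINT y. exp (?q * u y))"
  have K40: "K4 \<ge> 0" unfolding K4_def by (intro integral_nonneg_AE AE_I2) auto
  have K4: "(\<integral>\<^sup>+y. ennreal (exp (?q * u y)) \<partial>lborel) = ennreal K4"
    unfolding K4_def by (rule nn_integral_eq_integral[OF mass]) auto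
  have "(\<integral>\<^sup>+y. ennreal (exp (u y) / norm (x - y) powr \<alpha>) \<partial>lborel) \<le> ennreal (K1 + K2 + (K3 + K4))" for x
  proof -
    have "(\<integral>\<^sup>+y. ennreal (exp (u y) / norm (x - y) powr \<alpha>) \<partial>lborel) \<le>
      (\<integral>\<^sup>+y. (ennreal (1 / norm (x - y) powr (8 * \<alpha> / (4 + \<alpha>))) * near x y
         + ennreal (exp (?p * u y)) * near x y)
         + (ennreal (1 / norm (x - y) powr 8) * indicator {1..} (norm (x - y)) + ennreal (exp (?q * u y))) \<partial>lborel)"
    proof (rule nn_integral_mono)
      fix y
      have 1: "ennreal (exp (u y) / norm (x - y) powr \<alpha>) \<le> ennreal (1 / norm (x - y) powr (8 * \<alpha> / (4 + \<alpha>))) + ennreal (exp (?p * u y))"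
        using inverse_Young[OF p, of "norm (x - y)" "u y" \<alpha>] unfolding p2
        by (simp add: ennreal_plus[symmetric] ennreal_leI del: ennreal_plus)
      have 2: "ennreal (exp (u y) / norm (x - y) powr \<alpha>) \<le> ennreal (1 / norm (x - y) powr 8) + ennreal (exp (?q * u y))"
        using inverse_Young[OF q(1), of "norm (x - y)" "u y" \<alpha>] unfolding q(2)
        by (simp add: ennreal_plus[symmetric] ennreal_leI del: ennreal_plus)
      show "ennreal (exp (u y) / norm (x - y) powr \<alpha>) \<le> (ennreal (1 / norm (x - y) powr (8 * \<alpha> / (4 + \<alpha>))) * near x y
         + ennreal (exp (?p * u y)) * near x y)
         + (ennreal (1 / norm (x - y) powr 8) * indicator {1..} (norm (x - y)) + ennreal (exp (?q * u y)))"
      proof (cases "norm (x - y) < 1")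
        case True
        with 1 show ?thesis by (auto intro: add_increasing2)
      next
        case False
        with 2 show ?thesis by (auto intro: add_increasing)
      qed
    qed
    also have "\<dots> = ((\<integral>\<^sup>+y. ennreal (1 / norm (x - y) powr (8 * \<alpha> / (4 + \<alpha>))) * near x y \<partial>lborel)
        + (\<integral>\<^sup>+y. ennreal (exp (?p * u y)) * near x y \<partial>lborel))
        + ((\<integral>\<^sup>+y. ennreal (1 / norm (x - y) powr 8) * indicator {1..} (norm (x - y)) \<partial>lborel) + (\<integral>\<^sup>+y. ennreal (exp (?q * u y)) \<partial>lborel))"
      by (simp add: nn_integral_add)
    also have "\<dots> \<le> (ennreal K1 + ennreal K2) + (ennreal K3 + ennreal K4)"
      unfolding K4 by (intro add_mono K1 K2 K3 order_refl)
    also have "\<dots> = ennreal (K1 + K2 + (K3 + K4))"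
      using K1(1) K2(1) K3(1) K40 by (simp add: ennreal_plus[symmetric] del: ennreal_plus)
    finally show ?thesis .
  qed
  then show ?thesis using K1(1) K2(1) K3(1) K40 by (intro exI[of _ "K1 + K2 + (K3 + K4)"]) auto
qed

lemma choquard_integrable: "integrable lborel (\<lambda>y. exp (u y) / norm (x - y) powr \<alpha>)"
proof -
  obtain K where "\<And>x. (\<integral>\<^sup>+y. ennreal (exp (u y) / norm (x - y) powr \<alpha>) \<partial>lborel) \<le> ennreal K"
    using choquard_bound by blast
  then show ?thesis
    by (intro integrableI_nonneg) (auto intro: le_less_trans[OF _ ennreal_less_top])
qed

lemma nn_I: "(\<integral>\<^sup>+y. ennreal (exp (u y) / norm (x - y) powr \<alpha>) \<partial>lborel) = ennreal (I x)"
  unfolding I_eq by (rule nn_integral_eq_integral[OF choquard_integrable]) auto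

lemma I_bounded: "\<exists>K\<ge>0. \<forall>x. I x \<le> K"
  using choquard_bound unfolding nn_I by (auto simp: I_nonneg)

text \<open>The kernel \<open>- ln (norm (x - y))\<close> is positive only inside the unit ball,
  where it is at most \<open>1 / norm (x - y)\<close>. Splitting its product with \<open>F\<close>
  into squares leaves a kernel of order 2, integrable in dimension four, and the square of
  \<open>F\<close>, which the bound on \<open>I\<close> and the local bounds on
  \<open>exp (p * u)\<close> control.\<close>

lemma u_bounded_above: "\<exists>K. \<forall>x. u x \<le> K"
proof -
  \<comment> \<open>What matters is \<open>?p \<ge> 2\<close>, so that
    \<open>exp (2 * u y) \<le> 1 + exp (?p * u y)\<close>.\<close>
  let ?p = "8 / (4 - \<alpha>)"
  have p: "?p \<ge> 2" using \<alpha> by (simp add: field_simps)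
  then have p0: "?p > 0" by linarith
  obtain KI where KI: "KI \<ge> 0" "\<And>x. I x \<le> KI" using I_bounded by auto
  obtain K1 where K1: "K1 \<ge> 0" "\<And>x::real^4. (\<integral>\<^sup>+y. ennreal (1 / norm (x - y) powr 2) * near x y \<partial>lborel) \<le> ennreal K1"
    using inverse_powr_ball_bound[of 2, where 'a = "real^4"] by auto
  obtain K2 where K2: "K2 \<ge> 0" "\<And>x. (\<integral>\<^sup>+y. ennreal (exp (?p * u y)) * near x y \<partial>lborel) \<le> ennreal K2"
    using exp_u_local[OF p0] by blast
  obtain V where V: "V \<ge> 0" "\<And>x::real^4. (\<integral>\<^sup>+y. near x y \<partial>lborel) \<le> ennreal V"
    using nn_unit_ball_bound by auto
  have F2: "(F y)\<^sup>2 \<le> KI\<^sup>2 * (1 + exp (?p * u y))" for y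
  proof -
    have "(F y)\<^sup>2 = (I y)\<^sup>2 * exp (2 * u y)" by (simp add: F_eq power_mult_distrib exp_double)
    also have "\<dots> \<le> KI\<^sup>2 * (1 + exp (?p * u y))"
    proof (intro mult_mono power_mono KI)
      show "exp (2 * u y) \<le> 1 + exp (?p * u y)"
      proof (cases "u y \<ge> 0")
        case True
        then have "2 * u y \<le> ?p * u y" by (rule mult_right_mono[OF p])
        then have "exp (2 * u y) \<le> exp (?p * u y)" by (simp only: exp_le_cancel_iff)
        then show ?thesis by (rule order_trans) simp
      next
        case False
        then have "exp (2 * u y) \<le> 1" by simp
        then show ?thesis by (meson add_increasing2 exp_ge_zero)
      qed
    qed (auto simp: I_nonneg)
    finally show ?thesis .
  qed
  have "u x \<le> c0 * (K1 + KI\<^sup>2 * (V + K2)) + C0" for x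
  proof -
    define h where "h y = - ln (norm (x - y)) * F y * near x y" for y
    have [measurable]: "h \<in> borel_measurable borel" unfolding h_def by measurable
    have h0: "0 \<le> h y" for y
      using F_nonneg[of y] by (cases "x = y") (auto simp: h_def indicator_def mult_le_0_iff)
    have ih: "integrable lborel h"
      unfolding h_def by (rule integrable_dominated[OF F_log[of x]]) (auto simp: indicator_def)
    have "(LBINT y. - ln (norm (x - y)) * F y) \<le> (LBINT y. h y)"
    proof (rule integral_mono[OF _ ih])
      show "integrable lborel (\<lambda>y. - ln (norm (x - y)) * F y)" using F_log[of x] by simp
      show "- ln (norm (x - y)) * F y \<le> h y" for y
        using F_nonneg[of y] by (auto simp: h_def indicator_def not_less)
    qed
    also have "ennreal (LBINT y. h y) \<le> ennreal (K1 + KI\<^sup>2 * (V + K2))"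
    proof -
      have "ennreal (LBINT y. h y) = (\<integral>\<^sup>+y. ennreal (h y) \<partial>lborel)"
        by (rule nn_integral_eq_integral[symmetric, OF ih]) (simp add: h0)
      also have "\<dots> \<le> (\<integral>\<^sup>+y. ennreal (1 / norm (x - y) powr 2) * near x y
         + ennreal (KI\<^sup>2) * (near x y + ennreal (exp (?p * u y)) * near x y) \<partial>lborel)"
      proof (rule nn_integral_mono_AE, use AE_lborel_singleton[of x] in eventually_elim)
        case (elim y)
        then have n: "norm (x - y) > 0" by simp
        show ?case
        proof (cases "norm (x - y) < 1")
          case True
          have "- ln (norm (x - y)) = ln (1 / norm (x - y))" using n by (simp add: ln_div)
          also have "\<dots> \<le> 1 / norm (x - y)" using n ln_le_minus_one[of "1 / norm (x - y)"] by simp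
          finally have "- ln (norm (x - y)) * F y \<le> 1 / norm (x - y) * F y"
            using F_nonneg by (intro mult_right_mono)
          also have "\<dots> \<le> (1 / norm (x - y))\<^sup>2 + (F y)\<^sup>2"
          proof -
            have "0 \<le> 1 / norm (x - y) * F y" using F_nonneg[of y] by simp
            then show ?thesis
              using sum_squares_bound[of "1 / norm (x - y)" "F y"] by linarith
          qed
          also have "\<dots> \<le> 1 / norm (x - y) powr 2 + KI\<^sup>2 * (1 + exp (?p * u y))"
            using F2[of y] n by (intro add_mono) (auto simp: power_divide)
          finally have "ennreal (h y) \<le> ennreal (1 / norm (x - y) powr 2 + KI\<^sup>2 * (1 + exp (?p * u y)))"
            using True by (intro ennreal_leI) (simp add: h_def)
          also have "\<dots> = ennreal (1 / norm (x - y) powr 2) + ennreal (KI\<^sup>2) * (1 + ennreal (exp (?p * u y)))"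
            by (simp add: ennreal_plus ennreal_mult)
          finally show ?thesis using True by simp
        qed (simp add: h_def)
      qed
      also have "\<dots> = (\<integral>\<^sup>+y. ennreal (1 / norm (x - y) powr 2) * near x y \<partial>lborel)
        + ennreal (KI\<^sup>2) * ((\<integral>\<^sup>+y. near x y \<partial>lborel)
          + (\<integral>\<^sup>+y. ennreal (exp (?p * u y)) * near x y \<partial>lborel))"
        by (subst nn_integral_add, measurable, subst nn_integral_cmult, measurable, subst nn_integral_add, measurable)
      also have "\<dots> \<le> ennreal K1 + ennreal (KI\<^sup>2) * (ennreal V + ennreal K2)"
        by (intro add_mono mult_left_mono K1 V K2) auto
      also have "\<dots> = ennreal (K1 + KI\<^sup>2 * (V + K2))"
        using K1(1) V(1) K2(1) by (simp add: ennreal_plus ennreal_mult)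
      finally show ?thesis .
    qed
    then have "(LBINT y. h y) \<le> K1 + KI\<^sup>2 * (V + K2)"
      using K1(1) V(1) K2(1) by (subst (asm) ennreal_le_iff) auto
    finally have "(LBINT y. - ln (norm (x - y)) * F y) \<le> K1 + KI\<^sup>2 * (V + K2)" .
    then have "c0 * (LBINT y. - ln (norm (x - y)) * F y) \<le> c0 * (K1 + KI\<^sup>2 * (V + K2))"
      using c0_pos by (intro mult_left_mono) auto
    then show ?thesis unfolding u_eq'[of x] by linarith
  qed
  then show ?thesis by blast
qed

lemma F_bounded: "\<exists>K\<ge>0. \<forall>x. F x \<le> K"
proof -
  obtain K where K: "\<And>x. u x \<le> K" using u_bounded_above by blast
  obtain L where L: "0 \<le> L" "\<And>x. I x \<le> L" using I_bounded by blast
  have "F x \<le> L * exp K" for x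
    unfolding F_eq using K L by (intro mult_mono) (auto simp: I_nonneg)
  then show ?thesis using L by (intro exI[of _ "L * exp K"]) auto
qed

end

section \<open>Regularity\<close>

lemma cdiff_le: "j \<le> k \<Longrightarrow> cdiff P k f \<Longrightarrow> cdiff P j f"
  by (induction k) (auto simp: le_Suc_eq simp del: cdiff.simps dest: cdiff_Suc_imp)

lemma cdiff_cmult:
  fixes f :: "'a::euclidean_space \<Rightarrow> real"
  assumes "\<And>f. P f \<Longrightarrow> P (\<lambda>x. c * f x)"
  shows "cdiff P k f \<Longrightarrow> cdiff P k (\<lambda>x. c * f x)"
proof (induction k arbitrary: f)
  case 0
  then show ?case using assms by (auto intro: continuous_intros)
next
  case (Suc k)
  then have "partial_deriv b (\<lambda>x. c * f x) = (\<lambda>x. c * partial_deriv b f x)" for b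
    using partial_deriv_mult[of "\<lambda>_. c" _ f b] by (auto simp: partial_deriv_eqI[OF has_derivative_const])
  with Suc assms show ?case by auto
qed

context choquard
begin

text \<open>Near \<open>x\<close> the density is bounded and the kernel integrable; far from
  \<open>x\<close> the kernel is at most 1 and the density has mass \<open>M\<close>. Neither bound
  depends on \<open>x\<close>.\<close>

lemma F_singular_bound:
  assumes "0 \<le> s" "s < 4"
  shows "\<exists>K\<ge>0. \<forall>x. (\<integral>\<^sup>+y. ennreal (F y / norm (x - y) powr s) \<partial>lborel) \<le> ennreal K"
proof -
  obtain KF where KF: "KF \<ge> 0" "\<And>x. F x \<le> KF" using F_bounded by auto
  obtain K1 where K1: "K1 \<ge> 0" "\<And>x::real^4. (\<integral>\<^sup>+y. ennreal (1 / norm (x - y) powr s) * near x y \<partial>lborel) \<le> ennreal K1"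
    using inverse_powr_ball_bound[of s, where 'a = "real^4"] assms by auto
  have "(\<integral>\<^sup>+y. ennreal (F y / norm (x - y) powr s) \<partial>lborel) \<le> ennreal (KF * K1 + M)" for x
  proof -
    have "(\<integral>\<^sup>+y. ennreal (F y / norm (x - y) powr s) \<partial>lborel) \<le>
      (\<integral>\<^sup>+y. ennreal KF * (ennreal (1 / norm (x - y) powr s) * near x y) + ennreal (F y) \<partial>lborel)"
    proof (rule nn_integral_mono)
      fix y
      show "ennreal (F y / norm (x - y) powr s) \<le> ennreal KF * (ennreal (1 / norm (x - y) powr s) * near x y) + ennreal (F y)"
      proof (cases "norm (x - y) < 1")
        case True
        have "F y / norm (x - y) powr s \<le> KF / norm (x - y) powr s"
          using KF by (intro divide_right_mono) auto
        then have "ennreal (F y / norm (x - y) powr s) \<le> ennreal KF * ennreal (1 / norm (x - y) powr s)"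
          using KF by (simp add: ennreal_mult[symmetric] ennreal_leI)
        then show ?thesis using True by (simp add: add_increasing2)
      next
        case False
        then have "1 \<le> norm (x - y) powr s" using assms by (intro ge_one_powr_ge_zero) auto
        then have "F y / norm (x - y) powr s \<le> F y / 1" using F_nonneg[of y] by (intro divide_left_mono) auto
        then show ?thesis using False by (auto intro: ennreal_leI)
      qed
    qed
    also have "\<dots> = ennreal KF * (\<integral>\<^sup>+y. ennreal (1 / norm (x - y) powr s) * near x y \<partial>lborel) + ennreal M"
      by (subst nn_integral_add, measurable, subst nn_integral_cmult, measurable) (simp add: nn_F)
    also have "\<dots> \<le> ennreal KF * ennreal K1 + ennreal M"
      by (intro add_mono mult_left_mono K1) auto
    also have "\<dots> = ennreal (KF * K1 + M)" using KF(1) K1(1) M_nonneg by (simp add: ennreal_mult ennreal_plus)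
    finally show ?thesis .
  qed
  moreover have "KF * K1 + M \<ge> 0" using KF(1) K1(1) M_nonneg by simp
  ultimately show ?thesis by blast
qed

lemma F_singular_integrable:
  assumes "0 \<le> s" "s < 4"
  shows "integrable lborel (\<lambda>y. F y / norm (x - y) powr s)"
proof -
  obtain K where "\<And>x. (\<integral>\<^sup>+y. ennreal (F y / norm (x - y) powr s) \<partial>lborel) \<le> ennreal K"
    using F_singular_bound[OF assms] by blast
  then show ?thesis
    by (intro integrableI_nonneg) (auto simp: F_nonneg intro: le_less_trans[OF _ ennreal_less_top])
qed

lemma F_singular_integral_bound:
  assumes "0 \<le> s" "s < 4"
  shows "\<exists>K. \<forall>x. (LBINT y. F y / norm (x - y) powr s) \<le> K"
proof -
  obtain K where K: "K \<ge> 0" "\<And>x. (\<integral>\<^sup>+y. ennreal (F y / norm (x - y) powr s) \<partial>lborel) \<le> ennreal K"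
    using F_singular_bound[OF assms] by blast
  have "ennreal (LBINT y. F y / norm (x - y) powr s) \<le> ennreal K" for x
    using K(2)[of x] by (subst nn_integral_eq_integral[symmetric])
      (auto intro: F_singular_integrable assms simp: F_nonneg)
  then show ?thesis using K(1) by (auto simp: ennreal_le_iff)
qed

section \<open>The gradient of the solution as a convolution with the density\<close>

lemma F_div_norm: "integrable lborel (\<lambda>y. F y / norm (x - y))"
  using F_singular_integrable[of 1 x] by simp

lemma F_div_norm2: "integrable lborel (\<lambda>y. F y / (norm (x - y))\<^sup>2)"
  using F_singular_integrable[of 2 x] by simp

lemma u_has_derivative:
  "(u has_derivative (\<lambda>h. - c0 * (LBINT y. ((x - y) \<bullet> h) / (norm (x - y))\<^sup>2 * F y))) (at x)"
proof -
  obtain K where K: "\<And>x. (LBINT y. F y / norm (x - y) powr 2) \<le> K"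
    using F_singular_integral_bound[of 2] by auto
  have "((\<lambda>x. LBINT y. ln (norm (x - y)) * F y) has_derivative
           (\<lambda>h. LBINT y. ((x - y) \<bullet> h) / (norm (x - y))\<^sup>2 * F y)) (at x)"
  proof (rule has_derivative_log_potential[where K = K])
    show "(LBINT y. \<bar>F y\<bar> / (norm (x - y))\<^sup>2) \<le> K" for x
      using K[of x] by (simp add: F_nonneg)
  qed (auto intro: F_log F_div_norm F_div_norm2)
  moreover have "u = (\<lambda>x. - c0 * (LBINT y. ln (norm (x - y)) * F y) + C0)"
    by (rule ext) (simp add: u_eq[of _] c0_def)
  ultimately show ?thesis
    by (auto intro!: derivative_eq_intros)
qed

text \<open>The derivative of \<open>ln (norm z)\<close> in the direction \<open>b\<close>, with
  value 0 at \<open>z = 0\<close> by division by zero.\<close>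

definition R :: "real^4 \<Rightarrow> real^4 \<Rightarrow> real" where
  "R b z = (z \<bullet> b) / (norm z)\<^sup>2"

lemma R_meas [measurable]: "R b \<in> borel_measurable borel"
  unfolding R_def by measurable

lemma R_bound: "\<bar>R b z\<bar> \<le> norm b / norm z"
proof -
  have "\<bar>z \<bullet> b\<bar> / (norm z)\<^sup>2 \<le> (norm z * norm b) / (norm z)\<^sup>2"
    by (intro divide_right_mono Cauchy_Schwarz_ineq2) auto
  then show ?thesis by (simp add: R_def power2_eq_square split: if_splits)
qed

lemma u_differentiable: "u differentiable (at x)"
  using u_has_derivative by (auto simp: differentiable_def)

lemma partial_deriv_u: "partial_deriv b u x = - c0 * (LBINT z. R b z * F (x - z))"
proof -
  have "(LBINT y. (\<lambda>z. R b z * F (x - z)) (x - y)) = (LBINT z. R b z * F (x - z))"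
    by (rule integral_lborel_diff) measurable
  then show ?thesis
    using partial_deriv_eqI[OF u_has_derivative, of b x] by (simp add: R_def)
qed

lemma F_conv_div_norm: "integrable lborel (\<lambda>z. F (x - z) / norm z)"
  using F_div_norm[of x] integrable_lborel_diff_iff[of "\<lambda>z. F (x - z) / norm z" x] by simp

lemma F_conv_R: "integrable lborel (\<lambda>z. \<bar>R b z\<bar> * F (x - z))"
proof (rule integrable_dominated)
  show "integrable lborel (\<lambda>z. norm b * (F (x - z) / norm z))"
    by (rule integrable_mult_right[OF F_conv_div_norm])
  show "AE z in lborel. norm (\<bar>R b z\<bar> * F (x - z)) \<le> norm (norm b * (F (x - z) / norm z))"
  proof (rule AE_I2)
    fix z
    show "norm (\<bar>R b z\<bar> * F (x - z)) \<le> norm (norm b * (F (x - z) / norm z))"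
      using mult_right_mono[OF R_bound[of b z], of "F (x - z)"] F_nonneg[of "x - z"] by simp
  qed
qed measurable

text \<open>Convolution with \<open>R b\<close> turns the weight \<open>F\<close> into a new weight;
  its boundedness allows the constant weight 1 for all derivatives of the gradient of
  \<open>u\<close>.\<close>

lemma R_F_dominated: "dominated (\<lambda>_. 1) (\<lambda>x. LBINT z. \<bar>R b z\<bar> * F (x - z))"
proof -
  obtain K where K: "\<And>x. (LBINT y. F y / norm (x - y) powr 1) \<le> K"
    using F_singular_integral_bound[of 1] by auto
  have "\<bar>LBINT z. \<bar>R b z\<bar> * F (x - z)\<bar> \<le> norm b * K" for x
  proof -
    have "\<bar>LBINT z. \<bar>R b z\<bar> * F (x - z)\<bar> = (LBINT z. \<bar>R b z\<bar> * F (x - z))"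
      using F_nonneg by (intro abs_of_nonneg integral_nonneg_AE) simp
    also have "\<dots> \<le> (LBINT z. norm b * (F (x - z) / norm z))"
    proof (rule integral_mono[OF F_conv_R])
      show "integrable lborel (\<lambda>z. norm b * (F (x - z) / norm z))"
        by (rule integrable_mult_right[OF F_conv_div_norm])
      show "\<bar>R b z\<bar> * F (x - z) \<le> norm b * (F (x - z) / norm z)" for z
        using mult_right_mono[OF R_bound[of b z], of "F (x - z)"] F_nonneg[of "x - z"] by simp
    qed
    also have "\<dots> = norm b * (LBINT z. F (x - z) / norm z)" by (rule integral_mult_right_zero)
    also have "(LBINT z. F (x - z) / norm z) = (LBINT y. F y / norm (x - y))"
      using integral_lborel_diff[of "\<lambda>z. F (x - z) / norm z" x] by simp
    also have "norm b * \<dots> \<le> norm b * K" using K[of x] by (intro mult_left_mono) auto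
    finally show ?thesis .
  qed
  then show ?thesis by (auto simp: dominated_def)
qed

lemma partial_deriv_u_bounded: "\<exists>L\<ge>0. \<forall>x. \<forall>b\<in>Basis. \<bar>partial_deriv b u x\<bar> \<le> L"
proof -
  have "\<exists>K\<ge>0. \<forall>x. \<bar>LBINT z. \<bar>R b z\<bar> * F (x - z)\<bar> \<le> K" for b
    using dominatedD[OF R_F_dominated] by simp
  then obtain K where K: "\<And>b. K b \<ge> 0" "\<And>b x. \<bar>LBINT z. \<bar>R b z\<bar> * F (x - z)\<bar> \<le> K b"
    by metis
  define L where "L = c0 * (\<Sum>b\<in>Basis. K b)"
  have "\<bar>partial_deriv b u x\<bar> \<le> L" if b: "b \<in> Basis" for b x
  proof -
    have "\<bar>LBINT z. R b z * F (x - z)\<bar> \<le> (LBINT z. \<bar>R b z * F (x - z)\<bar>)"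
      by (rule integral_abs_bound)
    also have "\<dots> = (LBINT z. \<bar>R b z\<bar> * F (x - z))" by (simp add: abs_mult F_nonneg)
    also have "\<dots> \<le> K b" using K(2)[of b x] by linarith
    also have "K b \<le> (\<Sum>b\<in>Basis. K b)" using K(1) b by (intro member_le_sum) auto
    finally show ?thesis unfolding partial_deriv_u L_def using c0_pos by (simp add: abs_mult)
  qed
  moreover have "L \<ge> 0" unfolding L_def using K(1) c0_pos by (simp add: sum_nonneg)
  ultimately show ?thesis by blast
qed

lemma u_lipschitz: "\<exists>L\<ge>0. \<forall>x h. \<bar>u (x + h) - u x\<bar> \<le> L * norm h"
proof -
  obtain L where L: "L \<ge> 0" "\<And>x b. b \<in> Basis \<Longrightarrow> \<bar>partial_deriv b u x\<bar> \<le> L"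
    using partial_deriv_u_bounded by blast
  have "\<bar>u (x + h) - u x\<bar> \<le> real DIM(real^4) * L * norm h" for x h
    by (rule lipschitz_partial_deriv[OF u_differentiable L(2)])
  then show ?thesis using L by (intro exI[of _ "real DIM(real^4) * L"]) auto
qed

text \<open>A Lipschitz exponent changes by at most \<open>L\<close> over distance 1. The property
  passes to \<open>I\<close> under the convolution and to \<open>F\<close> as a product; it is the
  slow variation that \<open>cdiff_convolution\<close> demands of a weight.\<close>

lemma exp_u_harnack: "\<exists>H\<ge>0. \<forall>x h. norm h \<le> 1 \<longrightarrow> exp (u (x + h)) \<le> H * exp (u x)"
proof -
  obtain L where L: "L \<ge> 0" "\<And>x h. \<bar>u (x + h) - u x\<bar> \<le> L * norm h" using u_lipschitz by blast
  have "exp (u (x + h)) \<le> exp L * exp (u x)" if "norm h \<le> 1" for x h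
  proof -
    have "L * norm h \<le> L" using that L by (simp add: mult_left_le)
    then have "u (x + h) \<le> L + u x" using L(2)[of x h] by linarith
    then show ?thesis by (simp add: exp_add[symmetric])
  qed
  then show ?thesis by (intro exI[of _ "exp L"]) auto
qed

lemma I_conv_integrable: "integrable lborel (\<lambda>z. \<bar>1 / norm z powr \<alpha>\<bar> * exp (u (x - z)))"
  using choquard_integrable[of x] integrable_lborel_diff_iff[of "\<lambda>z. \<bar>1 / norm z powr \<alpha>\<bar> * exp (u (x - z))" x]
  by simp

lemma I_conv: "I x = (LBINT z. 1 / norm z powr \<alpha> * exp (u (x - z)))"
  using integral_lborel_diff[of "\<lambda>z. 1 / norm z powr \<alpha> * exp (u (x - z))" x] by (simp add: I_eq)

lemma I_harnack: "\<exists>H\<ge>0. \<forall>x h. norm h \<le> 1 \<longrightarrow> I (x + h) \<le> H * I x"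
proof -
  obtain H where H: "H \<ge> 0" "\<And>x h. norm h \<le> 1 \<Longrightarrow> exp (u (x + h)) \<le> H * exp (u x)"
    using exp_u_harnack by blast
  have "I (x + h) \<le> H * I x" if h: "norm h \<le> 1" for x h
  proof -
    have i: "integrable lborel (\<lambda>z. 1 / norm z powr \<alpha> * exp (u (x - z)))" for x
      using I_conv_integrable[of x] by simp
    have "I (x + h) \<le> (LBINT z. H * (1 / norm z powr \<alpha> * exp (u (x - z))))"
      unfolding I_conv[of "x + h"]
    proof (rule integral_mono[OF i integrable_mult_right[OF i]])
      fix z
      have "exp (u (x + h - z)) \<le> H * exp (u (x - z))" using H(2)[OF h, of "x - z"] by (simp add: algebra_simps)
      then have "1 / norm z powr \<alpha> * exp (u (x + h - z)) \<le> 1 / norm z powr \<alpha> * (H * exp (u (x - z)))"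
        by (intro mult_left_mono) auto
      then show "1 / norm z powr \<alpha> * exp (u (x + h - z)) \<le> H * (1 / norm z powr \<alpha> * exp (u (x - z)))"
        by (simp add: mult_ac)
    qed
    also have "\<dots> = H * I x" unfolding I_conv[of x] by (rule integral_mult_right_zero)
    finally show ?thesis .
  qed
  with H(1) show ?thesis by blast
qed

lemma F_harnack: "\<exists>H\<ge>0. \<forall>x h. norm h \<le> 1 \<longrightarrow> F (x + h) \<le> H * F x"
proof -
  obtain H where H: "H \<ge> 0" "\<And>x h. norm h \<le> 1 \<Longrightarrow> exp (u (x + h)) \<le> H * exp (u x)"
    using exp_u_harnack by blast
  obtain G where G: "G \<ge> 0" "\<And>x h. norm h \<le> 1 \<Longrightarrow> I (x + h) \<le> G * I x"
    using I_harnack by blast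
  have "F (x + h) \<le> (G * H) * F x" if "norm h \<le> 1" for x h
    using mult_mono[OF G(2)[OF that, of x] H(2)[OF that, of x]] G(1) I_nonneg[of x]
    by (simp add: F_eq mult_ac)
  then show ?thesis using H G by (intro exI[of _ "G * H"]) auto
qed

text \<open>Each derivative of \<open>exp u\<close> is \<open>exp u\<close> times a polynomial in
  derivatives of \<open>u\<close>. If those are bounded up to order \<open>k\<close> for the
  gradient, the weight stays \<open>exp u\<close> and one more order is reached.\<close>

lemma exp_u_cdiff:
  assumes "\<And>b. b \<in> Basis \<Longrightarrow> cdiff (dominated (\<lambda>_. 1)) k (partial_deriv b u)"
  shows "j \<le> Suc k \<Longrightarrow> cdiff (dominated (\<lambda>x. exp (u x))) j (\<lambda>x. exp (u x))"
proof (induction j)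
  have dom: "dominated (\<lambda>x. exp (u x)) (\<lambda>x. exp (u x))"
    unfolding dominated_def by (intro exI[of _ 1]) simp
  {
    case 0
    have "continuous_on UNIV u"
      by (intro continuous_at_imp_continuous_on ballI differentiable_imp_continuous_within u_differentiable)
    then show ?case using dom by (auto intro: continuous_intros)
  next
    case (Suc j)
    have "partial_deriv b (\<lambda>x. exp (u x)) = (\<lambda>x. exp (u x) * partial_deriv b u x)" for b
      by (rule ext, rule partial_deriv_chain(1)[OF u_differentiable]) (auto intro!: derivative_eq_intros)
    moreover have "(\<lambda>x. exp (u x)) differentiable (at x)" for x
      by (rule partial_deriv_chain(2)[OF u_differentiable DERIV_exp])
    moreover have "cdiff (dominated (\<lambda>x. exp (u x))) j (\<lambda>x. exp (u x) * partial_deriv b u x)" if "b \<in> Basis" for b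
    proof (rule cdiff_mult[where P = "dominated (\<lambda>x. exp (u x))" and Q = "dominated (\<lambda>_. 1)"])
      show "dominated (\<lambda>x. exp (u x)) (\<lambda>x. f x * g x)" if "dominated (\<lambda>x. exp (u x)) f" "dominated (\<lambda>_. 1) g" for f g
        using dominated_mult[OF that] by simp
      show "cdiff (dominated (\<lambda>x. exp (u x))) j (\<lambda>x. exp (u x))" using Suc by simp
      show "cdiff (dominated (\<lambda>_. 1)) j (partial_deriv b u)"
        using assms[OF \<open>b \<in> Basis\<close>] Suc.prems by (intro cdiff_le[of j k]) auto
    qed (rule dominated_add)
    ultimately show ?case using dom by simp
  }
qed

text \<open>For the weight \<open>exp u\<close> the convolved weight is \<open>I\<close> itself, so
  the derivatives of \<open>I\<close> are dominated by \<open>I\<close>, and those of the product by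
  \<open>I * exp u = F\<close>.\<close>

lemma F_cdiff:
  assumes "cdiff (dominated (\<lambda>x. exp (u x))) j (\<lambda>x. exp (u x))"
  shows "cdiff (dominated I) j I" and "cdiff (dominated F) j F"
proof -
  obtain H where H: "H \<ge> 0" "\<And>x h. norm h \<le> 1 \<Longrightarrow> exp (u (x + h)) \<le> H * exp (u x)"
    using exp_u_harnack by blast
  have "cdiff (dominated (\<lambda>x. LBINT z. \<bar>1 / norm z powr \<alpha>\<bar> * exp (u (x - z)))) j
      (\<lambda>x. LBINT z. 1 / norm z powr \<alpha> * exp (u (x - z)))"
    by (rule cdiff_convolution[OF _ _ _ H(2) I_conv_integrable assms]) auto
  moreover have "(\<lambda>x. LBINT z. \<bar>1 / norm z powr \<alpha>\<bar> * exp (u (x - z))) = I"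
    "(\<lambda>x. LBINT z. 1 / norm z powr \<alpha> * exp (u (x - z))) = I"
    by (rule ext, simp add: I_conv)+
  ultimately show I: "cdiff (dominated I) j I" by simp
  have "cdiff (dominated F) j (\<lambda>x. I x * exp (u x))"
  proof (rule cdiff_mult[where P = "dominated I" and Q = "dominated (\<lambda>x. exp (u x))"])
    show "dominated F (\<lambda>x. f x * g x)" if "dominated I f" "dominated (\<lambda>x. exp (u x)) g" for f g
      using dominated_mult[OF that] I_nonneg by (simp add: F_eq)
  qed (rule dominated_add I assms; assumption?)+
  then show "cdiff (dominated F) j F" by (simp add: F_eq)
qed

lemma partial_deriv_u_cdiff:
  assumes "cdiff (dominated F) k F"
  shows "cdiff (dominated (\<lambda>_. 1)) k (partial_deriv b u)"
proof -
  obtain H where H: "H \<ge> 0" "\<And>x h. norm h \<le> 1 \<Longrightarrow> F (x + h) \<le> H * F x"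
    using F_harnack by blast
  have "cdiff (dominated (\<lambda>x. LBINT z. \<bar>R b z\<bar> * F (x - z))) k (\<lambda>x. LBINT z. R b z * F (x - z))"
    by (rule cdiff_convolution[OF _ _ F_nonneg H(2) F_conv_R assms]) auto
  then have "cdiff (dominated (\<lambda>_. 1)) k (\<lambda>x. LBINT z. R b z * F (x - z))"
  proof (rule cdiff_mono)
    fix g assume "dominated (\<lambda>x. LBINT z. \<bar>R b z\<bar> * F (x - z)) g"
    then show "dominated (\<lambda>_. 1) g"
      by (rule dominated_trans[OF _ R_F_dominated]) (auto intro!: integral_nonneg_AE simp: F_nonneg)
  qed
  then have "cdiff (dominated (\<lambda>_. 1)) k (\<lambda>x. - c0 * (LBINT z. R b z * F (x - z)))"
    by (intro cdiff_cmult dominated_cmult)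
  then show ?thesis by (simp add: partial_deriv_u[abs_def])
qed

text \<open>One round of the bootstrap: control of \<open>F\<close> to order \<open>k\<close>
  controls the gradient of \<open>u\<close> to order \<open>k\<close>, hence \<open>exp u\<close>
  and then \<open>F\<close> to order \<open>k + 1\<close>. The weights remain the same in every
  round.\<close>

lemma all_cdiff:
  "cdiff (dominated (\<lambda>x. exp (u x))) k (\<lambda>x. exp (u x)) \<and> cdiff (dominated F) k F"
proof (induction k)
  case 0
  have "continuous_on UNIV u"
    by (intro continuous_at_imp_continuous_on ballI differentiable_imp_continuous_within u_differentiable)
  then have "cdiff (dominated (\<lambda>x. exp (u x))) 0 (\<lambda>x. exp (u x))"
    by (auto simp: dominated_def intro: continuous_intros exI[of _ 1])
  then show ?case using F_cdiff by blast
next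
  case (Suc k)
  then have "cdiff (dominated (\<lambda>x. exp (u x))) (Suc k) (\<lambda>x. exp (u x))"
    using partial_deriv_u_cdiff by (intro exp_u_cdiff[of k]) auto
  then show ?case using F_cdiff by blast
qed

lemma u_C_diff: "C_diff k u"
proof (cases k)
  case 0
  then show ?thesis
    by (auto intro!: continuous_at_imp_continuous_on differentiable_imp_continuous_within u_differentiable)
next
  case (Suc j)
  have "C_diff j (partial_deriv b u)" for b
    using partial_deriv_u_cdiff[of j b] all_cdiff[of j] by (auto intro: cdiff_imp_C_diff)
  then show ?thesis using Suc u_differentiable by simp
qed

lemma u_continuous: "continuous_on UNIV u"
  using u_C_diff[of 0] by simp

lemma F_continuous: "continuous_on UNIV F"
  using all_cdiff[of 0] by simp

lemma bilaplacian_u: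
  assumes "\<And>\<phi>. test_function \<phi> \<Longrightarrow> (LBINT x. u x * bilaplacian \<phi> x) = (LBINT x. F x * \<phi> x)"
  shows "bilaplacian u x = F x"
  by (rule bilaplacian_eqI[OF u_C_diff F_continuous assms])

end

section \<open>The Pohozaev identity\<close>

lemma norm_le_normI: "\<bar>a\<bar> \<le> c \<Longrightarrow> norm a \<le> norm (c::real)"
  by simp

lemma AE_lborel_off_diagonal:
  "AE p in (lborel :: 'a::euclidean_space measure) \<Otimes>\<^sub>M lborel. fst p \<noteq> snd p"
proof (rule lborel_pair.AE_pair_measure)
  show "{x \<in> space lborel2. fst x \<noteq> (snd x :: 'a)} \<in> sets lborel2"
    by measurable
  show "AE x in lborel. AE y in lborel. fst (x, y) \<noteq> (snd (x, y) :: 'a)"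
  proof (rule AE_I2)
    fix x :: 'a
    show "AE y in lborel. fst (x, y) \<noteq> snd (x, y)"
      using AE_lborel_singleton[of x] by eventually_elim auto
  qed
qed

text \<open>
  The field \<open>x / (1 + \<delta> \<bar>x\<bar>\<^sup>2)\<close> replaces the dilation field \<open>x\<close>: it is bounded, its Lipschitz
  constant does not depend on \<open>\<delta>\<close>, and it tends to \<open>x\<close> as \<open>\<delta> \<rightarrow> 0\<close>.
\<close>

definition theta :: "real \<Rightarrow> 'a::euclidean_space \<Rightarrow> real" where
  "theta \<delta> x = 1 / (1 + \<delta> * (norm x)\<^sup>2)"

text \<open>For the truncated field X this is \<open>(X x - X y) \<bullet> (x - y)\<close>, which
  appears when an expression with the gradient of a radial kernel is symmetrised. For the full
  dilation field it is \<open>(norm (x - y))\<^sup>2\<close>.\<close>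

definition dil :: "real \<Rightarrow> 'a::euclidean_space \<Rightarrow> 'a \<Rightarrow> real" where
  "dil \<delta> x y = (theta \<delta> x *\<^sub>R x - theta \<delta> y *\<^sub>R y) \<bullet> (x - y)"

text \<open>The divergence of \<open>theta \<delta> x *\<^sub>R x\<close>; the second term comes
  from the gradient of \<open>theta \<delta>\<close>.\<close>

definition divX :: "real \<Rightarrow> 'a::euclidean_space \<Rightarrow> real" where
  "divX \<delta> x = real DIM('a) * theta \<delta> x - 2 * \<delta> * (norm x)\<^sup>2 * (theta \<delta> x)\<^sup>2"

lemma theta_meas [measurable]: "theta \<delta> \<in> borel_measurable borel"
  unfolding theta_def[abs_def] by measurable

lemma dil_meas [measurable]:
  "(\<lambda>(x, y). dil \<delta> x y) \<in> borel_measurable (borel \<Otimes>\<^sub>M borel)"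
  unfolding dil_def by measurable

lemma divX_meas [measurable]: "divX \<delta> \<in> borel_measurable borel"
  unfolding divX_def[abs_def] by measurable

lemma theta_bounds:
  fixes x :: "'a::euclidean_space"
  assumes "0 \<le> \<delta>"
  shows "0 < theta \<delta> x" "theta \<delta> x \<le> 1" "0 \<le> \<delta> * (norm x)\<^sup>2 * theta \<delta> x" "\<delta> * (norm x)\<^sup>2 * theta \<delta> x \<le> 1"
proof -
  have "0 \<le> \<delta> * (norm x)\<^sup>2" using assms by simp
  then show "0 < theta \<delta> x" "theta \<delta> x \<le> 1" "0 \<le> \<delta> * (norm x)\<^sup>2 * theta \<delta> x" "\<delta> * (norm x)\<^sup>2 * theta \<delta> x \<le> 1"
    by (auto simp: theta_def field_simps)
qed

text \<open>Both parts rest on \<open>t \<le> 1 + t\<^sup>2\<close>. They make the truncated field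
  and the logarithmic gradient of the smoothed kernel bounded for a fixed parameter; the constants
  blow up as the parameter tends to 0 and serve integrability only.\<close>

lemma norm_le_sq:
  fixes t :: real
  assumes "0 < \<delta>" "0 \<le> t"
  shows "t \<le> (1 / \<delta> + 1) * (1 + \<delta> * t\<^sup>2)" "t \<le> (1 / \<delta> + 1) * (t\<^sup>2 + \<delta>)"
proof -
  have e1: "(1 / \<delta> + 1) * (1 + \<delta> * t\<^sup>2) = 1 / \<delta> + 1 + t\<^sup>2 + \<delta> * t\<^sup>2"
    and e2: "(1 / \<delta> + 1) * (t\<^sup>2 + \<delta>) = t\<^sup>2 / \<delta> + 1 + t\<^sup>2 + \<delta>"
    using assms by (auto simp: field_simps)
  have "t \<le> 1 + t\<^sup>2"
  proof (cases "t \<le> 1")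
    case False
    then have "t * 1 \<le> t * t" by (intro mult_left_mono) auto
    then show ?thesis by (simp add: power2_eq_square)
  qed (auto intro: add_increasing2)
  moreover have "0 \<le> 1 / \<delta>" "0 \<le> \<delta> * t\<^sup>2" "0 \<le> t\<^sup>2 / \<delta>" using assms by auto
  ultimately show "t \<le> (1 / \<delta> + 1) * (1 + \<delta> * t\<^sup>2)" "t \<le> (1 / \<delta> + 1) * (t\<^sup>2 + \<delta>)"
    unfolding e1 e2 using assms by linarith+
qed

lemma norm_theta_le:
  fixes x :: "'a::euclidean_space"
  assumes "0 < \<delta>"
  shows "theta \<delta> x * norm x \<le> 1 / \<delta> + 1"
proof -
  have "0 < 1 + \<delta> * (norm x)\<^sup>2" using assms by (simp add: add_pos_nonneg)
  then show ?thesis using norm_le_sq(1)[OF assms, of "norm x"] by (simp add: theta_def pos_divide_le_eq)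
qed

lemma divX_bound:
  assumes "0 \<le> \<delta>"
  shows "\<bar>divX \<delta> (x::'a::euclidean_space)\<bar> \<le> real DIM('a) + 2"
proof -
  note t = theta_bounds[OF assms, of x]
  have "0 \<le> real DIM('a) * theta \<delta> x" "real DIM('a) * theta \<delta> x \<le> real DIM('a) * 1"
    using t by (auto intro!: mult_left_mono)
  moreover have "\<delta> * (norm x)\<^sup>2 * theta \<delta> x * theta \<delta> x \<le> 1 * 1"
    using t by (intro mult_mono) auto
  moreover have "0 \<le> \<delta> * (norm x)\<^sup>2 * theta \<delta> x * theta \<delta> x" using t by simp
  ultimately show ?thesis
    unfolding divX_def power2_eq_square[of "theta \<delta> x"] mult.assoc by (intro abs_leI) linarith+
qed

text \<open>With \<open>a\<close> and \<open>b\<close> the denominators of \<open>theta\<close>, the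
  difference of the fields is \<open>(x - y)\<close> divided by \<open>a\<close> plus
  \<open>1/a - 1/b\<close> times \<open>y\<close>. The first part contributes 1 and the second 2 to
  the constant 3. Its independence of \<delta> is what later lets \<delta> tend to 0.\<close>

lemma dil_bound:
  fixes x y :: "'a::euclidean_space"
  assumes d: "0 \<le> \<delta>"
  shows "\<bar>dil \<delta> x y\<bar> \<le> 3 * (norm (x - y))\<^sup>2"
proof -
  define a b where "a = 1 + \<delta> * (norm x)\<^sup>2" and "b = 1 + \<delta> * (norm y)\<^sup>2"
  have ab: "1 \<le> a" "1 \<le> b" using d by (auto simp: a_def b_def)
  have "theta \<delta> x *\<^sub>R x - theta \<delta> y *\<^sub>R y = (1 / a) *\<^sub>R (x - y) + ((b - a) / (a * b)) *\<^sub>R y"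
  proof -
    have "(b - a) / (a * b) = 1 / a - 1 / b" using ab by (simp add: field_simps)
    moreover have "theta \<delta> x = 1 / a" "theta \<delta> y = 1 / b" by (auto simp: theta_def a_def b_def)
    ultimately show ?thesis by (simp only:) (simp add: algebra_simps)
  qed
  then have "norm (theta \<delta> x *\<^sub>R x - theta \<delta> y *\<^sub>R y) \<le> norm (x - y) / a + \<bar>b - a\<bar> / (a * b) * norm y"
    using ab norm_triangle_ineq[of "(1 / a) *\<^sub>R (x - y)" "((b - a) / (a * b)) *\<^sub>R y"] by (simp add: abs_mult)
  also have "norm (x - y) / a \<le> norm (x - y)" using ab by (simp add: divide_le_eq mult_le_cancel_left1)
  also have "\<bar>b - a\<bar> / (a * b) * norm y \<le> norm (x - y) * 2"
  proof -
    have "b - a = \<delta> * ((norm y - norm x) * (norm y + norm x))"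
      by (simp add: a_def b_def power2_eq_square algebra_simps)
    then have "\<bar>b - a\<bar> = \<delta> * (\<bar>norm y - norm x\<bar> * (norm y + norm x))"
      using d by (simp add: abs_mult)
    also have "\<dots> \<le> \<delta> * (norm (x - y) * (norm y + norm x))"
      using d norm_triangle_ineq3[of y x] by (intro mult_left_mono mult_right_mono) (auto simp: norm_minus_commute)
    finally have "\<bar>b - a\<bar> * norm y \<le> \<delta> * (norm (x - y) * (norm y + norm x)) * norm y"
      by (intro mult_right_mono) auto
    also have "\<dots> = norm (x - y) * (\<delta> * ((norm y)\<^sup>2 + norm x * norm y))"
      by (simp add: power2_eq_square algebra_simps)
    also have "\<dots> \<le> norm (x - y) * (2 * (a * b))"
    proof (intro mult_left_mono)
      have "norm x * norm y \<le> ((norm x)\<^sup>2 + (norm y)\<^sup>2)"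
        using sum_squares_bound[of "norm x" "norm y"] mult_nonneg_nonneg[OF norm_ge_zero[of x] norm_ge_zero[of y]]
        by linarith
      then have "\<delta> * ((norm y)\<^sup>2 + norm x * norm y) \<le> \<delta> * ((norm y)\<^sup>2 + ((norm x)\<^sup>2 + (norm y)\<^sup>2))"
        using d by (intro mult_left_mono add_mono) auto
      also have "\<dots> \<le> 2 * (1 + \<delta> * (norm x)\<^sup>2 + \<delta> * (norm y)\<^sup>2 + (\<delta> * (norm x)\<^sup>2) * (\<delta> * (norm y)\<^sup>2))"
      proof -
        have "0 \<le> \<delta> * (norm x)\<^sup>2" "0 \<le> (\<delta> * (norm x)\<^sup>2) * (\<delta> * (norm y)\<^sup>2)" using d by auto
        then show ?thesis unfolding distrib_left by linarith
      qed
      also have "\<dots> = 2 * (a * b)" by (simp add: a_def b_def algebra_simps)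
      finally show "\<delta> * ((norm y)\<^sup>2 + norm x * norm y) \<le> 2 * (a * b)" .
    qed auto
    finally have "\<bar>b - a\<bar> * norm y \<le> norm (x - y) * 2 * (a * b)" by (simp add: mult_ac)
    moreover have "a * b > 0" using ab by simp
    ultimately have "\<bar>b - a\<bar> * norm y / (a * b) \<le> norm (x - y) * 2" by (simp only: pos_divide_le_eq)
    then show ?thesis by simp
  qed
  finally have n: "norm (theta \<delta> x *\<^sub>R x - theta \<delta> y *\<^sub>R y) \<le> 3 * norm (x - y)" by simp
  have "\<bar>dil \<delta> x y\<bar> \<le> norm (theta \<delta> x *\<^sub>R x - theta \<delta> y *\<^sub>R y) * norm (x - y)"
    unfolding dil_def by (rule Cauchy_Schwarz_ineq2)
  also have "\<dots> \<le> 3 * norm (x - y) * norm (x - y)" using n by (intro mult_right_mono) auto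
  finally show ?thesis by (simp add: power2_eq_square)
qed

context choquard
begin

abbreviation kap :: "real \<Rightarrow> real^4 \<Rightarrow> real" where
  "kap \<epsilon> z \<equiv> ((norm z)\<^sup>2 + \<epsilon>) powr (- \<alpha> / 2)"

text \<open>The derivative of \<open>u\<close> along the truncated dilation field.\<close>

definition G :: "real \<Rightarrow> real^4 \<Rightarrow> real" where
  "G \<delta> x = theta \<delta> x * (\<Sum>b\<in>Basis. (x \<bullet> b) * partial_deriv b u x)"

definition P :: "real^4 \<Rightarrow> real^4 \<Rightarrow> real" where
  "P x y = exp (u x) * exp (u y) / norm (x - y) powr \<alpha>"

lemma partial_u_meas [measurable]: "b \<in> Basis \<Longrightarrow> partial_deriv b u \<in> borel_measurable borel"
  using u_C_diff[of 1] by (auto intro: borel_measurable_continuous_onI)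

lemma G_meas [measurable]: "G \<delta> \<in> borel_measurable borel"
  unfolding G_def[abs_def] by measurable

lemma P_meas [measurable]: "(\<lambda>(x, y). P x y) \<in> borel_measurable (borel \<Otimes>\<^sub>M borel)"
  unfolding P_def by measurable

lemma P_nonneg: "0 \<le> P x y" by (simp add: P_def)

lemma P_row: "integrable lborel (P x)" "(LBINT y. P x y) = F x"
proof -
  have eq: "P x = (\<lambda>y. exp (u x) * (exp (u y) / norm (x - y) powr \<alpha>))" by (auto simp: P_def)
  show "integrable lborel (P x)" unfolding eq by (rule integrable_mult_right[OF choquard_integrable])
  show "(LBINT y. P x y) = F x" unfolding eq by (simp only: integral_mult_right_zero F_eq I_eq mult.commute)
qed

lemma P_integrable: "integrable lborel2 (\<lambda>(x, y). P x y)"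
proof (rule lborel_pair.Fubini_integrable)
  show "integrable lborel (\<lambda>x. LBINT y. norm (case (x, y) of (x, y) \<Rightarrow> P x y))"
    using F_int by (simp add: P_nonneg P_row)
qed (auto simp: P_row)

lemma kap_le: "z \<noteq> 0 \<Longrightarrow> 0 \<le> \<epsilon> \<Longrightarrow> kap \<epsilon> z \<le> 1 / norm z powr \<alpha>"
proof -
  assume z: "z \<noteq> 0" "0 \<le> \<epsilon>"
  have "kap \<epsilon> z \<le> ((norm z)\<^sup>2) powr (- \<alpha> / 2)"
    using z \<alpha> by (intro powr_mono2') auto
  also have "((norm z)\<^sup>2) powr (- \<alpha> / 2) = 1 / norm z powr \<alpha>"
  proof -
    have "(norm z)\<^sup>2 = norm z powr 2" using z by simp
    then show ?thesis by (simp only: powr_powr) (simp add: powr_minus_divide)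
  qed
  finally show ?thesis .
qed

lemma kap_tendsto:
  assumes "z \<noteq> 0" "e \<longlonglongrightarrow> 0"
  shows "(\<lambda>n. kap (e n) z) \<longlonglongrightarrow> 1 / norm z powr \<alpha>"
proof -
  have "(\<lambda>n. kap (e n) z) \<longlonglongrightarrow> ((norm z)\<^sup>2 + 0) powr (- \<alpha> / 2)"
    using assms by (intro tendsto_intros) auto
  moreover have "(norm z)\<^sup>2 = norm z powr 2" using assms by simp
  then have "((norm z)\<^sup>2 + 0) powr (- \<alpha> / 2) = 1 / norm z powr \<alpha>"
    by (simp only: powr_powr add_0_right) (simp add: powr_minus_divide)
  ultimately show ?thesis by simp
qed

lemma G_bound: "0 < \<delta> \<Longrightarrow> \<exists>C\<ge>0. \<forall>x. \<bar>G \<delta> x\<bar> \<le> C"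
proof -
  assume d: "0 < \<delta>"
  obtain L where L: "L \<ge> 0" "\<And>x b. b \<in> Basis \<Longrightarrow> \<bar>partial_deriv b u x\<bar> \<le> L"
    using partial_deriv_u_bounded by blast
  have "\<bar>G \<delta> x\<bar> \<le> (1 / \<delta> + 1) * (4 * L)" for x
  proof -
    have t: "0 < theta \<delta> x" using d by (intro theta_bounds) auto
    have "\<bar>\<Sum>b\<in>Basis. (x \<bullet> b) * partial_deriv b u x\<bar> \<le> (\<Sum>b\<in>(Basis::(real^4) set). norm x * L)"
      unfolding real_norm_def[symmetric]
    proof (rule sum_norm_le)
      fix b :: "real^4" assume "b \<in> Basis"
      then show "norm ((x \<bullet> b) * partial_deriv b u x) \<le> norm x * L"
        unfolding real_norm_def abs_mult using L by (intro mult_mono Basis_le_norm) auto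
    qed
    then have "\<bar>G \<delta> x\<bar> \<le> theta \<delta> x * (4 * (norm x * L))"
      unfolding G_def abs_mult using t by (intro mult_mono) auto
    also have "\<dots> = (theta \<delta> x * norm x) * (4 * L)" by simp
    also have "\<dots> \<le> (1 / \<delta> + 1) * (4 * L)"
      using L d by (intro mult_right_mono norm_theta_le) auto
    finally show ?thesis .
  qed
  moreover have "0 \<le> (1 / \<delta> + 1) * (4 * L)" using d L by simp
  ultimately show ?thesis by blast
qed

lemma kap_row_integrable:
  assumes "0 < \<epsilon>" shows "integrable lborel (\<lambda>x. exp (u x) * kap \<epsilon> (x - y))"
proof (rule integrable_dominated[OF choquard_integrable[of y]])
  show "AE x in lborel. norm (exp (u x) * kap \<epsilon> (x - y)) \<le> norm (exp (u x) / norm (y - x) powr \<alpha>)"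
    using AE_lborel_singleton[of y]
  proof eventually_elim
    case (elim x)
    then have "exp (u x) * kap \<epsilon> (x - y) \<le> exp (u x) * (1 / norm (x - y) powr \<alpha>)"
      using assms by (intro mult_left_mono kap_le) auto
    then show ?case by (simp add: norm_minus_commute)
  qed
qed measurable

text \<open>
  The integrand is the divergence of the field \<open>theta \<delta> x *\<^sub>R x\<close> times \<open>exp (u x) * kap \<epsilon> (x - y)\<close>.
  The kernel has to be regularised because its gradient need not be locally integrable for
  \<open>\<alpha> \<ge> 3\<close>; only after symmetrisation in \<open>x\<close> and \<open>y\<close> can \<open>\<epsilon>\<close> be sent to 0.
\<close>

lemma pohozaev_row:
  assumes d: "0 < \<delta>" and e: "0 < \<epsilon>"
  shows "(LBINT x. exp (u x) * kap \<epsilon> (x - y) *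
    (divX \<delta> x + G \<delta> x - \<alpha> * (theta \<delta> x * (x \<bullet> (x - y)) / ((norm (x - y))\<^sup>2 + \<epsilon>)))) = 0"
proof -
  define s where "s x = (norm (x - y))\<^sup>2 + \<epsilon>" for x :: "real^4"
  have s: "s x > 0" for x unfolding s_def using e by (simp add: add_nonneg_pos)
  define p where "p b x = exp (u x) * kap \<epsilon> (x - y) *
    ((theta \<delta> x - 2 * \<delta> * (x \<bullet> b)\<^sup>2 * (theta \<delta> x)\<^sup>2) + theta \<delta> x * ((x \<bullet> b) * partial_deriv b u x)
      - \<alpha> * (theta \<delta> x * ((x \<bullet> b) * ((x - y) \<bullet> b)) / s x))" for b x
  define g where "g b x = (x \<bullet> b) * theta \<delta> x * (exp (u x) * kap \<epsilon> (x - y))" for b x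
  have den: "0 < 1 + \<delta> * (norm x)\<^sup>2" for x :: "real^4" using d by (simp add: add_pos_nonneg)
  have der: "(g b has_derivative (\<lambda>h. ((x \<bullet> b) * theta \<delta> x) *
      (exp (u x) * (kap \<epsilon> (x - y) * ((- \<alpha> / 2) * (2 * ((x - y) \<bullet> h)) / s x))
        + (exp (u x) * (\<Sum>c\<in>Basis. (h \<bullet> c) * partial_deriv c u x)) * kap \<epsilon> (x - y))
      + ((x \<bullet> b) * (- (theta \<delta> x)\<^sup>2 * \<delta> * (2 * (x \<bullet> h))) + (h \<bullet> b) * theta \<delta> x) * (exp (u x) * kap \<epsilon> (x - y)))) (at x)" for b x
  proof -
    have du: "(u has_derivative (\<lambda>h. \<Sum>c\<in>Basis. (h \<bullet> c) * partial_deriv c u x)) (at x)"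
      by (rule has_derivative_partial_deriv[OF u_differentiable])
    have dt: "(theta \<delta> has_derivative (\<lambda>h. - (theta \<delta> x)\<^sup>2 * \<delta> * (2 * (x \<bullet> h)))) (at x)"
      unfolding theta_def[abs_def] power2_norm_eq_inner using den[of x] unfolding power2_norm_eq_inner
      by (auto intro!: derivative_eq_intros simp: inner_commute power2_eq_square field_simps)
    have dk: "((\<lambda>x. kap \<epsilon> (x - y)) has_derivative (\<lambda>h. kap \<epsilon> (x - y) * ((- \<alpha> / 2) * (2 * ((x - y) \<bullet> h)) / s x))) (at x)"
    proof -
      have "((\<lambda>t. t powr (- \<alpha> / 2)) has_real_derivative ((- \<alpha> / 2) * s x powr (- \<alpha> / 2 - 1))) (at (s x))"
        using s[of x] by (auto intro!: derivative_eq_intros)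
      moreover have "(s has_derivative (\<lambda>h. 2 * ((x - y) \<bullet> h))) (at x)"
        unfolding s_def[abs_def] power2_norm_eq_inner by (auto intro!: derivative_eq_intros simp: inner_commute)
      ultimately have "((\<lambda>x. s x powr (- \<alpha> / 2)) has_derivative (\<lambda>h. (- \<alpha> / 2) * s x powr (- \<alpha> / 2 - 1) * (2 * ((x - y) \<bullet> h)))) (at x)"
        unfolding has_field_derivative_def by (rule has_derivative_compose[rotated])
      moreover have "s x powr (- \<alpha> / 2 - 1) = s x powr (- \<alpha> / 2) / s x"
        using s[of x] by (simp add: powr_diff)
      ultimately show ?thesis by (simp add: s_def mult_ac)
    qed
    have de: "((\<lambda>x. exp (u x)) has_derivative (\<lambda>h. exp (u x) * (\<Sum>c\<in>Basis. (h \<bullet> c) * partial_deriv c u x))) (at x)"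
      by (rule has_derivative_eq_rhs[OF has_derivative_exp[OF du]]) (auto simp: mult.commute)
    have db: "((\<lambda>x. x \<bullet> b) has_derivative (\<lambda>h. h \<bullet> b)) (at x)"
      by (rule has_derivative_inner_left[OF has_derivative_ident])
    show ?thesis unfolding g_def[abs_def]
      by (rule has_derivative_mult[OF has_derivative_mult[OF db dt] has_derivative_mult[OF de dk]])
  qed
  have gd: "g b differentiable (at x)" for b x using der by (auto simp: differentiable_def)
  have pg: "partial_deriv b (g b) = p b" if b: "b \<in> Basis" for b
  proof
    fix x
    have "partial_deriv b (g b) x = ((x \<bullet> b) * theta \<delta> x) *
      (exp (u x) * (kap \<epsilon> (x - y) * ((- \<alpha> / 2) * (2 * ((x - y) \<bullet> b)) / s x))
        + (exp (u x) * partial_deriv b u x) * kap \<epsilon> (x - y))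
      + ((x \<bullet> b) * (- (theta \<delta> x)\<^sup>2 * \<delta> * (2 * (x \<bullet> b))) + 1 * theta \<delta> x) * (exp (u x) * kap \<epsilon> (x - y))"
      using partial_deriv_eqI[OF der, of b b x] b
      by (simp add: inner_Basis if_distrib if_distribR sum.delta' cong: if_cong)
    also have "\<dots> = p b x"
    proof -
      have alg: "(q * t) * (E * (k * ((- \<alpha> / 2) * (2 * z) / S)) + (E * w) * k) + (q * (- t\<^sup>2 * \<delta> * (2 * q)) + 1 * t) * (E * k)
        = E * k * ((t - 2 * \<delta> * q\<^sup>2 * t\<^sup>2) + t * (q * w) - \<alpha> * (t * (q * z) / S))"
        for q t E k z S w :: real
      proof -
        have r1: "(- \<alpha> / 2) * (2 * z) / S = - \<alpha> * (z / S)" by simp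
        have r2: "t * (q * z) / S = t * (q * (z / S))" by simp
        show ?thesis unfolding r1 r2 by algebra
      qed
      show ?thesis unfolding p_def by (rule alg)
    qed
    finally show "partial_deriv b (g b) x = p b x" .
  qed
  obtain L where L: "L \<ge> 0" "\<And>x b. b \<in> Basis \<Longrightarrow> \<bar>partial_deriv b u x\<bar> \<le> L"
    using partial_deriv_u_bounded by blast
  \<comment> \<open>Bounds for the truncated field and for the logarithmic gradient of the kernel,
    used to dominate \<open>p b\<close> and \<open>g b\<close> by the integrable smoothed
    row.\<close>
  let ?D = "1 / \<delta> + 1" and ?E = "1 / \<epsilon> + 1"
  have D0: "0 \<le> ?D" "0 \<le> ?E" using d e by auto
  have xb: "\<bar>theta \<delta> x * (x \<bullet> b)\<bar> \<le> ?D" if "b \<in> Basis" for x b :: "real^4"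
  proof -
    have "theta \<delta> x * \<bar>x \<bullet> b\<bar> \<le> theta \<delta> x * norm x"
      using that d theta_bounds[of \<delta> x] by (intro mult_left_mono Basis_le_norm) auto
    from order_trans[OF this norm_theta_le[OF d]] show ?thesis
      using theta_bounds(1)[of \<delta> x] d by (simp add: abs_mult)
  qed
  have zb: "\<bar>((x - y) \<bullet> b) / s x\<bar> \<le> ?E" if "b \<in> Basis" for x b
  proof -
    have "\<bar>(x - y) \<bullet> b\<bar> \<le> ?E * s x"
      using Basis_le_norm[OF that, of "x - y"] norm_le_sq(2)[OF e, of "norm (x - y)"] unfolding s_def by linarith
    then show ?thesis using s[of x] by (simp add: abs_divide pos_divide_le_eq)
  qed
  have kpos: "0 \<le> exp (u x) * kap \<epsilon> (x - y)" for x by simp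
  have pb: "\<bar>p b x\<bar> \<le> (3 + ?D * L + \<alpha> * (?D * ?E)) * (exp (u x) * kap \<epsilon> (x - y))" if b: "b \<in> Basis" for b x
  proof -
    have t: "0 < theta \<delta> x" "theta \<delta> x \<le> 1" using theta_bounds[of \<delta> x] d by auto
    have "\<delta> * (x \<bullet> b)\<^sup>2 * theta \<delta> x * theta \<delta> x \<le> \<delta> * (norm x)\<^sup>2 * theta \<delta> x * 1"
    proof (intro mult_mono)
      have "\<bar>x \<bullet> b\<bar>\<^sup>2 \<le> (norm x)\<^sup>2" using Basis_le_norm[OF b] by (intro power_mono) auto
      then show "(x \<bullet> b)\<^sup>2 \<le> (norm x)\<^sup>2" by simp
    qed (use d t in auto)
    also have "\<dots> \<le> 1" using theta_bounds(4)[of \<delta> x] d by simp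
    finally have q1: "2 * \<delta> * (x \<bullet> b)\<^sup>2 * (theta \<delta> x)\<^sup>2 \<le> 2" by (simp add: power2_eq_square mult_ac)
    have q0: "0 \<le> 2 * \<delta> * (x \<bullet> b)\<^sup>2 * (theta \<delta> x)\<^sup>2" using d by simp
    have q2: "\<bar>theta \<delta> x * ((x \<bullet> b) * partial_deriv b u x)\<bar> \<le> ?D * L"
      using mult_mono[OF xb[OF b, of x] L(2)[OF b, of x] D0(1)] by (simp add: abs_mult mult.assoc)
    have q3: "\<bar>theta \<delta> x * ((x \<bullet> b) * ((x - y) \<bullet> b)) / s x\<bar> \<le> ?D * ?E"
      using mult_mono[OF xb[OF b, of x] zb[OF b, of x] D0(1)] by (simp add: abs_mult mult.assoc)
    have q4: "\<bar>\<alpha> * (theta \<delta> x * ((x \<bullet> b) * ((x - y) \<bullet> b)) / s x)\<bar> \<le> \<alpha> * (?D * ?E)"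
      unfolding abs_mult[of \<alpha>] abs_of_pos[OF \<alpha>(1)] by (rule mult_left_mono[OF q3]) (use \<alpha> in simp)
    have "\<bar>(theta \<delta> x - 2 * \<delta> * (x \<bullet> b)\<^sup>2 * (theta \<delta> x)\<^sup>2) + theta \<delta> x * ((x \<bullet> b) * partial_deriv b u x)
      - \<alpha> * (theta \<delta> x * ((x \<bullet> b) * ((x - y) \<bullet> b)) / s x)\<bar> \<le> 3 + ?D * L + \<alpha> * (?D * ?E)"
      using q0 q1 q2 q4 t by linarith
    from mult_right_mono[OF this kpos[of x]] show ?thesis
      unfolding p_def abs_mult[of "exp (u x) * kap \<epsilon> (x - y)"] abs_of_nonneg[OF kpos] by (simp only: mult.commute)
  qed
  have gb: "\<bar>g b x\<bar> \<le> ?D * (exp (u x) * kap \<epsilon> (x - y))" if b: "b \<in> Basis" for b x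
    using mult_right_mono[OF xb[OF b, of x] kpos[of x]]
    unfolding g_def abs_mult[of "(x \<bullet> b) * theta \<delta> x"] abs_of_nonneg[OF kpos] by (simp only: mult.commute)
  have cu: "continuous_on UNIV (partial_deriv b u)" if "b \<in> Basis" for b
    using u_C_diff[of 1] that by simp
  have cp: "continuous_on UNIV (p b)" if b: "b \<in> Basis" for b
    unfolding p_def[abs_def] s_def theta_def
    using den e by (intro continuous_intros u_continuous cu[OF b])
      (auto simp: less_imp_neq[THEN not_sym] add_nonneg_eq_0_iff)
  have cg: "continuous_on UNIV (g b)" for b
    by (intro continuous_at_imp_continuous_on ballI differentiable_imp_continuous_within gd)
  have ip: "integrable lborel (p b)" if b: "b \<in> Basis" for b
  proof (rule integrable_dominated[OF integrable_mult_right[OF kap_row_integrable[OF e, of y]]])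
    show "AE x in lborel. norm (p b x) \<le> norm ((3 + ?D * L + \<alpha> * (?D * ?E)) * (exp (u x) * kap \<epsilon> (x - y)))"
      by (intro AE_I2 norm_le_normI pb[OF b])
  qed (use borel_measurable_continuous_onI[OF cp[OF b]] in simp)
  have ig: "integrable lborel (g b)" if b: "b \<in> Basis" for b
  proof (rule integrable_dominated[OF integrable_mult_right[OF kap_row_integrable[OF e, of y]]])
    show "AE x in lborel. norm (g b x) \<le> norm (?D * (exp (u x) * kap \<epsilon> (x - y)))"
      by (intro AE_I2 norm_le_normI gb[OF b])
  qed (use borel_measurable_continuous_onI[OF cg] in simp)
  have "(LBINT x. p b x) = 0" if b: "b \<in> Basis" for b
    using integral_partial_deriv_eq_0[OF b gd, of b] cp[OF b] ig[OF b] ip[OF b] unfolding pg[OF b] by simp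
  then have "0 = (\<Sum>b\<in>Basis. LBINT x. p b x)" by simp
  also have "\<dots> = (LBINT x. (\<Sum>b\<in>Basis. p b x))"
    by (rule Bochner_Integration.integral_sum[symmetric]) (rule ip)
  also have "(\<lambda>x. \<Sum>b\<in>Basis. p b x) = (\<lambda>x. exp (u x) * kap \<epsilon> (x - y) *
    (divX \<delta> x + G \<delta> x - \<alpha> * (theta \<delta> x * (x \<bullet> (x - y)) / ((norm (x - y))\<^sup>2 + \<epsilon>))))"
  \<comment> \<open>Summation over the four directions: the constant terms assemble to
    \<open>divX\<close>, the derivatives of \<open>u\<close> to \<open>G\<close>, and the coordinate
    products to inner products.\<close>
  proof
    fix x :: "real^4"
    have n: "(\<Sum>b\<in>Basis. (x \<bullet> b)\<^sup>2) = (norm x)\<^sup>2"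
      unfolding power2_norm_eq_inner by (subst euclidean_inner) (simp add: power2_eq_square)
    have i: "(\<Sum>b\<in>Basis. (x \<bullet> b) * ((x - y) \<bullet> b)) = x \<bullet> (x - y)"
      by (subst euclidean_inner) simp
    have "(\<Sum>b\<in>Basis. p b x) = exp (u x) * kap \<epsilon> (x - y) *
      ((\<Sum>b\<in>(Basis::(real^4) set). theta \<delta> x) - (\<Sum>b\<in>Basis. 2 * \<delta> * (x \<bullet> b)\<^sup>2 * (theta \<delta> x)\<^sup>2)
        + (\<Sum>b\<in>Basis. theta \<delta> x * ((x \<bullet> b) * partial_deriv b u x))
        - (\<Sum>b\<in>Basis. \<alpha> * (theta \<delta> x * ((x \<bullet> b) * ((x - y) \<bullet> b)) / s x)))"
      unfolding p_def sum_distrib_left[symmetric] sum_subtractf sum.distrib ..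
    also have "(\<Sum>b\<in>(Basis::(real^4) set). theta \<delta> x) - (\<Sum>b\<in>Basis. 2 * \<delta> * (x \<bullet> b)\<^sup>2 * (theta \<delta> x)\<^sup>2) = divX \<delta> x"
      unfolding divX_def n[symmetric] sum_distrib_left sum_distrib_right by simp
    also have "(\<Sum>b\<in>Basis. theta \<delta> x * ((x \<bullet> b) * partial_deriv b u x)) = G \<delta> x"
      by (simp add: G_def sum_distrib_left)
    also have "(\<Sum>b\<in>Basis. \<alpha> * (theta \<delta> x * ((x \<bullet> b) * ((x - y) \<bullet> b)) / s x))
       = \<alpha> * (theta \<delta> x * (x \<bullet> (x - y)) / ((norm (x - y))\<^sup>2 + \<epsilon>))"
      unfolding i[symmetric] s_def by (simp add: sum_distrib_left sum_divide_distrib)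
    finally show "(\<Sum>b\<in>Basis. p b x) = exp (u x) * kap \<epsilon> (x - y) *
      (divX \<delta> x + G \<delta> x - \<alpha> * (theta \<delta> x * (x \<bullet> (x - y)) / ((norm (x - y))\<^sup>2 + \<epsilon>)))" .
  qed
  finally show ?thesis by simp
qed

end

lemma not_AE_lborel_False: "\<not> (AE x in (lborel :: 'a::euclidean_space measure). False)"
  using AE_iff_measurable[of UNIV "lborel :: 'a measure" "\<lambda>_. False"] emeasure_lborel_UNIV[where 'a = 'a] by auto

section \<open>Symmetrisation and removal of the smoothing\<close>

lemma lborel_pair_swap:
  fixes H :: "'a::euclidean_space \<Rightarrow> 'a \<Rightarrow> real"
  assumes "integrable lborel2 (\<lambda>(x, y). H x y)"
  shows "integrable lborel2 (\<lambda>(x, y). H y x)"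
    and "integral\<^sup>L lborel2 (\<lambda>(x, y). H y x) = integral\<^sup>L lborel2 (\<lambda>(x, y). H x y)"
proof -
  show "integrable lborel2 (\<lambda>(x, y). H y x)"
    using lborel_pair.integrable_product_swap[OF assms] by simp
  show "integral\<^sup>L lborel2 (\<lambda>(x, y). H y x) = integral\<^sup>L lborel2 (\<lambda>(x, y). H x y)"
    using lborel_pair.integral_product_swap[of "\<lambda>(x, y). H x y"] assms by auto
qed

context choquard
begin

definition S :: "real \<Rightarrow> real^4 \<Rightarrow> real^4 \<Rightarrow> real" where
  "S \<epsilon> x y = exp (u x) * exp (u y) * kap \<epsilon> (x - y)"

lemma S_meas [measurable]: "(\<lambda>(x, y). S \<epsilon> x y) \<in> borel_measurable (borel \<Otimes>\<^sub>M borel)"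
  unfolding S_def by measurable

lemma S_nonneg: "0 \<le> S \<epsilon> x y" by (simp add: S_def)

text \<open>The diagonal is excluded because \<open>P x x\<close> is 0 by division by zero, while
  \<open>S \<epsilon> x x\<close> is positive for positive \<epsilon>. It is a null set for the
  product measure.\<close>

lemma S_le_P: "x \<noteq> y \<Longrightarrow> 0 \<le> \<epsilon> \<Longrightarrow> S \<epsilon> x y \<le> P x y"
  unfolding S_def P_def using mult_left_mono[OF kap_le[of "x - y" \<epsilon>], of "exp (u x) * exp (u y)"] by simp

lemma integrable_S_mult:
  assumes [measurable]: "(\<lambda>(x, y). A x y) \<in> borel_measurable (borel \<Otimes>\<^sub>M borel)"
    and A: "\<And>x y. \<bar>A x y\<bar> \<le> C" and e: "0 \<le> \<epsilon>"
  shows "integrable lborel2 (\<lambda>(x, y). S \<epsilon> x y * A x y)"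
proof (rule integrable_dominated[OF integrable_mult_right[OF P_integrable, of C]])
  show "AE p in lborel2. norm (case p of (x, y) \<Rightarrow> S \<epsilon> x y * A x y) \<le> norm (C * (case p of (x, y) \<Rightarrow> P x y))"
    using AE_lborel_off_diagonal
  proof eventually_elim
    case (elim p)
    obtain x y where p: "p = (x, y)" by (cases p)
    have "S \<epsilon> x y * \<bar>A x y\<bar> \<le> P x y * C"
      using elim e A S_nonneg P_nonneg unfolding p by (intro mult_mono S_le_P) auto
    then have "\<bar>S \<epsilon> x y * A x y\<bar> \<le> C * P x y" by (simp add: abs_mult S_nonneg mult.commute)
    then show ?case unfolding p prod.case by (rule norm_le_normI)
  qed
qed measurable

lemma integrable_P_mult:
  assumes [measurable]: "(\<lambda>(x, y). A x y) \<in> borel_measurable (borel \<Otimes>\<^sub>M borel)"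
    and A: "\<And>x y. \<bar>A x y\<bar> \<le> C"
  shows "integrable lborel2 (\<lambda>(x, y). P x y * A x y)"
proof (rule integrable_dominated[OF integrable_mult_right[OF P_integrable, of C]])
  show "AE p in lborel2. norm (case p of (x, y) \<Rightarrow> P x y * A x y) \<le> norm (C * (case p of (x, y) \<Rightarrow> P x y))"
  proof (rule AE_I2)
    fix p :: "(real^4) \<times> (real^4)"
    obtain x y where p: "p = (x, y)" by (cases p)
    have "P x y * \<bar>A x y\<bar> \<le> P x y * C" using A P_nonneg by (intro mult_left_mono) auto
    then have "\<bar>P x y * A x y\<bar> \<le> C * P x y" by (simp add: abs_mult P_nonneg mult.commute)
    then show "norm (case p of (x, y) \<Rightarrow> P x y * A x y) \<le> norm (C * (case p of (x, y) \<Rightarrow> P x y))"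
      unfolding p prod.case by (rule norm_le_normI)
  qed
qed measurable

lemma integral_P_mult:
  assumes [measurable]: "A \<in> borel_measurable borel" and A: "\<And>x. \<bar>A x\<bar> \<le> C"
  shows "integral\<^sup>L lborel2 (\<lambda>(x, y). P x y * A x) = (LBINT x. F x * A x)"
proof -
  have "(LBINT x. LBINT y. P x y * A x) = integral\<^sup>L lborel2 (\<lambda>(x, y). P x y * A x)"
    by (rule lborel_pair.integral_fst, rule integrable_P_mult[OF _ A]) measurable
  moreover have "(LBINT y. P x y * A x) = F x * A x" for x
    by (simp only: integral_mult_left_zero P_row)
  ultimately show ?thesis by (simp only:)
qed

lemma divX_G_bound:
  assumes "0 < \<delta>" shows "\<exists>C. \<forall>x. \<bar>divX \<delta> x + G \<delta> x\<bar> \<le> C"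
proof -
  obtain C where C: "\<And>x. \<bar>G \<delta> x\<bar> \<le> C" using G_bound[OF assms] by blast
  have "\<bar>divX \<delta> x + G \<delta> x\<bar> \<le> (real DIM(real^4) + 2) + C" for x
    using divX_bound[of \<delta> x] C[of x] assms by linarith
  then show ?thesis by blast
qed

text \<open>The row identity is multiplied by \<open>exp (u y)\<close> and integrated in
  \<open>y\<close>. As \<open>S\<close> is symmetric, the kernel term may be averaged with its image
  under exchange of the variables, and the two numerators add up to \<open>dil\<close>; the average
  is the origin of the factor 1/2.\<close>

lemma pohozaev_regularised:
  assumes d: "0 < \<delta>" and e: "0 < \<epsilon>"
  shows "integral\<^sup>L lborel2 (\<lambda>(x, y). S \<epsilon> x y * (divX \<delta> x + G \<delta> x))
    = \<alpha> / 2 * integral\<^sup>L lborel2 (\<lambda>(x, y). S \<epsilon> x y * (dil \<delta> x y / ((norm (x - y))\<^sup>2 + \<epsilon>)))"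
proof -
  define B where "B x y = theta \<delta> x * (x \<bullet> (x - y)) / ((norm (x - y))\<^sup>2 + \<epsilon>)" for x y :: "real^4"
  have [measurable]: "(\<lambda>(x, y). B x y) \<in> borel_measurable (borel \<Otimes>\<^sub>M borel)"
    unfolding B_def by measurable
  have s: "0 < (norm z)\<^sup>2 + \<epsilon>" for z :: "real^4" using e by (simp add: add_nonneg_pos)
  have B: "\<bar>B x y\<bar> \<le> (1 / \<delta> + 1) * (1 / \<epsilon> + 1)" for x y
  proof -
    have t: "0 < theta \<delta> x" using d by (intro theta_bounds) auto
    have "\<bar>B x y\<bar> \<le> theta \<delta> x * (norm x * norm (x - y)) / ((norm (x - y))\<^sup>2 + \<epsilon>)"
      unfolding B_def abs_divide abs_mult abs_of_pos[OF t] abs_of_pos[OF s]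
      using t s[of "x - y"] by (intro divide_right_mono mult_left_mono Cauchy_Schwarz_ineq2) auto
    also have "\<dots> = (theta \<delta> x * norm x) * (norm (x - y) / ((norm (x - y))\<^sup>2 + \<epsilon>))" by simp
    also have "\<dots> \<le> (1 / \<delta> + 1) * (1 / \<epsilon> + 1)"
    proof (intro mult_mono norm_theta_le d)
      show "norm (x - y) / ((norm (x - y))\<^sup>2 + \<epsilon>) \<le> 1 / \<epsilon> + 1"
        using norm_le_sq(2)[OF e, of "norm (x - y)"] s[of "x - y"] by (simp add: pos_divide_le_eq)
    qed (use d s[of "x - y"] in auto)
    finally show ?thesis .
  qed
  obtain C where C: "\<And>x. \<bar>divX \<delta> x + G \<delta> x\<bar> \<le> C" using divX_G_bound[OF d] by blast
  have i1: "integrable lborel2 (\<lambda>(x, y). S \<epsilon> x y * (divX \<delta> x + G \<delta> x))"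
    by (rule integrable_S_mult[OF _ C less_imp_le[OF e]]) measurable
  have i2: "integrable lborel2 (\<lambda>(x, y). S \<epsilon> x y * B x y)"
    by (rule integrable_S_mult[OF _ B less_imp_le[OF e]]) measurable
  have "integral\<^sup>L lborel2 (\<lambda>(x, y). S \<epsilon> x y * (divX \<delta> x + G \<delta> x))
     - \<alpha> * integral\<^sup>L lborel2 (\<lambda>(x, y). S \<epsilon> x y * B x y)
    = integral\<^sup>L lborel2 (\<lambda>p. (case p of (x, y) \<Rightarrow> S \<epsilon> x y * (divX \<delta> x + G \<delta> x)) - \<alpha> * (case p of (x, y) \<Rightarrow> S \<epsilon> x y * B x y))"
    using i1 i2 by simp
  also have "\<dots> = integral\<^sup>L lborel2 (\<lambda>(x, y). S \<epsilon> x y * (divX \<delta> x + G \<delta> x - \<alpha> * B x y))"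
    by (intro Bochner_Integration.integral_cong) (auto simp: algebra_simps)
  also have "\<dots> = (LBINT y. LBINT x. S \<epsilon> x y * (divX \<delta> x + G \<delta> x - \<alpha> * B x y))"
  proof (rule lborel_pair.integral_snd[symmetric])
    have "integrable lborel2 (\<lambda>p. (case p of (x, y) \<Rightarrow> S \<epsilon> x y * (divX \<delta> x + G \<delta> x)) - \<alpha> * (case p of (x, y) \<Rightarrow> S \<epsilon> x y * B x y))"
      using i1 i2 by simp
    also have "(\<lambda>p. (case p of (x, y) \<Rightarrow> S \<epsilon> x y * (divX \<delta> x + G \<delta> x)) - \<alpha> * (case p of (x, y) \<Rightarrow> S \<epsilon> x y * B x y))
      = (\<lambda>(x, y). S \<epsilon> x y * (divX \<delta> x + G \<delta> x - \<alpha> * B x y))"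
      by (auto simp: algebra_simps)
    finally show "integrable lborel2 (\<lambda>(x, y). S \<epsilon> x y * (divX \<delta> x + G \<delta> x - \<alpha> * B x y))" .
  qed
  also have "(\<lambda>y. LBINT x. S \<epsilon> x y * (divX \<delta> x + G \<delta> x - \<alpha> * B x y)) = (\<lambda>y. 0)"
  proof
    fix y
    have "(LBINT x. S \<epsilon> x y * (divX \<delta> x + G \<delta> x - \<alpha> * B x y))
      = (LBINT x. exp (u y) * (exp (u x) * kap \<epsilon> (x - y) * (divX \<delta> x + G \<delta> x - \<alpha> * (theta \<delta> x * (x \<bullet> (x - y)) / ((norm (x - y))\<^sup>2 + \<epsilon>)))))"
      by (intro Bochner_Integration.integral_cong refl) (simp add: S_def B_def)
    also have "\<dots> = 0" by (simp only: integral_mult_right_zero pohozaev_row[OF d e] mult_zero_right)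
    finally show "(LBINT x. S \<epsilon> x y * (divX \<delta> x + G \<delta> x - \<alpha> * B x y)) = 0" .
  qed
  finally have 1: "integral\<^sup>L lborel2 (\<lambda>(x, y). S \<epsilon> x y * (divX \<delta> x + G \<delta> x))
     = \<alpha> * integral\<^sup>L lborel2 (\<lambda>(x, y). S \<epsilon> x y * B x y)" by simp
  note sw = lborel_pair_swap[OF i2]
  have "2 * integral\<^sup>L lborel2 (\<lambda>(x, y). S \<epsilon> x y * B x y)
    = integral\<^sup>L lborel2 (\<lambda>p. (case p of (x, y) \<Rightarrow> S \<epsilon> x y * B x y) + (case p of (x, y) \<Rightarrow> S \<epsilon> y x * B y x))"
    using i2 sw by simp
  also have "\<dots> = integral\<^sup>L lborel2 (\<lambda>(x, y). S \<epsilon> x y * (dil \<delta> x y / ((norm (x - y))\<^sup>2 + \<epsilon>)))"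
  proof (intro Bochner_Integration.integral_cong refl, clarify)
    fix x y :: "real^4"
    have c: "S \<epsilon> y x = S \<epsilon> x y" by (simp add: S_def norm_minus_commute)
    have "dil \<delta> x y = theta \<delta> x * (x \<bullet> (x - y)) + theta \<delta> y * (y \<bullet> (y - x))"
      by (simp add: dil_def inner_diff algebra_simps)
    then have "B x y + B y x = dil \<delta> x y / ((norm (x - y))\<^sup>2 + \<epsilon>)"
      unfolding B_def norm_minus_commute[of y x] by (simp only: add_divide_distrib)
    then show "S \<epsilon> x y * B x y + S \<epsilon> y x * B y x = S \<epsilon> x y * (dil \<delta> x y / ((norm (x - y))\<^sup>2 + \<epsilon>))"
      unfolding c by (simp only: distrib_left[symmetric])
  qed
  finally show ?thesis using 1 by simp
qed

text \<open>After symmetrisation the quotient with \<open>dil\<close> is at most 3 uniformly in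
  \<epsilon>, so constant multiples of \<open>P\<close> dominate both sides as \<epsilon> tends to
  0. The rows of \<open>P\<close> integrate to \<open>F\<close>, which brings the left side to a
  single integral.\<close>

lemma pohozaev_truncated:
  assumes d: "0 < \<delta>"
  shows "(LBINT x. F x * (divX \<delta> x + G \<delta> x))
    = \<alpha> / 2 * integral\<^sup>L lborel2 (\<lambda>(x, y). P x y * (dil \<delta> x y / (norm (x - y))\<^sup>2))"
proof -
  define e where "e n = 1 / real (Suc n)" for n
  have e: "0 < e n" for n by (simp add: e_def)
  have e0: "e \<longlonglongrightarrow> 0" unfolding e_def[abs_def] using LIMSEQ_inverse_real_of_nat by (simp add: inverse_eq_divide)
  obtain C where C: "\<And>x. \<bar>divX \<delta> x + G \<delta> x\<bar> \<le> C" using divX_G_bound[OF d] by blast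
  have Slim: "(\<lambda>n. S (e n) x y) \<longlonglongrightarrow> P x y" if "x \<noteq> y" for x y
  proof -
    have "(\<lambda>n. S (e n) x y) \<longlonglongrightarrow> exp (u x) * exp (u y) * (1 / norm (x - y) powr \<alpha>)"
      unfolding S_def using that by (intro tendsto_mult_left kap_tendsto e0) auto
    then show ?thesis by (simp add: P_def)
  qed
  have L1: "(\<lambda>n. integral\<^sup>L lborel2 (\<lambda>(x, y). S (e n) x y * (divX \<delta> x + G \<delta> x)))
    \<longlonglongrightarrow> integral\<^sup>L lborel2 (\<lambda>(x, y). P x y * (divX \<delta> x + G \<delta> x))"
  proof (rule integral_dominated_convergence[where w = "\<lambda>p. C * (case p of (x, y) \<Rightarrow> P x y)"])
    show "integrable lborel2 (\<lambda>p. C * (case p of (x, y) \<Rightarrow> P x y))"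
      by (rule integrable_mult_right[OF P_integrable])
    show "AE p in lborel2. (\<lambda>n. case p of (x, y) \<Rightarrow> S (e n) x y * (divX \<delta> x + G \<delta> x)) \<longlonglongrightarrow> (case p of (x, y) \<Rightarrow> P x y * (divX \<delta> x + G \<delta> x))"
      using AE_lborel_off_diagonal by eventually_elim (auto intro!: tendsto_mult_right Slim split: prod.splits)
    show "AE p in lborel2. norm (case p of (x, y) \<Rightarrow> S (e n) x y * (divX \<delta> x + G \<delta> x)) \<le> C * (case p of (x, y) \<Rightarrow> P x y)" for n
      using AE_lborel_off_diagonal
    proof eventually_elim
      case (elim p)
      obtain x y where p: "p = (x, y)" by (cases p)
      have "S (e n) x y * \<bar>divX \<delta> x + G \<delta> x\<bar> \<le> P x y * C"
        using elim e[of n] C S_nonneg P_nonneg unfolding p by (intro mult_mono S_le_P) auto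
      then show ?case unfolding p by (simp add: abs_mult S_nonneg mult.commute)
    qed
  qed measurable
  have L2: "(\<lambda>n. integral\<^sup>L lborel2 (\<lambda>(x, y). S (e n) x y * (dil \<delta> x y / ((norm (x - y))\<^sup>2 + e n))))
    \<longlonglongrightarrow> integral\<^sup>L lborel2 (\<lambda>(x, y). P x y * (dil \<delta> x y / (norm (x - y))\<^sup>2))"
  proof (rule integral_dominated_convergence[where w = "\<lambda>p. 3 * (case p of (x, y) \<Rightarrow> P x y)"])
    show "integrable lborel2 (\<lambda>p. 3 * (case p of (x, y) \<Rightarrow> P x y))"
      by (rule integrable_mult_right[OF P_integrable])
    show "AE p in lborel2. (\<lambda>n. case p of (x, y) \<Rightarrow> S (e n) x y * (dil \<delta> x y / ((norm (x - y))\<^sup>2 + e n)))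
      \<longlonglongrightarrow> (case p of (x, y) \<Rightarrow> P x y * (dil \<delta> x y / (norm (x - y))\<^sup>2))"
      using AE_lborel_off_diagonal
    proof eventually_elim
      case (elim p)
      obtain x y where p: "p = (x, y)" by (cases p)
      have "(\<lambda>n. S (e n) x y * (dil \<delta> x y / ((norm (x - y))\<^sup>2 + e n))) \<longlonglongrightarrow> P x y * (dil \<delta> x y / ((norm (x - y))\<^sup>2 + 0))"
        using elim unfolding p by (intro tendsto_mult tendsto_divide tendsto_add tendsto_const e0 Slim) auto
      then show ?case unfolding p by simp
    qed
    show "AE p in lborel2. norm (case p of (x, y) \<Rightarrow> S (e n) x y * (dil \<delta> x y / ((norm (x - y))\<^sup>2 + e n))) \<le> 3 * (case p of (x, y) \<Rightarrow> P x y)" for n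
      using AE_lborel_off_diagonal
    proof eventually_elim
      case (elim p)
      obtain x y where p: "p = (x, y)" by (cases p)
      have s: "0 < (norm (x - y))\<^sup>2 + e n" using e[of n] by (simp add: add_nonneg_pos)
      have "\<bar>dil \<delta> x y\<bar> \<le> 3 * ((norm (x - y))\<^sup>2 + e n)"
        using dil_bound[OF less_imp_le[OF d], of x y] e[of n] by (simp add: distrib_left)
      then have "\<bar>dil \<delta> x y / ((norm (x - y))\<^sup>2 + e n)\<bar> \<le> 3"
        using s by (simp add: abs_divide pos_divide_le_eq)
      then have "S (e n) x y * \<bar>dil \<delta> x y / ((norm (x - y))\<^sup>2 + e n)\<bar> \<le> P x y * 3"
        using elim e[of n] S_nonneg P_nonneg unfolding p by (intro mult_mono S_le_P) auto
      then show ?case unfolding p prod.case real_norm_def abs_mult abs_of_nonneg[OF S_nonneg] by simp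
    qed
  qed measurable
  have "(\<lambda>n. integral\<^sup>L lborel2 (\<lambda>(x, y). S (e n) x y * (divX \<delta> x + G \<delta> x)))
    \<longlonglongrightarrow> \<alpha> / 2 * integral\<^sup>L lborel2 (\<lambda>(x, y). P x y * (dil \<delta> x y / (norm (x - y))\<^sup>2))"
    unfolding pohozaev_regularised[OF d e] by (rule tendsto_mult_left[OF L2])
  from LIMSEQ_unique[OF L1 this]
  show ?thesis by (subst integral_P_mult[symmetric, OF _ C]) auto
qed

text \<open>The inner integral is bounded uniformly in \<open>x\<close>, so \<open>M\<close> bounds
  the outer one. This justifies Fubini in \<open>integral_F_G\<close>, where the gradient kernel has
  order 1.\<close>

lemma FF_singular_integrable:
  "integrable lborel2 (\<lambda>(x, y). F x * (F y / norm (x - y)))"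
proof (rule lborel_pair.Fubini_integrable)
  obtain K where K: "\<And>x. (LBINT y. F y / norm (x - y) powr 1) \<le> K"
    using F_singular_integral_bound[of 1] by auto
  have [measurable]: "(\<lambda>x. LBINT y. F y / norm (x - y)) \<in> borel_measurable borel"
    by measurable
  have "integrable lborel (\<lambda>x. F x * (LBINT y. F y / norm (x - y)))"
  proof (rule integrable_dominated[OF integrable_mult_right[OF F_int, of K]])
    show "AE x in lborel. norm (F x * (LBINT y. F y / norm (x - y))) \<le> norm (K * F x)"
    proof (rule AE_I2)
      fix x
      have "0 \<le> (LBINT y. F y / norm (x - y))" by (intro integral_nonneg_AE) (simp add: F_nonneg)
      then show "norm (F x * (LBINT y. F y / norm (x - y))) \<le> norm (K * F x)"
        using K[of x] F_nonneg[of x] mult_left_mono[of "LBINT y. F y / norm (x - y)" K "F x"]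
        by (simp add: abs_mult mult.commute)
    qed
  qed measurable
  moreover have "(LBINT y. norm (case (x, y) of (x, y) \<Rightarrow> F x * (F y / norm (x - y))))
    = F x * (LBINT y. F y / norm (x - y))" for x
  proof -
    have "(LBINT y. norm (case (x, y) of (x, y) \<Rightarrow> F x * (F y / norm (x - y))))
      = (LBINT y. F x * (F y / norm (x - y)))"
      by (intro Bochner_Integration.integral_cong refl) (simp add: abs_mult F_nonneg)
    then show ?thesis by (simp only: integral_mult_right_zero)
  qed
  ultimately show "integrable lborel (\<lambda>x. LBINT y. norm (case (x, y) of (x, y) \<Rightarrow> F x * (F y / norm (x - y))))"
    by (simp only:)
  show "AE x in lborel. integrable lborel (\<lambda>y. case (x, y) of (x, y) \<Rightarrow> F x * (F y / norm (x - y)))"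
    using integrable_mult_right[OF F_div_norm] by auto
qed measurable

lemma FF_integrable:
  "integrable lborel2 (\<lambda>(x, y). F x * F y)"
  and FF_integral: "integral\<^sup>L lborel2 (\<lambda>(x, y). F x * F y) = M\<^sup>2"
proof -
  show *: "integrable lborel2 (\<lambda>(x, y). F x * F y)"
    by (rule lborel_pair.Fubini_integrable) (use F_int in \<open>auto simp: abs_mult F_nonneg\<close>)
  show "integral\<^sup>L lborel2 (\<lambda>(x, y). F x * F y) = M\<^sup>2"
    using lborel_pair.integral_fst[OF *] by (simp add: M_def power2_eq_square)
qed

text \<open>The gradient of \<open>u\<close> is replaced by its potential, which turns the integral
  into a double integral against \<open>F x * F y\<close>. Exchanging the variables again produces
  \<open>dil\<close> and a factor 1/2.\<close>

lemma integral_F_G: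
  assumes d: "0 < \<delta>"
  shows "(LBINT x. F x * G \<delta> x)
    = - c0 / 2 * integral\<^sup>L lborel2 (\<lambda>(x, y). F x * F y * (dil \<delta> x y / (norm (x - y))\<^sup>2))"
proof -
  define B where "B x y = F x * F y * (theta \<delta> x * ((x - y) \<bullet> x) / (norm (x - y))\<^sup>2)" for x y
  have [measurable]: "(\<lambda>(x, y). B x y) \<in> borel_measurable (borel \<Otimes>\<^sub>M borel)"
    unfolding B_def by measurable
  have t: "0 < theta \<delta> x" for x :: "real^4" using d by (intro theta_bounds) auto
  have iB: "integrable lborel2 (\<lambda>(x, y). B x y)"
  proof (rule integrable_dominated[OF integrable_mult_right[OF FF_singular_integrable, of "1 / \<delta> + 1"]])
    show "AE p in lborel2. norm (case p of (x, y) \<Rightarrow> B x y)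
      \<le> norm ((1 / \<delta> + 1) * (case p of (x, y) \<Rightarrow> F x * (F y / norm (x - y))))"
    proof (rule AE_I2)
      fix p :: "(real^4) \<times> (real^4)"
      obtain x y where p: "p = (x, y)" by (cases p)
      have FF: "0 \<le> F x * F y" using F_nonneg by simp
      have "\<bar>theta \<delta> x * ((x - y) \<bullet> x) / (norm (x - y))\<^sup>2\<bar> \<le> theta \<delta> x * (norm (x - y) * norm x) / (norm (x - y))\<^sup>2"
        unfolding abs_divide abs_mult abs_of_pos[OF t] abs_power2
        using t[of x] by (intro divide_right_mono mult_left_mono Cauchy_Schwarz_ineq2) auto
      also have "\<dots> = (theta \<delta> x * norm x) * (1 / norm (x - y))" by (simp add: power2_eq_square)
      also have "\<dots> \<le> (1 / \<delta> + 1) * (1 / norm (x - y))" by (intro mult_right_mono norm_theta_le d) auto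
      finally have "F x * F y * \<bar>theta \<delta> x * ((x - y) \<bullet> x) / (norm (x - y))\<^sup>2\<bar> \<le> F x * F y * ((1 / \<delta> + 1) * (1 / norm (x - y)))"
        by (rule mult_left_mono[OF _ FF])
      then have "\<bar>B x y\<bar> \<le> (1 / \<delta> + 1) * (F x * (F y / norm (x - y)))"
        unfolding B_def abs_mult[of "F x * F y"] abs_of_nonneg[OF FF] by (simp add: mult_ac)
      then show "norm (case p of (x, y) \<Rightarrow> B x y) \<le> norm ((1 / \<delta> + 1) * (case p of (x, y) \<Rightarrow> F x * (F y / norm (x - y))))"
        unfolding p prod.case by (rule norm_le_normI)
    qed
  qed measurable
  have G: "F x * G \<delta> x = - c0 * (LBINT y. B x y)" for x
  proof -
    have "(\<lambda>h. \<Sum>b\<in>Basis. (h \<bullet> b) * partial_deriv b u x) = (\<lambda>h. - c0 * (LBINT y. ((x - y) \<bullet> h) / (norm (x - y))\<^sup>2 * F y))"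
      by (rule has_derivative_unique[OF has_derivative_partial_deriv[OF u_differentiable] u_has_derivative])
    then have "(\<Sum>b\<in>Basis. (x \<bullet> b) * partial_deriv b u x) = - c0 * (LBINT y. ((x - y) \<bullet> x) / (norm (x - y))\<^sup>2 * F y)"
      by meson
    then have "F x * G \<delta> x = - c0 * ((F x * theta \<delta> x) * (LBINT y. ((x - y) \<bullet> x) / (norm (x - y))\<^sup>2 * F y))"
      by (simp add: G_def)
    also have "(F x * theta \<delta> x) * (LBINT y. ((x - y) \<bullet> x) / (norm (x - y))\<^sup>2 * F y)
      = (LBINT y. (F x * theta \<delta> x) * (((x - y) \<bullet> x) / (norm (x - y))\<^sup>2 * F y))"
      by (rule integral_mult_right_zero[symmetric])
    also have "\<dots> = (LBINT y. B x y)"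
      by (intro Bochner_Integration.integral_cong) (auto simp: B_def)
    finally show ?thesis .
  qed
  have "(LBINT x. F x * G \<delta> x) = - c0 * (LBINT x. LBINT y. B x y)"
    unfolding G by (rule integral_mult_right_zero)
  also have "(LBINT x. LBINT y. B x y) = integral\<^sup>L lborel2 (\<lambda>(x, y). B x y)"
    by (rule lborel_pair.integral_fst[OF iB])
  finally have 1: "(LBINT x. F x * G \<delta> x) = - c0 * integral\<^sup>L lborel2 (\<lambda>(x, y). B x y)" .
  note sw = lborel_pair_swap[OF iB]
  have "2 * integral\<^sup>L lborel2 (\<lambda>(x, y). B x y)
    = integral\<^sup>L lborel2 (\<lambda>p. (case p of (x, y) \<Rightarrow> B x y) + (case p of (x, y) \<Rightarrow> B y x))"
    using iB sw by simp
  also have "\<dots> = integral\<^sup>L lborel2 (\<lambda>(x, y). F x * F y * (dil \<delta> x y / (norm (x - y))\<^sup>2))"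
  proof (intro Bochner_Integration.integral_cong refl, clarify)
    fix x y :: "real^4"
    have "dil \<delta> x y = theta \<delta> x * ((x - y) \<bullet> x) + theta \<delta> y * ((y - x) \<bullet> y)"
      by (simp add: dil_def inner_diff inner_commute algebra_simps)
    then have "dil \<delta> x y / (norm (x - y))\<^sup>2 = theta \<delta> x * ((x - y) \<bullet> x) / (norm (x - y))\<^sup>2 + theta \<delta> y * ((y - x) \<bullet> y) / (norm (y - x))\<^sup>2"
      unfolding norm_minus_commute[of y x] by (simp only: add_divide_distrib)
    then show "B x y + B y x = F x * F y * (dil \<delta> x y / (norm (x - y))\<^sup>2)"
      unfolding B_def by (simp only: distrib_left mult.commute[of "F y" "F x"])
  qed
  finally show ?thesis using 1 by simp
qed

lemma dil_quotient_bound: "0 \<le> \<delta> \<Longrightarrow> \<bar>dil \<delta> x y / (norm (x - y))\<^sup>2\<bar> \<le> 3"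
proof (cases "x = y")
  case False
  assume "0 \<le> \<delta>"
  moreover have "0 < (norm (x - y))\<^sup>2" using False by simp
  ultimately show ?thesis
    using dil_bound[of \<delta> x y] unfolding abs_divide abs_power2 by (simp only: pos_divide_le_eq)
qed simp

lemma theta_tendsto: "e \<longlonglongrightarrow> 0 \<Longrightarrow> (\<lambda>n. theta (e n) (x :: real^4)) \<longlonglongrightarrow> 1"
proof -
  assume e: "e \<longlonglongrightarrow> 0"
  have "(\<lambda>n. theta (e n) x) \<longlonglongrightarrow> 1 / (1 + 0 * (norm x)\<^sup>2)"
    unfolding theta_def using e by (intro tendsto_intros) auto
  then show ?thesis by simp
qed

lemma dil_tendsto:
  assumes "e \<longlonglongrightarrow> 0" "x \<noteq> (y :: real^4)"
  shows "(\<lambda>n. dil (e n) x y / (norm (x - y))\<^sup>2) \<longlonglongrightarrow> 1"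
proof -
  have "(\<lambda>n. dil (e n) x y / (norm (x - y))\<^sup>2) \<longlonglongrightarrow> ((1 *\<^sub>R x - 1 *\<^sub>R y) \<bullet> (x - y)) / (norm (x - y))\<^sup>2"
    unfolding dil_def using assms by (intro tendsto_intros theta_tendsto) auto
  moreover have "((1 *\<^sub>R x - 1 *\<^sub>R y) \<bullet> (x - y)) / (norm (x - y))\<^sup>2 = 1"
    using assms by (simp add: power2_norm_eq_inner)
  ultimately show ?thesis by simp
qed

text \<open>Off the diagonal the quotient tends to 1, and it is bounded by 3. The weight is left
  general because the limit is taken with both \<open>F x * F y\<close> and
  \<open>P\<close>.\<close>

lemma integral_dil_tendsto:
  assumes W: "integrable lborel2 (\<lambda>(x, y). W x y)" and W0: "\<And>x y. 0 \<le> W x y"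
    and e: "\<And>n. 0 \<le> e n" "e \<longlonglongrightarrow> 0"
  shows "(\<lambda>n. integral\<^sup>L lborel2 (\<lambda>(x, y). W x y * (dil (e n) x y / (norm (x - y :: real^4))\<^sup>2)))
    \<longlonglongrightarrow> integral\<^sup>L lborel2 (\<lambda>(x, y). W x y)"
proof (rule integral_dominated_convergence[where w = "\<lambda>p. 3 * (case p of (x, y) \<Rightarrow> W x y)"])
  have [measurable]: "(\<lambda>(x, y). W x y) \<in> borel_measurable lborel2" using W by auto
  show "(\<lambda>(x, y). W x y * (dil (e n) x y / (norm (x - y))\<^sup>2)) \<in> borel_measurable lborel2" for n
    by measurable
  show "(\<lambda>(x, y). W x y) \<in> borel_measurable lborel2" by fact
  show "integrable lborel2 (\<lambda>p. 3 * (case p of (x, y) \<Rightarrow> W x y))"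
    by (rule integrable_mult_right[OF W])
  show "AE p in lborel2. (\<lambda>n. case p of (x, y) \<Rightarrow> W x y * (dil (e n) x y / (norm (x - y))\<^sup>2))
      \<longlonglongrightarrow> (case p of (x, y) \<Rightarrow> W x y)"
    using AE_lborel_off_diagonal
  proof eventually_elim
    case (elim p)
    obtain x y where p: "p = (x, y)" by (cases p)
    show ?case unfolding p prod.case
      using tendsto_mult_left[OF dil_tendsto[OF e(2), of x y], of "W x y"] elim p by simp
  qed
  show "AE p in lborel2. norm (case p of (x, y) \<Rightarrow> W x y * (dil (e n) x y / (norm (x - y))\<^sup>2)) \<le> 3 * (case p of (x, y) \<Rightarrow> W x y)" for n
  proof (rule AE_I2)
    fix p :: "(real^4) \<times> (real^4)"
    obtain x y where p: "p = (x, y)" by (cases p)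
    show "norm (case p of (x, y) \<Rightarrow> W x y * (dil (e n) x y / (norm (x - y))\<^sup>2)) \<le> 3 * (case p of (x, y) \<Rightarrow> W x y)"
      unfolding p prod.case real_norm_def abs_mult[of "W x y"] abs_of_nonneg[OF W0]
      using mult_left_mono[OF dil_quotient_bound[OF e(1), of n x y] W0[of x y]] by (simp only: mult.commute)
  qed
qed

text \<open>Let \<delta> tend to 0 in the truncated identity. The number 4 is the divergence of the
  dilation field, \<open>c0 / 2\<close> comes from symmetrising the logarithmic gradient, and
  \<open>\<alpha> / 2\<close> from the homogeneity of the kernel. The total integrals of
  \<open>F x * F y\<close> and \<open>P\<close> are \<open>M\<^sup>2\<close> and
  \<open>M\<close>.\<close>

lemma pohozaev: "4 * M - c0 / 2 * M\<^sup>2 = \<alpha> / 2 * M"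
proof -
  define e where "e n = 1 / real (Suc n)" for n
  have e: "0 < e n" "0 \<le> e n" for n by (auto simp: e_def)
  have e0: "e \<longlonglongrightarrow> 0" unfolding e_def[abs_def] using LIMSEQ_inverse_real_of_nat by (simp add: inverse_eq_divide)
  have L1: "(\<lambda>n. LBINT x. F x * divX (e n) x) \<longlonglongrightarrow> (LBINT x. F x * 4)"
  \<comment> \<open>The 6 is the dimension plus 2, from \<open>divX_bound\<close>.\<close>
  proof (rule integral_dominated_convergence[where w = "\<lambda>x. F x * 6"])
    show "AE x in lborel. (\<lambda>n. F x * divX (e n) x) \<longlonglongrightarrow> F x * 4"
    proof (rule AE_I2, rule tendsto_mult_left)
      fix x :: "real^4"
      have "(\<lambda>n. divX (e n) x) \<longlonglongrightarrow> real DIM(real^4) * 1 - 2 * 0 * (norm x)\<^sup>2 * 1\<^sup>2"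
        unfolding divX_def by (intro tendsto_intros theta_tendsto e0)
      then show "(\<lambda>n. divX (e n) x) \<longlonglongrightarrow> 4" by simp
    qed
    show "AE x in lborel. norm (F x * divX (e n) x) \<le> F x * 6" for n
    proof (rule AE_I2)
      fix x :: "real^4"
      have "\<bar>divX (e n) x\<bar> \<le> 6" using divX_bound[OF e(2), of n x] by simp
      then show "norm (F x * divX (e n) x) \<le> F x * 6"
        using mult_left_mono[of "\<bar>divX (e n) x\<bar>" 6 "F x"] F_nonneg[of x] by (simp add: abs_mult)
    qed
    show "integrable lborel (\<lambda>x. F x * 6)" using F_int by simp
  qed measurable
  have L2: "(\<lambda>n. LBINT x. F x * G (e n) x) \<longlonglongrightarrow> - c0 / 2 * M\<^sup>2"
    unfolding integral_F_G[OF e(1)] FF_integral[symmetric]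
    by (intro tendsto_mult_left integral_dil_tendsto FF_integrable e e0) (simp add: F_nonneg)
  have L3: "(\<lambda>n. LBINT x. F x * (divX (e n) x + G (e n) x)) \<longlonglongrightarrow> \<alpha> / 2 * integral\<^sup>L lborel2 (\<lambda>(x, y). P x y)"
    unfolding pohozaev_truncated[OF e(1)]
    by (intro tendsto_mult_left integral_dil_tendsto P_integrable P_nonneg e e0)
  have PM: "integral\<^sup>L lborel2 (\<lambda>(x, y). P x y) = M"
    using lborel_pair.integral_fst[OF P_integrable] by (simp add: P_row M_def)
  have "(LBINT x. F x * (divX (e n) x + G (e n) x)) = (LBINT x. F x * divX (e n) x) + (LBINT x. F x * G (e n) x)" for n
  proof -
    obtain C where C: "0 \<le> C" "\<And>x. \<bar>G (e n) x\<bar> \<le> C" using G_bound[OF e(1)] by blast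
    have "integrable lborel (\<lambda>x. F x * divX (e n) x)"
    proof (rule integrable_dominated[OF integrable_mult_left[OF F_int, of 6]])
      show "AE x in lborel. norm (F x * divX (e n) x) \<le> norm (F x * 6)"
      proof (rule AE_I2)
        fix x :: "real^4"
        have "\<bar>divX (e n) x\<bar> \<le> 6" using divX_bound[OF e(2), of n x] by simp
        then show "norm (F x * divX (e n) x) \<le> norm (F x * 6)"
          using mult_left_mono[of "\<bar>divX (e n) x\<bar>" 6 "F x"] F_nonneg[of x] by (simp add: abs_mult)
      qed
    qed measurable
    moreover have "integrable lborel (\<lambda>x. F x * G (e n) x)"
    proof (rule integrable_dominated[OF integrable_mult_left[OF F_int, of C]])
      show "AE x in lborel. norm (F x * G (e n) x) \<le> norm (F x * C)"
      proof (rule AE_I2)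
        fix x
        show "norm (F x * G (e n) x) \<le> norm (F x * C)"
          using mult_left_mono[OF C(2)[of x], of "F x"] F_nonneg[of x] C(1) by (simp add: abs_mult)
      qed
    qed measurable
    ultimately show ?thesis by (simp add: distrib_left)
  qed
  then have "(\<lambda>n. LBINT x. F x * (divX (e n) x + G (e n) x)) \<longlonglongrightarrow> (LBINT x. F x * 4) + - c0 / 2 * M\<^sup>2"
    using tendsto_add[OF L1 L2] by simp
  from LIMSEQ_unique[OF this L3] show ?thesis unfolding PM by (simp add: M_def)
qed

text \<open>\<open>I\<close> integrates a function that is positive off one point, so
  \<open>F\<close> has no zeros. Positivity permits cancelling one \<open>M\<close> in the quadratic
  identity.\<close>

lemma M_pos: "0 < M"
proof (rule ccontr)
  assume "\<not> 0 < M"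
  then have "M = 0" using M_nonneg by simp
  then have "AE x in lborel. F x = 0"
    using integral_nonneg_eq_0_iff_AE[OF F_int] F_nonneg by (simp add: M_def)
  moreover have "F x \<noteq> 0" for x
  proof
    assume "F x = 0"
    then have "(LBINT y. exp (u y) / norm (x - y) powr \<alpha>) = 0" by (simp add: F_eq I_eq)
    then have "AE y in lborel. exp (u y) / norm (x - y) powr \<alpha> = 0"
      using integral_nonneg_eq_0_iff_AE[OF choquard_integrable] by simp
    then have "AE y in (lborel :: (real^4) measure). False"
      using AE_lborel_singleton[of x] by eventually_elim auto
    then show False by (simp add: not_AE_lborel_False)
  qed
  ultimately have "AE y in (lborel :: (real^4) measure). False" by simp
  then show False by (simp add: not_AE_lborel_False)
qed

lemma total_mass: "c0 * M = 8 - \<alpha>"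
proof -
  have "M * (4 - c0 / 2 * M) = M * (\<alpha> / 2)" using pohozaev by (simp add: power2_eq_square algebra_simps)
  then have "4 - c0 / 2 * M = \<alpha> / 2" using M_pos by simp
  then show ?thesis by simp
qed

end

section \<open>Behaviour at infinity and the conclusion\<close>

context choquard
begin

text \<open>The logarithmic integrability at the origin suffices, because
  \<open>ln (1 + norm y)\<close> exceeds \<open>\<bar>ln (norm y)\<bar>\<close> by at most
  \<open>ln 2\<close>.\<close>

lemma F_log_weight: "integrable lborel (\<lambda>y. ln (1 + norm y) * F y)"
proof (rule integrable_dominated)
  have "integrable lborel (\<lambda>y. \<bar>ln (norm (0 - y)) * F y\<bar>)" by (rule integrable_abs[OF F_log])
  then show "integrable lborel (\<lambda>y. ln 2 * F y + \<bar>ln (norm (0 - y)) * F y\<bar>)"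
    by (rule Bochner_Integration.integrable_add[OF integrable_mult_right[OF F_int]])
  show "AE y in lborel. norm (ln (1 + norm y) * F y) \<le> norm (ln 2 * F y + \<bar>ln (norm (0 - y)) * F y\<bar>)"
  proof (intro AE_I2 norm_le_normI)
    fix y :: "real^4"
    have "ln (1 + norm y) \<le> ln 2 + \<bar>ln (norm y)\<bar>"
    proof (cases "norm y \<le> 1")
      case True
      then have "ln (1 + norm y) \<le> ln 2" by (simp add: add_pos_nonneg)
      then show ?thesis by simp
    next
      case False
      then have "ln (1 + norm y) \<le> ln (2 * norm y)" by (subst ln_le_cancel_iff) auto
      also have "\<dots> = ln 2 + ln (norm y)" using False by (subst ln_mult) auto
      finally show ?thesis by simp
    qed
    then have "ln (1 + norm y) * F y \<le> (ln 2 + \<bar>ln (norm y)\<bar>) * F y"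
      using F_nonneg by (intro mult_right_mono)
    then show "\<bar>ln (1 + norm y) * F y\<bar> \<le> ln 2 * F y + \<bar>ln (norm (0 - y)) * F y\<bar>"
      using F_nonneg[of y] by (simp add: abs_mult distrib_right)
  qed
qed measurable

text \<open>The inequality \<open>norm (x - y) \<le> (1 + norm x) * (1 + norm y)\<close> separates
  the variables under the logarithm, leaving the mass \<open>M\<close> and the logarithmic moment of
  \<open>F\<close>.\<close>

lemma u_lower_bound: "\<exists>A. \<forall>x. - A - c0 * M * ln (1 + norm x) \<le> u x"
proof -
  define L where "L = (LBINT y. ln (1 + norm y) * F y)"
  have "- (c0 * L - C0) - c0 * M * ln (1 + norm x) \<le> u x" for x
  proof -
    have "(LBINT y. ln (norm (x - y)) * F y) \<le> (LBINT y. ln (1 + norm x) * F y + ln (1 + norm y) * F y)"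
    proof (rule integral_mono[OF F_log])
      show "integrable lborel (\<lambda>y. ln (1 + norm x) * F y + ln (1 + norm y) * F y)"
        by (rule Bochner_Integration.integrable_add[OF integrable_mult_right[OF F_int] F_log_weight])
      fix y
      have "ln (norm (x - y)) \<le> ln (1 + norm x) + ln (1 + norm y)"
      \<comment> \<open>On the diagonal \<open>ln 0 = 0\<close> by convention, and the right side is
        nonnegative.\<close>
      proof (cases "x = y")
        case False
        have "norm (x - y) \<le> (1 + norm x) * (1 + norm y)"
        proof -
          have "(1 + norm x) * (1 + norm y) = 1 + norm x + norm y + norm x * norm y"
            by (simp add: algebra_simps)
          then show ?thesis
            using norm_triangle_ineq4[of x y] mult_nonneg_nonneg[OF norm_ge_zero[of x] norm_ge_zero[of y]]
            by linarith
        qed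
        then have "ln (norm (x - y)) \<le> ln ((1 + norm x) * (1 + norm y))"
          using False by (subst ln_le_cancel_iff) (auto intro!: mult_pos_pos add_pos_nonneg)
        also have "\<dots> = ln (1 + norm x) + ln (1 + norm y)"
          by (rule ln_mult_pos) (auto intro!: add_pos_nonneg)
        finally show ?thesis .
      qed simp
      then have "ln (norm (x - y)) * F y \<le> (ln (1 + norm x) + ln (1 + norm y)) * F y"
        using F_nonneg by (intro mult_right_mono)
      then show "ln (norm (x - y)) * F y \<le> ln (1 + norm x) * F y + ln (1 + norm y) * F y"
        by (simp add: distrib_right)
    qed
    also have "\<dots> = ln (1 + norm x) * M + L"
      using F_int F_log_weight by (simp add: M_def L_def)
    finally have "c0 * (LBINT y. ln (norm (x - y)) * F y) \<le> c0 * (ln (1 + norm x) * M + L)"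
      using c0_pos by (intro mult_left_mono) auto
    moreover have "u x = - (c0 * (LBINT y. ln (norm (x - y)) * F y)) + C0" using u_eq'[of x] by simp
    ultimately show ?thesis by (simp add: algebra_simps)
  qed
  then show ?thesis by blast
qed

text \<open>The upper bound is constant and the lower one logarithmic. The common linear form is
  enough for growth of order \<open>o(norm x ^ 2)\<close> and is preserved by affine changes of
  \<open>u\<close>.\<close>

lemma u_linear_growth: "\<exists>A\<ge>0. \<forall>x. \<bar>u x\<bar> \<le> A * (1 + norm x)"
proof -
  obtain K where K: "\<And>x. u x \<le> K" using u_bounded_above by blast
  obtain A where A: "\<And>x. - A - c0 * M * ln (1 + norm x) \<le> u x" using u_lower_bound by blast
  have cM: "0 \<le> c0 * M" using c0_pos M_nonneg by simp
  define B where "B = \<bar>K\<bar> + \<bar>A\<bar> + c0 * M"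
  have "\<bar>u x\<bar> \<le> B * (1 + norm x)" for x
  proof -
    have "ln (1 + norm x) \<le> norm x" using ln_add_one_self_le_self[of "norm x"] by simp
    then have "c0 * M * ln (1 + norm x) \<le> c0 * M * norm x" using cM by (rule mult_left_mono)
    then have "\<bar>u x\<bar> \<le> \<bar>K\<bar> + \<bar>A\<bar> + c0 * M * norm x"
      using K[of x] A[of x] mult_nonneg_nonneg[OF cM norm_ge_zero[of x]] by linarith
    moreover have "0 \<le> (\<bar>K\<bar> + \<bar>A\<bar>) * norm x" by simp
    moreover have "B * (1 + norm x) = \<bar>K\<bar> + \<bar>A\<bar> + c0 * M + ((\<bar>K\<bar> + \<bar>A\<bar>) * norm x + c0 * M * norm x)"
      by (simp add: B_def algebra_simps)
    ultimately show ?thesis using cM by linarith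
  qed
  moreover have "B \<ge> 0" using cM by (simp add: B_def)
  ultimately show ?thesis by blast
qed

text \<open>A large ball already carries more than \<open>s / c0\<close> of the mass, with
  \<open>s > 4\<close>. Seen from far away, this mass lies at distance at least
  \<open>norm x / 2\<close> and pushes \<open>u\<close> below \<open>- s * ln (norm x / 2)\<close>
  up to a constant. The remaining mass could raise \<open>u\<close> only near \<open>x\<close>,
  where a bounded potential controls it. Hence \<open>exp u\<close> decays faster than the power
  -4.\<close>

lemma exp_u_integrable: "integrable lborel (\<lambda>x. exp (u x))"
proof -
  \<comment> \<open>The midpoint between the critical exponent 4 and the value
    \<open>8 - \<alpha>\<close> of \<open>c0 * M\<close>.\<close>
  define s where "s = (4 + (8 - \<alpha>)) / 2"
  have s: "4 < s" "s < c0 * M" using \<alpha> by (auto simp: s_def total_mass)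
  have "(\<lambda>n. LBINT y. F y * indicator {..real n} (norm y)) \<longlonglongrightarrow> (LBINT y. F y)"
  proof (rule integral_dominated_convergence[where w = F])
    show "AE y in lborel. (\<lambda>n. F y * indicator {..real n} (norm y)) \<longlonglongrightarrow> F y"
    proof (rule AE_I2, rule tendsto_eventually)
      fix y :: "real^4"
      obtain N where "norm y \<le> real N" using real_arch_simple by blast
      then show "\<forall>\<^sub>F n in sequentially. F y * indicator {..real n} (norm y) = F y"
        by (intro eventually_sequentiallyI[of N]) auto
    qed
  qed (use F_int F_nonneg in \<open>auto simp: indicator_def\<close>)
  then have "(\<lambda>n. c0 * (LBINT y. F y * indicator {..real n} (norm y))) \<longlonglongrightarrow> c0 * M"
    unfolding M_def by (rule tendsto_mult_left)
  from order_tendstoD(1)[OF this s(2)] obtain n where n: "s < c0 * (LBINT y. F y * indicator {..real n} (norm y))"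
    by (auto simp: eventually_sequentially)
  define R0 where "R0 = real n"
  define M1 where "M1 = (LBINT y. F y * indicator {..R0} (norm y))"
  have M1: "s < c0 * M1" using n by (simp add: M1_def R0_def)
  have i1: "integrable lborel (\<lambda>y. F y * indicator {..R0} (norm y))"
    by (rule integrable_dominated[OF F_int]) (auto simp: indicator_def)
  obtain K1 where K1: "\<And>x. (LBINT y. F y / norm (x - y) powr 1) \<le> K1"
    using F_singular_integral_bound[of 1] by auto
  obtain K where K: "\<And>x. u x \<le> K" using u_bounded_above by blast
  \<comment> \<open>The radius makes \<open>norm x / 2\<close> at least \<open>R0 + 1\<close>: the
    logarithm is nonnegative and every \<open>y\<close> with \<open>norm y \<le> R0\<close> is at
    distance at least \<open>norm x / 2\<close>.\<close>
  have far: "u x \<le> (c0 * K1 + C0) - s * ln (norm x / 2)" if x: "norm x \<ge> 2 * R0 + 2" for x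
  proof -
    have R0: "R0 \<ge> 0" by (simp add: R0_def)
    have lx: "0 \<le> ln (norm x / 2)" using x R0 by (intro ln_ge_zero) auto
    have "(LBINT y. ln (norm x / 2) * (F y * indicator {..R0} (norm y)) - F y / norm (x - y)) \<le> (LBINT y. ln (norm (x - y)) * F y)"
    proof (rule integral_mono[OF _ F_log])
      show "integrable lborel (\<lambda>y. ln (norm x / 2) * (F y * indicator {..R0} (norm y)) - F y / norm (x - y))"
        by (rule Bochner_Integration.integrable_diff[OF integrable_mult_right[OF i1] F_div_norm])
      fix y
      have q: "0 \<le> F y / norm (x - y)" using F_nonneg by simp
      show "ln (norm x / 2) * (F y * indicator {..R0} (norm y)) - F y / norm (x - y) \<le> ln (norm (x - y)) * F y"
      proof (cases "norm y \<le> R0")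
        case True
        have "norm x \<le> norm (x - y) + norm y" using norm_triangle_ineq[of "x - y" y] by simp
        then have "norm x / 2 \<le> norm (x - y)" using True x by simp
        moreover have "0 < norm x / 2" using x R0 by linarith
        ultimately have "ln (norm x / 2) \<le> ln (norm (x - y))" by (subst ln_le_cancel_iff) auto
        then have "ln (norm x / 2) * F y \<le> ln (norm (x - y)) * F y" using F_nonneg by (rule mult_right_mono)
        then show ?thesis using True q by simp
      next
        case False
        \<comment> \<open>This is \<open>ln t \<le> t - 1\<close> at the reciprocal distance; at
          \<open>x = y\<close> both sides are 0 by convention.\<close>
        have "- (1 / norm (x - y)) \<le> ln (norm (x - y))"
        proof (cases "x = y")
          case False
          then show ?thesis using ln_le_minus_one[of "1 / norm (x - y)"] by (simp add: ln_div)
        qed simp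
        then have "- (1 / norm (x - y)) * F y \<le> ln (norm (x - y)) * F y" using F_nonneg by (rule mult_right_mono)
        then show ?thesis using False by simp
      qed
    qed
    moreover have "(LBINT y. ln (norm x / 2) * (F y * indicator {..R0} (norm y)) - F y / norm (x - y))
      = ln (norm x / 2) * M1 - (LBINT y. F y / norm (x - y))"
      using i1 F_div_norm[of x] by (simp add: M1_def)
    ultimately have "ln (norm x / 2) * M1 - K1 \<le> (LBINT y. ln (norm (x - y)) * F y)"
      using K1[of x] by simp
    then have "c0 * (ln (norm x / 2) * M1 - K1) \<le> c0 * (LBINT y. ln (norm (x - y)) * F y)"
      using c0_pos by (intro mult_left_mono) auto
    moreover have "u x = - (c0 * (LBINT y. ln (norm (x - y)) * F y)) + C0" using u_eq'[of x] by simp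
    moreover have "s * ln (norm x / 2) \<le> (c0 * M1) * ln (norm x / 2)" using M1 lx by (intro mult_right_mono) auto
    ultimately show ?thesis by (simp add: algebra_simps)
  qed
  \<comment> \<open>The power of 4 comes from \<open>(1 + norm x) / 4 \<le> norm x / 2\<close> in
    the far region; the second entry covers the bounded region, where
    \<open>1 + norm x \<le> 2 * R0 + 3\<close> and \<open>u \<le> K\<close>.\<close>
  define A where "A = max (exp (c0 * K1 + C0) * 4 powr s) (exp K * (2 * R0 + 3) powr s)"
  have bd: "exp (u x) \<le> A * (1 + norm x) powr (- s)" for x
  proof (cases "norm x \<ge> 2 * R0 + 2")
    case True
    have R0: "R0 \<ge> 0" by (simp add: R0_def)
    have nx: "0 < norm x / 2" "0 < (1 + norm x) / 4" "(1 + norm x) / 4 \<le> norm x / 2" using True R0 by auto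
    have "exp (u x) \<le> exp ((c0 * K1 + C0) + (- s) * ln (norm x / 2))" using far[OF True] by simp
    also have "\<dots> = exp (c0 * K1 + C0) * (norm x / 2) powr (- s)"
      by (subst exp_add) (use nx in \<open>simp add: powr_def\<close>)
    also have "\<dots> \<le> exp (c0 * K1 + C0) * ((1 + norm x) / 4) powr (- s)"
      using nx s by (intro mult_left_mono powr_mono2') auto
    also have "((1 + norm x) / 4) powr (- s) = 4 powr s * (1 + norm x) powr (- s)"
    proof -
      have "((1 + norm x) / 4) powr (- s) = (1 + norm x) powr (- s) / 4 powr (- s)"
        by (rule powr_divide)
      also have "\<dots> = (1 + norm x) powr (- s) / inverse (4 powr s)" by (simp only: powr_minus[of 4])
      also have "\<dots> = 4 powr s * (1 + norm x) powr (- s)"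
        by (simp only: divide_inverse inverse_inverse_eq mult.commute)
      finally show ?thesis .
    qed
    also have "exp (c0 * K1 + C0) * (4 powr s * (1 + norm x) powr (- s)) \<le> A * (1 + norm x) powr (- s)"
      unfolding A_def mult.assoc[symmetric] by (intro mult_right_mono) auto
    finally show ?thesis .
  next
    case False
    have "(1 + norm x) powr s \<le> (2 * R0 + 3) powr s" using False s by (intro powr_mono2) auto
    then have "(1 + norm x) powr s * inverse ((1 + norm x) powr s) \<le> (2 * R0 + 3) powr s * inverse ((1 + norm x) powr s)"
      by (rule mult_right_mono) simp
    moreover have "0 < 1 + norm x" by (simp add: add_pos_nonneg)
    then have "(1 + norm x) powr s * inverse ((1 + norm x) powr s) = 1" by (intro right_inverse) simp
    ultimately have "1 \<le> (2 * R0 + 3) powr s * (1 + norm x) powr (- s)"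
      unfolding powr_minus by linarith
    then have "exp K * 1 \<le> exp K * ((2 * R0 + 3) powr s * (1 + norm x) powr (- s))" by (intro mult_left_mono) auto
    moreover have "exp (u x) \<le> exp K" using K by simp
    ultimately have "exp (u x) \<le> exp K * (2 * R0 + 3) powr s * (1 + norm x) powr (- s)"
      unfolding mult_1_right mult.assoc by (rule order_trans[rotated])
    also have "\<dots> \<le> A * (1 + norm x) powr (- s)" unfolding A_def by (intro mult_right_mono) auto
    finally show ?thesis .
  qed
  show ?thesis
  proof (rule integrable_dominated)
    show "integrable lborel (\<lambda>x::real^4. A * (1 + norm x) powr (- s))"
      using s by (intro integrable_mult_right integrable_powr_tail) auto
    show "AE x in lborel. norm (exp (u x)) \<le> norm (A * (1 + norm x) powr (- s))"
      by (intro AE_I2 norm_le_normI) (simp add: bd)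
  qed measurable
qed

end

lemma smallo_norm_square:
  fixes v :: "'a::real_normed_vector \<Rightarrow> real"
  assumes "\<And>x. \<bar>v x\<bar> \<le> A * (1 + norm x)"
  shows "v \<in> o[at_infinity](\<lambda>x. (norm x)\<^sup>2)"
proof (rule landau_o.smallI)
  fix c :: real assume c: "c > 0"
  have A: "0 \<le> A" using assms[of 0] by simp
  show "\<forall>\<^sub>F x in at_infinity. norm (v x) \<le> c * norm ((norm x)\<^sup>2)"
    unfolding eventually_at_infinity
  proof (intro exI allI impI)
    fix x :: 'a assume x: "norm x \<ge> max 1 (2 * A / c)"
    have "\<bar>v x\<bar> \<le> A * (2 * norm x)" using assms[of x] x A mult_left_mono[of "1 + norm x" "2 * norm x" A] by linarith
    also have "\<dots> = (2 * A) * norm x" by simp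
    also have "\<dots> \<le> (c * norm x) * norm x"
      using x c by (intro mult_right_mono) (auto simp: pos_divide_le_eq mult.commute)
    finally show "norm (v x) \<le> c * norm ((norm x)\<^sup>2)" by (simp add: power2_eq_square mult.assoc)
  qed
qed

section \<open>The affine change of unknown\<close>

lemma partial_deriv_affine:
  fixes f :: "'a::euclidean_space \<Rightarrow> real"
  assumes "\<And>x. f differentiable (at x)"
  shows "partial_deriv b (\<lambda>x. c * f x + k) = (\<lambda>x. c * partial_deriv b f x)"
proof
  fix x
  obtain D where D: "(f has_derivative D) (at x)" using assms by (auto simp: differentiable_def)
  have "((\<lambda>x. c * f x + k) has_derivative (\<lambda>h. c * D h)) (at x)"
    by (auto intro!: derivative_eq_intros D)
  then show "partial_deriv b (\<lambda>x. c * f x + k) x = c * partial_deriv b f x"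
    by (simp add: partial_deriv_eqI[OF D] partial_deriv_eqI)
qed

lemma laplacian_affine:
  fixes f :: "'a::euclidean_space \<Rightarrow> real"
  assumes "C_diff 2 f"
  shows "laplacian (\<lambda>x. c * f x + k) = (\<lambda>x. c * laplacian f x)"
proof
  fix x
  have d: "f differentiable (at x)" "b \<in> Basis \<Longrightarrow> partial_deriv b f differentiable (at x)" for x b
    using assms by (auto simp: numeral_2_eq_2)
  show "laplacian (\<lambda>x. c * f x + k) x = c * laplacian f x"
    unfolding laplacian_def sum_distrib_left
  proof (rule sum.cong[OF refl])
    fix b :: 'a assume "b \<in> Basis"
    then show "partial_deriv b (partial_deriv b (\<lambda>x. c * f x + k)) x = c * partial_deriv b (partial_deriv b f) x"
      using partial_deriv_affine[OF d(1), of b c k] partial_deriv_affine[OF d(2), of b b c 0] by simp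
  qed
qed

lemma bilaplacian_affine:
  fixes f :: "'a::euclidean_space \<Rightarrow> real"
  assumes "C_diff 4 f"
  shows "bilaplacian (\<lambda>x. c * f x + k) = (\<lambda>x. c * bilaplacian f x)"
  using laplacian_affine[of f c k] laplacian_affine[of "laplacian f" c 0]
    C_diff_laplacian[of 2 f] assms C_diff_mono[of 2 4 f]
  by (simp add: bilaplacian_def del: C_diff.simps)

lemma ex_borel_version_lebesgue:
  fixes f :: "'a::euclidean_space \<Rightarrow> real"
  assumes "f \<in> borel_measurable lebesgue"
  shows "\<exists>g\<in>borel_measurable borel. AE x in lborel. f x = g x"
  using completion_ex_borel_measurable_real[OF assms] by auto

text \<open>Local integrability covers a ball around the origin; outside it the integrable product
  with the logarithm is divided by the logarithm. Writing the outer part as this quotient also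
  supplies its measurability.\<close>

lemma choquard_term_integrable:
  fixes u :: "real^4 \<Rightarrow> real"
  assumes loc: "locally_integrable (choquard_term \<alpha> u)"
    and log: "integrable lebesgue (\<lambda>y. ln (norm (0 - y)) * choquard_term \<alpha> u y)"
  shows "integrable lebesgue (choquard_term \<alpha> u)"
proof -
  let ?F = "choquard_term \<alpha> u"
  let ?B = "cball (0::real^4) 2"
  have 1: "integrable lebesgue (\<lambda>y. indicator ?B y *\<^sub>R ?F y)"
    using loc unfolding locally_integrable_def set_integrable_def by auto
  have [measurable]: "?B \<in> sets lebesgue" by simp
  have [measurable]: "(\<lambda>y. ln (norm (0 - y)) * ?F y) \<in> borel_measurable lebesgue" using log by auto
  have ln_m[measurable]: "(\<lambda>y::real^4. ln (norm (0 - y))) \<in> borel_measurable lebesgue"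
    by (intro measurable_completion) measurable
  \<comment> \<open>The ball has radius 2, not 1, so that the logarithm in the denominator is at
    least \<open>ln 2\<close> outside.\<close>
  have "integrable lebesgue (\<lambda>y. indicator (- ?B) y * ((ln (norm (0 - y)) * ?F y) / ln (norm (0 - y))))"
  proof (rule integrable_dominated[OF integrable_mult_right[OF log, of "1 / ln 2"]])
    show "(\<lambda>y. indicator (- ?B) y * ((ln (norm (0 - y)) * ?F y) / ln (norm (0 - y)))) \<in> borel_measurable lebesgue"
      by measurable
    show "AE y in lebesgue. norm (indicator (- ?B) y * ((ln (norm (0 - y)) * ?F y) / ln (norm (0 - y))))
      \<le> norm (1 / ln 2 * (ln (norm (0 - y)) * ?F y))"
    proof (rule AE_I2)
      fix y
      show "norm (indicator (- ?B) y * ((ln (norm (0 - y)) * ?F y) / ln (norm (0 - y)))) \<le> norm (1 / ln 2 * (ln (norm (0 - y)) * ?F y))"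
      proof (cases "y \<in> ?B")
        case False
        then have "ln 2 \<le> ln (norm y)" by (subst ln_le_cancel_iff) auto
        then have "1 \<le> \<bar>ln (norm y)\<bar> / ln 2" by simp
        from mult_right_mono[OF this, of "\<bar>?F y\<bar>"] show ?thesis using False by (auto simp: abs_mult)
      qed simp
    qed
  qed
  also have "(\<lambda>y. indicator (- ?B) y * ((ln (norm (0 - y)) * ?F y) / ln (norm (0 - y)))) = (\<lambda>y. indicator (- ?B) y * ?F y)"
  proof
    fix y :: "real^4"
    show "indicator (- ?B) y * ((ln (norm (0 - y)) * ?F y) / ln (norm (0 - y))) = indicator (- ?B) y * ?F y"
    proof (cases "y \<in> ?B")
      case False
      then have "ln (norm y) > 0" by (intro ln_gt_zero) auto
      then show ?thesis by simp
    qed simp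
  qed
  finally have 2: "integrable lebesgue (\<lambda>y. indicator (- ?B) y * ?F y)" .
  have "(\<lambda>y. indicator ?B y *\<^sub>R ?F y + indicator (- ?B) y * ?F y) = ?F" by (auto simp: indicator_def)
  then show ?thesis using Bochner_Integration.integrable_add[OF 1 2] by simp
qed

text \<open>
  A priori \<open>u\<close> is only Lebesgue measurable; the representation formula, with \<open>F\<close> replaced by a Borel
  version, shows that it is Borel measurable, so that Fubini's theorem for \<open>lborel\<close> applies.
\<close>

lemma normal_solution_choquard:
  assumes \<alpha>: "0 < \<alpha>" "\<alpha> < 4" and n: "normal_finite_mass_solution \<alpha> u"
  shows "\<exists>C0. choquard \<alpha> C0 u (\<lambda>x. LBINT y. exp (u y) / norm (x - y) powr \<alpha>) (choquard_term \<alpha> u)"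
proof -
  let ?F = "choquard_term \<alpha> u"
  obtain C0 where log: "\<And>x. integrable lebesgue (\<lambda>y. ln (norm (x - y)) * ?F y)"
    and ueq: "\<And>x. u x = - (1 / (8 * pi\<^sup>2)) * (LINT y|lebesgue. ln (norm (x - y)) * ?F y) + C0"
    using n by (auto simp: normal_finite_mass_solution_def)
  have mass: "integrable lebesgue (\<lambda>x. exp (8 / (8 - \<alpha>) * u x))"
    using n by (simp add: normal_finite_mass_solution_def)
  have int: "integrable lebesgue ?F"
    using n by (intro choquard_term_integrable log) (simp add: normal_finite_mass_solution_def distributional_solution_def)
  then have "?F \<in> borel_measurable lebesgue" by auto
  then obtain g where [measurable]: "g \<in> borel_measurable borel" and g: "AE x in lborel. ?F x = g x"
    using ex_borel_version_lebesgue by blast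
  have "(LINT y|lebesgue. ln (norm (x - y)) * ?F y) = (LBINT y. ln (norm (x - y)) * g y)" for x
  proof -
    have "(LINT y|lebesgue. ln (norm (x - y)) * ?F y) = (LINT y|lebesgue. ln (norm (x - y)) * g y)"
    proof (rule integral_cong_AE)
      show "(\<lambda>y. ln (norm (x - y)) * ?F y) \<in> borel_measurable lebesgue" using log by auto
      show "(\<lambda>y. ln (norm (x - y)) * g y) \<in> borel_measurable lebesgue"
        by (intro measurable_completion) measurable
      show "AE y in lebesgue. ln (norm (x - y)) * ?F y = ln (norm (x - y)) * g y"
        using AE_completion[OF g] by eventually_elim simp
    qed
    also have "\<dots> = (LBINT y. ln (norm (x - y)) * g y)"
      by (rule integral_completion) measurable
    finally show ?thesis .
  qed
  then have "u = (\<lambda>x. - (1 / (8 * pi\<^sup>2)) * (LBINT y. ln (norm (x - y)) * g y) + C0)"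
    using ueq by auto
  moreover have "(\<lambda>x. - (1 / (8 * pi\<^sup>2)) * (LBINT y. ln (norm (x - y)) * g y) + C0) \<in> borel_measurable borel"
    by measurable
  ultimately have u[measurable]: "u \<in> borel_measurable borel" by simp
  have F: "?F = (\<lambda>x. (LBINT y. exp (u y) / norm (x - y) powr \<alpha>) * exp (u x))"
  proof
    fix x
    have "(LINT y|lebesgue. exp (u y) / norm (x - y) powr \<alpha>) = (LBINT y. exp (u y) / norm (x - y) powr \<alpha>)"
      by (rule integral_completion) measurable
    then show "?F x = (LBINT y. exp (u y) / norm (x - y) powr \<alpha>) * exp (u x)"
      by (simp add: choquard_term_def)
  qed
  have [measurable]: "?F \<in> borel_measurable borel" unfolding F by measurable
  have "choquard \<alpha> C0 u (\<lambda>x. LBINT y. exp (u y) / norm (x - y) powr \<alpha>) ?F"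
  proof
    show "?F = (\<lambda>x. (LBINT y. exp (u y) / norm (x - y) powr \<alpha>) * exp (u x))" by (rule F)
    show "integrable lborel (\<lambda>x. exp (8 / (8 - \<alpha>) * u x))"
      using mass by (subst (asm) integrable_completion) measurable
    show "integrable lborel ?F" using int by (subst (asm) integrable_completion) measurable
    show "integrable lborel (\<lambda>y. ln (norm (x - y)) * ?F y)" for x
      using log[of x] by (subst (asm) integrable_completion) measurable
    have "(LINT y|lebesgue. ln (norm (x - y)) * ?F y) = (LBINT y. ln (norm (x - y)) * ?F y)" for x
      by (rule integral_completion) measurable
    then show "u x = - (1 / (8 * pi\<^sup>2)) * (LBINT y. ln (norm (x - y)) * ?F y) + C0" for x
      using ueq by simp
  qed (use \<alpha> u in auto)
  then show ?thesis ..
qed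

theorem proposition3p7:
  fixes \<alpha> b :: real and u v :: "real^4 \<Rightarrow> real"
  assumes "0 < \<alpha>" and "\<alpha> < 4"
    and "normal_finite_mass_solution \<alpha> u"
    and "b = (8 - \<alpha>) / 2"
    and "v = (\<lambda>x. 1 / b * (u x - 1 / 2 * ln b))"
  shows "classical_solution \<alpha> b v
    \<and> v \<in> o[at_infinity](\<lambda>x. (norm x)\<^sup>2)
    \<and> integrable lebesgue (\<lambda>x. exp (b * v x))
    \<and> (\<integral>\<^sup>+ y. \<integral>\<^sup>+ x. ennreal (exp (b * v x) * exp (b * v y) / norm (x - y) powr \<alpha>)
          \<partial>lebesgue \<partial>lebesgue) < \<infinity>
    \<and> niu_hypotheses \<alpha> v
    \<and> (niu_classification \<alpha> \<longrightarrow>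
        (\<exists>\<mu>>0. \<exists>\<zeta>. \<exists>c>0. \<forall>x.
           u x = (8 - \<alpha>) / 2 * ln (c * \<mu> / (1 + \<mu>\<^sup>2 * (norm (x - \<zeta>))\<^sup>2))))"
proof -
  obtain C0 where ch: "choquard \<alpha> C0 u (\<lambda>x. LBINT y. exp (u y) / norm (x - y) powr \<alpha>) (choquard_term \<alpha> u)"
    using normal_solution_choquard[OF assms(1-3)] by blast
  define I where "I = (\<lambda>x. LBINT y. exp (u y) / norm (x - y) powr \<alpha>)"
  define F where "F = choquard_term \<alpha> u"
  interpret choquard \<alpha> C0 u I F using ch unfolding I_def F_def .
  have b: "0 < b" using assms(1,2,4) by simp
  \<comment> \<open>\<open>E\<close> is the inverse square root of \<open>b\<close>. The right side
    of the equation is quadratic in the exponential, so it scales by \<open>E * E = 1 / b\<close>,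
    exactly as the bilaplacian does under division of \<open>u\<close> by \<open>b\<close>.\<close>
  define E where "E = exp (- (1 / 2 * ln b))"
  have "E * E = exp (- ln b)" unfolding E_def by (subst exp_add[symmetric]) simp
  then have E: "0 < E" "E * E = 1 / b"
    using b by (auto simp: E_def exp_minus inverse_eq_divide)
  have bv: "b * v x = u x - 1 / 2 * ln b" for x using b by (simp add: assms(5))
  have ebv: "exp (b * v x) = E * exp (u x)" for x
    unfolding bv E_def by (subst exp_add[symmetric]) simp
  have Em: "(\<lambda>y. exp (b * v y) / norm (x - y) powr \<alpha>) = (\<lambda>y. E * (exp (u y) / norm (x - y) powr \<alpha>))" for x
    by (auto simp: ebv)
  have dist: "(LBINT x. u x * bilaplacian \<phi> x) = (LBINT x. F x * \<phi> x)" if t: "test_function \<phi>" for \<phi>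
  proof -
    have c: "C_diff k \<phi>" for k using t by (simp add: test_function_def)
    have [measurable]: "\<phi> \<in> borel_measurable borel"
      using C_diff_continuous[OF c] by (rule borel_measurable_continuous_onI)
    have "C_diff 0 (bilaplacian \<phi>)"
      unfolding bilaplacian_def by (intro C_diff_laplacian c)
    then have [measurable]: "bilaplacian \<phi> \<in> borel_measurable borel"
      using C_diff_continuous by (intro borel_measurable_continuous_onI)
    have "(LINT x|lebesgue. u x * bilaplacian \<phi> x) = (LBINT x. u x * bilaplacian \<phi> x)"
      "(LINT x|lebesgue. F x * \<phi> x) = (LBINT x. F x * \<phi> x)"
      by (rule integral_completion; measurable)+
    moreover have "(LINT x|lebesgue. u x * bilaplacian \<phi> x) = (LINT x|lebesgue. F x * \<phi> x)"
      using assms(3) t unfolding normal_finite_mass_solution_def distributional_solution_def F_def by blast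
    ultimately show ?thesis by simp
  qed
  have v_affine: "v = (\<lambda>x. 1 / b * u x + - (1 / b * (1 / 2 * ln b)))"
    by (simp add: assms(5) right_diff_distrib)
  have classical: "classical_solution \<alpha> b v"
    unfolding classical_solution_def
  proof (intro conjI allI)
    show "C_diff 4 v"
      unfolding v_affine by (intro C_diff_add C_diff_cmult C_diff_const u_C_diff)
    fix x
    show "choquard_finite \<alpha> (\<lambda>y. b * v y) x"
      unfolding choquard_finite_def Em
      by (subst integrable_completion) (measurable, intro integrable_mult_right choquard_integrable)
    have "(LINT y|lebesgue. exp (b * v y) / norm (x - y) powr \<alpha>) = (LBINT y. E * (exp (u y) / norm (x - y) powr \<alpha>))"
      unfolding Em by (rule integral_completion) measurable
    also have "\<dots> = E * I x" unfolding I_def by (rule integral_mult_right_zero)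
    finally have "choquard_term \<alpha> (\<lambda>y. b * v y) x = (E * E) * F x"
      by (simp add: choquard_term_def ebv F_eq)
    also have "\<dots> = 1 / b * bilaplacian u x"
      using bilaplacian_u[OF dist] E by simp
    also have "\<dots> = bilaplacian v x"
      unfolding v_affine bilaplacian_affine[OF u_C_diff] ..
    finally show "bilaplacian v x = choquard_term \<alpha> (\<lambda>y. b * v y) x" ..
  qed
  obtain A where A: "A \<ge> 0" "\<And>x. \<bar>u x\<bar> \<le> A * (1 + norm x)" using u_linear_growth by blast
  have small: "v \<in> o[at_infinity](\<lambda>x. (norm x)\<^sup>2)"
  proof (rule smallo_norm_square)
    fix x
    have "\<bar>u x - 1 / 2 * ln b\<bar> \<le> (A + \<bar>1 / 2 * ln b\<bar>) * (1 + norm x)"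
    proof -
      have "0 \<le> \<bar>1 / 2 * ln b\<bar> * norm x" by simp
      then show ?thesis using A(2)[of x] unfolding distrib_right distrib_left by linarith
    qed
    from mult_left_mono[OF this, of "1 / b"]
    show "\<bar>v x\<bar> \<le> (1 / b * (A + \<bar>1 / 2 * ln b\<bar>)) * (1 + norm x)"
      using b by (simp add: assms(5) abs_mult mult.assoc)
  qed
  have expint: "integrable lebesgue (\<lambda>x. exp (b * v x))"
    unfolding ebv by (subst integrable_completion) (measurable, intro integrable_mult_right exp_u_integrable)
  have double: "(\<integral>\<^sup>+ y. \<integral>\<^sup>+ x. ennreal (exp (b * v x) * exp (b * v y) / norm (x - y) powr \<alpha>)
          \<partial>lebesgue \<partial>lebesgue) < \<infinity>"
  proof -
    \<comment> \<open>The inner integral reproduces the Choquard density, so the double integral is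
      \<open>E * E\<close> times the mass \<open>M\<close>.\<close>
    have "(\<integral>\<^sup>+ x. ennreal (exp (b * v x) * exp (b * v y) / norm (x - y) powr \<alpha>) \<partial>lebesgue) = ennreal (E * E) * ennreal (F y)" for y
    proof -
      have "(\<integral>\<^sup>+ x. ennreal (exp (b * v x) * exp (b * v y) / norm (x - y) powr \<alpha>) \<partial>lebesgue)
        = (\<integral>\<^sup>+ x. ennreal (E * E * exp (u y)) * ennreal (exp (u x) / norm (y - x) powr \<alpha>) \<partial>lborel)"
        unfolding nn_integral_completion
      proof (rule nn_integral_cong)
        fix x
        have "exp (b * v x) * exp (b * v y) / norm (x - y) powr \<alpha> = (E * E * exp (u y)) * (exp (u x) / norm (y - x) powr \<alpha>)"
          unfolding ebv norm_minus_commute[of x y] by (simp add: mult_ac)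
        then show "ennreal (exp (b * v x) * exp (b * v y) / norm (x - y) powr \<alpha>)
          = ennreal (E * E * exp (u y)) * ennreal (exp (u x) / norm (y - x) powr \<alpha>)"
          using E(1) by (simp only:) (rule ennreal_mult; simp)
      qed
      also have "\<dots> = ennreal (E * E * exp (u y)) * ennreal (I y)"
        by (subst nn_integral_cmult) (measurable, simp only: nn_I)
      also have "\<dots> = ennreal (E * E) * ennreal (F y)"
        using E(1) I_nonneg[of y] by (simp add: F_eq ennreal_mult[symmetric] mult_ac)
      finally show ?thesis .
    qed
    then have "(\<integral>\<^sup>+ y. \<integral>\<^sup>+ x. ennreal (exp (b * v x) * exp (b * v y) / norm (x - y) powr \<alpha>) \<partial>lebesgue \<partial>lebesgue)
      = (\<integral>\<^sup>+ y. ennreal (E * E) * ennreal (F y) \<partial>lborel)" by (simp add: nn_integral_completion)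
    also have "\<dots> = ennreal (E * E) * ennreal M"
      by (subst nn_integral_cmult) (measurable, simp only: nn_F)
    finally show ?thesis by (simp add: ennreal_mult_less_top)
  qed
  have niu: "niu_hypotheses \<alpha> v"
    using assms(1,2) classical small expint double unfolding niu_hypotheses_def assms(4) by simp
  have "\<exists>\<mu>>0. \<exists>\<zeta>. \<exists>c>0. \<forall>x. u x = (8 - \<alpha>) / 2 * ln (c * \<mu> / (1 + \<mu>\<^sup>2 * (norm (x - \<zeta>))\<^sup>2))"
    if nc: "niu_classification \<alpha>"
  proof -
    obtain \<mu> \<zeta> c where m: "\<mu> > 0" "c > 0" and vx: "\<And>x. v x = ln (c * \<mu> / (1 + \<mu>\<^sup>2 * (norm (x - \<zeta>))\<^sup>2))"
      using nc niu unfolding niu_classification_def by blast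
    \<comment> \<open>From \<open>u = b * v + ln b / 2\<close> the shift inside the factor
      \<open>b\<close> is \<open>ln b / (2 * b)\<close>; its exponential is absorbed into the
      constant.\<close>
    define c' where "c' = exp (ln b / (2 * b)) * c"
    have "u x = (8 - \<alpha>) / 2 * ln (c' * \<mu> / (1 + \<mu>\<^sup>2 * (norm (x - \<zeta>))\<^sup>2))" for x
    proof -
      define q where "q = c * \<mu> / (1 + \<mu>\<^sup>2 * (norm (x - \<zeta>))\<^sup>2)"
      have q: "0 < q" unfolding q_def using m by (intro divide_pos_pos add_pos_nonneg mult_pos_pos) auto
      have "c' * \<mu> / (1 + \<mu>\<^sup>2 * (norm (x - \<zeta>))\<^sup>2) = exp (ln b / (2 * b)) * q"
        by (simp add: c'_def q_def)
      then have "ln (c' * \<mu> / (1 + \<mu>\<^sup>2 * (norm (x - \<zeta>))\<^sup>2)) = ln b / (2 * b) + v x"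
        using q by (simp add: ln_mult_pos vx q_def[symmetric])
      then have "b * ln (c' * \<mu> / (1 + \<mu>\<^sup>2 * (norm (x - \<zeta>))\<^sup>2)) = u x"
        using bv[of x] b by (simp add: distrib_left)
      then show ?thesis by (simp add: assms(4))
    qed
    moreover have "c' > 0" using m by (simp add: c'_def)
    ultimately show ?thesis using m by blast
  qed
  then show ?thesis using classical small expint double niu by blast
qed

end
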